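(* If $t\ge 2$, $n\ge 20t^2+31t+12$ and $\pi=(d_1,\ldots,d_n)$ is a graphic sequence with $\sigma(\pi)>4tn-4t^2-2t$, then $\pi$ has a realization containing every 2-tree on $3t+2$ vertices as a subgraph.
   Context: A simple graph $G$ is a 2-tree if $G=K_3$, or $G$ has a vertex $v$ of degree 2 whose two neighbors are adjacent and $G-v$ is a 2-tree. A non-increasing sequence $\pi=(d_1,\ldots,d_n)$ of nonnegative integers is graphic if it is the degree sequence of some simple graph on $n$ vertices, called a realization of $\pi$. We write $\sigma(\pi)=d_1+\cdots+d_n$. *)

theory Defs
  imports "HOL-Library.Multiset"
begin

definition simple_graph :: "'a set \<Rightarrow> 'a set set \<Rightarrow> bool" where
  "simple_graph V E \<longleftrightarrow> finite V \<and> E \<subseteq> {e. e \<subseteq> V \<and> card e = 2}"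

definition complete_graph :: "'a set \<Rightarrow> 'a set set \<Rightarrow> bool" where
  "complete_graph V E \<longleftrightarrow> finite V \<and> E = {e. e \<subseteq> V \<and> card e = 2}"

definition neighbors :: "'a set set \<Rightarrow> 'a \<Rightarrow> 'a set" where
  "neighbors E v = {u. {u, v} \<in> E}"

definition degree :: "'a set set \<Rightarrow> 'a \<Rightarrow> nat" where
  "degree E v = card (neighbors E v)"

definition delete_vertex :: "'a set set \<Rightarrow> 'a \<Rightarrow> 'a set set" where
  "delete_vertex E v = {e \<in> E. v \<notin> e}"

inductive two_tree :: "'a set \<Rightarrow> 'a set set \<Rightarrow> bool" where
  K3: "two_tree V E" if "complete_graph V E" "card V = 3"
| extend: "two_tree V E"
    if "simple_graph V E" "v \<in> V" "degree E v = 2" "neighbors E v = {a, b}" "{a, b} \<in> E"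
      "two_tree (V - {v}) (delete_vertex E v)"

definition degree_sequence :: "'a set \<Rightarrow> 'a set set \<Rightarrow> nat list" where
  "degree_sequence V E = rev (sorted_list_of_multiset (image_mset (degree E) (mset_set V)))"

definition realization :: "'a set \<Rightarrow> 'a set set \<Rightarrow> nat list \<Rightarrow> bool" where
  "realization V E \<pi> \<longleftrightarrow> simple_graph V E \<and> degree_sequence V E = \<pi>"

text \<open>Finite graphs may be taken, up to isomorphism, with natural numbers as vertices.\<close>

definition graphic :: "nat list \<Rightarrow> bool" where
  "graphic \<pi> \<longleftrightarrow> sorted_wrt (\<ge>) \<pi> \<and> (\<exists>(V :: nat set) E. realization V E \<pi>)"

text \<open>Containment is up to isomorphism, and the copy need not be induced.\<close>

definition contains_subgraph ::
    "'a set \<Rightarrow> 'a set set \<Rightarrow> 'b set \<Rightarrow> 'b set set \<Rightarrow> bool" where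
  "contains_subgraph V E W F \<longleftrightarrow>
     (\<exists>f. inj_on f W \<and> f ` W \<subseteq> V \<and> (\<forall>e\<in>F. f ` e \<in> E))"

end

theory Submission imports Defs begin

text \<open>
  Fix the degrees and pass between realizations by switching two or three edges. Let \<open>L\<close> be the set of
  vertices of degree at least \<open>6t + 1\<close>. If \<open>L\<close> has at least \<open>3t + 2\<close> elements, switching produces a
  clique on \<open>3t + 2\<close> vertices. Otherwise take a target graph that contains every 2-tree on \<open>3t + 2\<close> vertices
  (a clique joined to a complete bipartite graph, one edge and isolated vertices), place its clique on
  vertices of \<open>L\<close>, and choose a realization that cannot be switched to contain one more target edge. The failure of
  all switches confines the edges outside \<open>L\<close> to the neighbourhoods of two vertices of small degree, up to
  the vertices of \<open>L\<close> that are not adjacent to both; counting degrees then contradicts the lower bound on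
  the degree sum, which is that of \<open>K\<^bsub>2t\<^esub>\<close> joined to \<open>n - 2t\<close> isolated vertices.
\<close>

text \<open>A 2-tree has a 3-colouring in which any two classes span a tree. Deleting the smallest
  class and enough of the middle one leaves so few edges that, with a clique of
  \<open>2t - j\<close> vertices, only a \<open>K_{j+1,2j}\<close> and one further edge have to be
  realized. Here \<open>j\<close> is the number of vertices that \<open>L\<close> lacks to reach
  \<open>2t\<close>, or 0. A failed switch leaves a set \<open>Z\<close> of \<open>L\<close> that
  has to be adjacent to both switching vertices. If \<open>Z\<close> has \<open>2t - i\<close>
  elements, the main term of the degree sum drops by about \<open>2in\<close>, while the errors are
  of order \<open>i t^2\<close>; the lower bound on \<open>n\<close> balances the two. With exactly
  \<open>2t\<close> dominating vertices this gain vanishes, and the one extra edge off the clique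
  comes from the strict inequality on the degree sum: the threshold graph has no such edge. The main
  obstacle is a switch through a vertex of \<open>L\<close> outside the chosen \<open>2t\<close>.
  Its neighbourhood is not bounded by \<open>6t\<close>, and a bound has to be won by comparing its
  degree with those of the chosen vertices.\<close>

definition realizes :: "'a set \<Rightarrow> ('a \<Rightarrow> nat) \<Rightarrow> 'a set set \<Rightarrow> bool" where
  "realizes V d E \<longleftrightarrow> simple_graph V E \<and> (\<forall>v\<in>V. degree E v = d v)"

definition closed_nbh :: "'a set set \<Rightarrow> 'a \<Rightarrow> 'a set" where
  "closed_nbh E v = insert v (neighbors E v)"

definition pairs :: "'a set \<Rightarrow> 'a set set" where
  "pairs V = {e. e \<subseteq> V \<and> card e = 2}"

text \<open>Quantifying over all realizations, not only those one switch away, makes the property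
  depend on \<open>E\<close> through \<open>E \<inter> H\<close> alone; it therefore survives
  switches that leave \<open>E \<inter> H\<close> unchanged.\<close>

definition stuck :: "'a set \<Rightarrow> ('a \<Rightarrow> nat) \<Rightarrow> 'a set set \<Rightarrow> 'a set set \<Rightarrow> 'a set \<Rightarrow> bool" where
  "stuck V d H E e \<longleftrightarrow> (\<nexists>E'. realizes V d E' \<and> insert e (E \<inter> H) \<subseteq> E')"

lemma pair_in_pairs [simp]: "{x, y} \<in> pairs V \<longleftrightarrow> x \<in> V \<and> y \<in> V \<and> x \<noteq> y"
  by (cases "x = y") (auto simp: pairs_def)

lemma pairsE:
  assumes "e \<in> pairs V"
  obtains x y where "e = {x, y}" "x \<noteq> y" "x \<in> V" "y \<in> V"
  using assms by (auto simp: pairs_def card_2_iff)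

lemma finite_pairs [simp]: "finite V \<Longrightarrow> finite (pairs V)"
  by (simp add: pairs_def)

lemma simple_graph_iff: "simple_graph V E \<longleftrightarrow> finite V \<and> E \<subseteq> pairs V"
  by (simp add: simple_graph_def pairs_def)

lemma in_neighbors_iff: "u \<in> neighbors E v \<longleftrightarrow> {u, v} \<in> E"
  by (simp add: neighbors_def)

lemma neighbors_commute: "u \<in> neighbors E v \<longleftrightarrow> v \<in> neighbors E u"
  by (simp add: neighbors_def insert_commute)

lemma closed_nbh_commute: "u \<in> closed_nbh E v \<longleftrightarrow> v \<in> closed_nbh E u"
  by (auto simp: closed_nbh_def neighbors_commute)

lemma simple_graph_edgeD:
  assumes "simple_graph V E" "{x, y} \<in> E"
  shows "x \<in> V" "y \<in> V" "x \<noteq> y"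
proof -
  have "{x, y} \<in> pairs V" using assms unfolding simple_graph_iff by blast
  then show "x \<in> V" "y \<in> V" "x \<noteq> y" unfolding pair_in_pairs by blast+
qed

lemma neighbors_subset: "simple_graph V E \<Longrightarrow> neighbors E v \<subseteq> V - {v}"
  using simple_graph_edgeD[of V E _ v] unfolding in_neighbors_iff[symmetric] by blast

lemma finite_neighbors: "simple_graph V E \<Longrightarrow> finite (neighbors E v)"
  by (meson finite_Diff finite_subset neighbors_subset simple_graph_iff)

lemma degree_eq_incident:
  assumes "simple_graph V E"
  shows "degree E v = card {e \<in> E. v \<in> e}"
proof -
  have "bij_betw (\<lambda>u. {u, v}) (neighbors E v) {e \<in> E. v \<in> e}"
  proof (rule bij_betwI')
    show "\<And>x y. x \<in> neighbors E v \<Longrightarrow> y \<in> neighbors E v \<Longrightarrow> ({x, v} = {y, v}) = (x = y)"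
      by (auto simp: doubleton_eq_iff)
    show "\<And>x. x \<in> neighbors E v \<Longrightarrow> {x, v} \<in> {e \<in> E. v \<in> e}"
      by (auto simp: in_neighbors_iff)
    fix e assume e: "e \<in> {e \<in> E. v \<in> e}"
    then have "e \<in> pairs V" using assms by (auto simp: simple_graph_iff)
    then obtain x y where "e = {x, y}" by (auto elim: pairsE)
    with e show "\<exists>x\<in>neighbors E v. e = {x, v}"
      by (auto simp: in_neighbors_iff insert_commute)
  qed
  then show ?thesis by (simp add: degree_def bij_betw_same_card)
qed

section \<open>Edge switches between realizations\<close>

lemma realizesD:
  assumes "realizes V d E"
  shows "simple_graph V E" "finite V" "E \<subseteq> pairs V" "finite E"
    "v \<in> V \<Longrightarrow> card (neighbors E v) = d v" "finite (neighbors E v)" "neighbors E v \<subseteq> V - {v}"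
proof -
  show s: "simple_graph V E" and f: "finite V" and p: "E \<subseteq> pairs V"
    using assms by (auto simp: realizes_def simple_graph_iff)
  show "finite E" using f p by (meson finite_pairs finite_subset)
  show "v \<in> V \<Longrightarrow> card (neighbors E v) = d v" using assms by (auto simp: realizes_def degree_def)
  show "finite (neighbors E v)" "neighbors E v \<subseteq> V - {v}"
    using finite_neighbors[OF s] neighbors_subset[OF s] by auto
qed

text \<open>Each vertex loses its edges in \<open>A\<close> and gains those in \<open>B\<close>; as
  \<open>A\<close> lies in \<open>E\<close> and \<open>B\<close> is disjoint from it, both counts
  are exact.\<close>

lemma realizes_exchange:
  assumes r: "realizes V d E" and A: "A \<subseteq> E" and B: "B \<inter> E = {}" "B \<subseteq> pairs V"
    and eq: "\<And>v. card {e \<in> A. v \<in> e} = card {e \<in> B. v \<in> e}"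
  shows "realizes V d (E - A \<union> B)"
proof -
  have s: "simple_graph V E" and fE: "finite E" and fV: "finite V"
    using realizesD[OF r] by auto
  have fA: "finite A" using A fE finite_subset by blast
  have fB: "finite B" using B(2) fV by (meson finite_pairs finite_subset)
  have s': "simple_graph V (E - A \<union> B)" using s B(2) by (auto simp: simple_graph_iff)
  have "degree (E - A \<union> B) v = degree E v" for v
  proof -
    have "{e \<in> E - A \<union> B. v \<in> e} = ({e \<in> E. v \<in> e} - {e \<in> A. v \<in> e}) \<union> {e \<in> B. v \<in> e}"
      by auto
    then have "card {e \<in> E - A \<union> B. v \<in> e}
      = card ({e \<in> E. v \<in> e} - {e \<in> A. v \<in> e}) + card {e \<in> B. v \<in> e}"
      using B(1) fE fB by (subst card_Un_disjoint[symmetric]) auto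
    also have "card ({e \<in> E. v \<in> e} - {e \<in> A. v \<in> e}) = card {e \<in> E. v \<in> e} - card {e \<in> A. v \<in> e}"
      using A fA by (intro card_Diff_subset) auto
    also have "\<dots> + card {e \<in> B. v \<in> e} = card {e \<in> E. v \<in> e}"
    proof -
      have "card {e \<in> A. v \<in> e} \<le> card {e \<in> E. v \<in> e}"
        using A fE by (intro card_mono) auto
      then show ?thesis using eq[of v] by simp
    qed
    finally show ?thesis
      using degree_eq_incident[OF s'] degree_eq_incident[OF s] by simp
  qed
  then show ?thesis using r s' by (simp add: realizes_def)
qed

lemma card_incident_insert:
  assumes "finite A" "a \<notin> A"
  shows "card {e \<in> insert a A. v \<in> e} = of_bool (v \<in> a) + card {e \<in> A. v \<in> e}"
proof -
  have "{e \<in> insert a A. v \<in> e} = (if v \<in> a then insert a {e \<in> A. v \<in> e} else {e \<in> A. v \<in> e})"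
    by auto
  then show ?thesis using assms by simp
qed

lemma card_incident_pair:
  assumes "a \<noteq> b"
  shows "card {e \<in> {a, b}. v \<in> e} = of_bool (v \<in> a) + of_bool (v \<in> b)"
  using card_incident_insert[of "{b}" a v] card_incident_insert[of "{}" b v] assms
  by (simp del: Collect_conv_if Collect_conv_if2)

lemma card_incident_triple:
  assumes "a \<noteq> b" "a \<noteq> c" "b \<noteq> c"
  shows "card {e \<in> {a, b, c}. v \<in> e} = of_bool (v \<in> a) + of_bool (v \<in> b) + of_bool (v \<in> c)"
  using card_incident_insert[of "{b, c}" a v] card_incident_pair[of b c v] assms by simp

lemma realizes_switch2:
  assumes r: "realizes V d E"
    and e: "{x, x'} \<in> E" "{y, y'} \<in> E" "{x, y} \<notin> E" "{x', y'} \<notin> E" "x \<noteq> y" "x' \<noteq> y'"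
  shows "realizes V d (E - {{x, x'}, {y, y'}} \<union> {{x, y}, {x', y'}})"
proof -
  note s = simple_graph_edgeD[OF realizesD(1)[OF r]]
  have d: "{x, x'} \<noteq> {y, y'}" "{x, y} \<noteq> {x', y'}" "x \<noteq> x'" "y \<noteq> y'"
    using e s(3)[OF e(1)] s(3)[OF e(2)] by (auto simp: doubleton_eq_iff insert_commute)
  show ?thesis
  proof (rule realizes_exchange[OF r])
    show "{{x, y}, {x', y'}} \<subseteq> pairs V" using e s(1,2) by auto
    fix v
    show "card {e \<in> {{x, x'}, {y, y'}}. v \<in> e} = card {e \<in> {{x, y}, {x', y'}}. v \<in> e}"
      unfolding card_incident_pair[OF d(1)] card_incident_pair[OF d(2)]
      using d(3,4) e(5,6) by simp
  qed (use e in auto)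
qed

text \<open>The edge \<open>{p, q}\<close> takes up the loose ends: \<open>p\<close> is joined to
  \<open>x'\<close> and \<open>q\<close> to \<open>y'\<close>. Unlike in the two-edge switch,
  \<open>x'\<close> and \<open>y'\<close> may be adjacent or even equal.\<close>

lemma realizes_switch3:
  assumes r: "realizes V d E"
    and e: "{x, x'} \<in> E" "{y, y'} \<in> E" "{p, q} \<in> E" "{x, y} \<notin> E" "x \<noteq> y"
    and n: "p \<notin> closed_nbh E x'" "q \<notin> closed_nbh E y'"
  shows "realizes V d (E - {{x, x'}, {y, y'}, {p, q}} \<union> {{x, y}, {x', p}, {y', q}})"
proof -
  note s = simple_graph_edgeD[OF realizesD(1)[OF r]]
  have n': "p \<noteq> x'" "{x', p} \<notin> E" "q \<noteq> y'" "{y', q} \<notin> E"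
    using n by (auto simp: closed_nbh_def in_neighbors_iff insert_commute)
  have d0: "x \<noteq> x'" "y \<noteq> y'" "p \<noteq> q" using s(3) e by auto
  have d: "{x, x'} \<noteq> {y, y'}" "{x, x'} \<noteq> {p, q}" "{y, y'} \<noteq> {p, q}"
    "{x, y} \<noteq> {x', p}" "{x, y} \<noteq> {y', q}" "{x', p} \<noteq> {y', q}"
    using e n' d0 by (auto simp: doubleton_eq_iff insert_commute)
  show ?thesis
  proof (rule realizes_exchange[OF r])
    show "{{x, y}, {x', p}, {y', q}} \<subseteq> pairs V" using e n' s(1,2) by auto
    fix v
    \<comment> \<open>Both edge sets have the same six endpoints with multiplicity, so coincidences
      among the vertices do no harm.\<close>
    have "card {f \<in> {{x, x'}, {y, y'}, {p, q}}. v \<in> f}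
      = of_bool (v = x) + of_bool (v = x') + of_bool (v = y) + of_bool (v = y')
        + of_bool (v = p) + of_bool (v = q)"
      unfolding card_incident_triple[OF d(1-3)] using d0 by simp
    moreover have "card {f \<in> {{x, y}, {x', p}, {y', q}}. v \<in> f}
      = of_bool (v = x) + of_bool (v = x') + of_bool (v = y) + of_bool (v = y')
        + of_bool (v = p) + of_bool (v = q)"
      unfolding card_incident_triple[OF d(4-6)] using e(5) n' by simp
    ultimately show "card {f \<in> {{x, x'}, {y, y'}, {p, q}}. v \<in> f}
      = card {f \<in> {{x, y}, {x', p}, {y', q}}. v \<in> f}" by simp
  qed (use e n' in auto)
qed

lemma stuck_switch2:
  assumes "realizes V d E" "stuck V d H E {x, y}" "{x, y} \<notin> E" "x \<noteq> y"
    and "{x, x'} \<in> E - H" "{y, y'} \<in> E - H"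
  shows "x' \<in> closed_nbh E y'"
proof (rule ccontr)
  assume n: "x' \<notin> closed_nbh E y'"
  then have "realizes V d (E - {{x, x'}, {y, y'}} \<union> {{x, y}, {x', y'}})"
    using assms by (intro realizes_switch2) (auto simp: closed_nbh_def in_neighbors_iff)
  moreover have "insert {x, y} (E \<inter> H) \<subseteq> E - {{x, x'}, {y, y'}} \<union> {{x, y}, {x', y'}}"
    using assms(5,6) by auto
  ultimately show False using assms(2) unfolding stuck_def by blast
qed

text \<open>Since \<open>{p, q}\<close> and \<open>{q, p}\<close> are the same edge, every edge
  outside \<open>H\<close> gives two constraints, one for each orientation; the counting uses
  both.\<close>

lemma stuck_switch3:
  assumes "realizes V d E" "stuck V d H E {x, y}" "{x, y} \<notin> E" "x \<noteq> y"
    and "{x, x'} \<in> E - H" "{y, y'} \<in> E - H" "{p, q} \<in> E - H"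
  shows "p \<in> closed_nbh E x' \<or> q \<in> closed_nbh E y'"
proof (rule ccontr)
  assume "\<not> (p \<in> closed_nbh E x' \<or> q \<in> closed_nbh E y')"
  then have "realizes V d (E - {{x, x'}, {y, y'}, {p, q}} \<union> {{x, y}, {x', p}, {y', q}})"
    using assms by (intro realizes_switch3) auto
  moreover have "insert {x, y} (E \<inter> H) \<subseteq> E - {{x, x'}, {y, y'}, {p, q}} \<union> {{x, y}, {x', p}, {y', q}}"
    using assms(5-7) by auto
  ultimately show False using assms(2) unfolding stuck_def by blast
qed

text \<open>A realization with the most edges in \<open>H\<close> among those containing
  \<open>K\<close> works: any realization keeping \<open>E \<inter> H\<close> and gaining an edge of
  \<open>H\<close> still contains \<open>K\<close>, because \<open>K \<subseteq> H\<close>, and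
  would beat it.\<close>

lemma realizes_maximal:
  assumes "realizes V d E0" "K \<subseteq> E0" "K \<subseteq> H"
  obtains E where "realizes V d E" "K \<subseteq> E" "\<And>e. e \<in> H - E \<Longrightarrow> stuck V d H E e"
proof -
  let ?P = "\<lambda>E. realizes V d E \<and> K \<subseteq> E"
  have fin: "finite (pairs V)" using realizesD(2)[OF assms(1)] by simp
  have bound: "?P E \<Longrightarrow> card (E \<inter> H) \<le> card (pairs V)" for E
    using realizesD(3)[of V d E] fin by (intro card_mono) auto
  obtain E where E: "?P E" and max: "\<And>E'. ?P E' \<Longrightarrow> card (E' \<inter> H) \<le> card (E \<inter> H)"
    using ex_has_greatest_nat[of ?P E0 "\<lambda>E. card (E \<inter> H)" "Suc (card (pairs V))"] assms(1,2) bound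
    by (metis less_Suc_eq_le)
  show thesis
  proof (rule that[of E])
    fix e assume e: "e \<in> H - E"
    show "stuck V d H E e" unfolding stuck_def
    proof
      assume "\<exists>E'. realizes V d E' \<and> insert e (E \<inter> H) \<subseteq> E'"
      then obtain E' where E': "realizes V d E'" "insert e (E \<inter> H) \<subseteq> E'" by blast
      then have "K \<subseteq> E'" using E assms(3) by blast
      then have le: "card (E' \<inter> H) \<le> card (E \<inter> H)" using max E'(1) by blast
      have "E \<inter> H \<subset> E' \<inter> H" using E'(2) e by blast
      then have "card (E \<inter> H) < card (E' \<inter> H)"
        using realizesD(4)[OF E'(1)] by (intro psubset_card_mono) auto
      with le show False by simp
    qed
  qed (use E in auto)
qed

text \<open>Take a realization with the most edges inside \<open>U\<close> and non-adjacent
  \<open>x\<close>, \<open>y\<close> in \<open>U\<close>. The outer neighbours \<open>A\<close> of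
  \<open>x\<close> are adjacent or equal to the outer neighbours \<open>B\<close> of
  \<open>y\<close>, or a switch would add \<open>{x, y}\<close>. If neither \<open>A\<close> nor
  \<open>B\<close> were a clique, a switch outside \<open>U\<close> would destroy one of these
  adjacencies. The constant 3: \<open>x\<close> has at most \<open>card U - 2\<close> neighbours in
  \<open>U\<close>, hence at least \<open>r - 1\<close> outside, and \<open>x\<close> itself
  completes the clique.\<close>

lemma clique_or_clique:
  assumes r0: "realizes V d E0" and U: "U \<subseteq> V" and deg: "\<And>u. u \<in> U \<Longrightarrow> card U + r \<le> d u + 3"
    and r1: "r \<ge> 1"
  obtains E where "realizes V d E" "pairs U \<subseteq> E"
  | E Q where "realizes V d E" "Q \<subseteq> V" "card Q = r" "pairs Q \<subseteq> E"
proof -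
  note clique = that(2)
  obtain E where E: "realizes V d E" and st: "\<And>e. e \<in> pairs U - E \<Longrightarrow> stuck V d (pairs U) E e"
    using realizes_maximal[OF r0, of "{}" "pairs U"] by auto
  have fV: "finite V" using realizesD(2)[OF r0] .
  have fU: "finite U" using U fV finite_subset by blast
  show thesis
  proof (cases "pairs U \<subseteq> E")
    case True then show ?thesis using that(1) E by blast
  next
    case False
    then obtain x y where xy: "{x, y} \<notin> E" "x \<noteq> y" "x \<in> U" "y \<in> U"
      by (metis subsetI pairsE)
    have stxy: "stuck V d (pairs U) E {x, y}" using st xy by auto
    define A where "A = neighbors E x - U"
    define B where "B = neighbors E y - U"
    have size: "r - 1 \<le> card (neighbors E u - U)" if "u \<in> U" "w \<in> U" "u \<noteq> w" "{u, w} \<notin> E" for u w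
    proof -
      have "neighbors E u \<inter> U \<subseteq> U - {u, w}"
        using that realizesD(7)[OF E] by (auto simp: in_neighbors_iff insert_commute)
      then have "card (neighbors E u \<inter> U) \<le> card U - 2"
        using card_mono[of "U - {u, w}" "neighbors E u \<inter> U"] fU that by (simp add: card_Diff_subset)
      moreover have "card U \<ge> 2" using that fU card_mono[of U "{u, w}"] by auto
      moreover have "card (neighbors E u - U) = card (neighbors E u) - card (neighbors E u \<inter> U)"
        by (intro card_Diff_subset_Int) (use realizesD(6)[OF E] in auto)
      moreover have "card (neighbors E u) = d u" using realizesD(5)[OF E] that U by auto
      moreover have "card (neighbors E u \<inter> U) \<le> card (neighbors E u)"
        using realizesD(6)[OF E] by (intro card_mono) auto
      ultimately show ?thesis using deg[OF that(1)] by linarith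
    qed
    have outA: "{x, a} \<in> E - pairs U" if "a \<in> A" for a
      using that by (auto simp: A_def in_neighbors_iff insert_commute)
    have outB: "{y, b} \<in> E - pairs U" if "b \<in> B" for b
      using that by (auto simp: B_def in_neighbors_iff insert_commute)
    have AB: "a \<in> closed_nbh E b" if "a \<in> A" "b \<in> B" for a b
      using stuck_switch2[OF E stxy xy(1,2) outA[OF that(1)] outB[OF that(2)]] .
    have cl: "pairs A \<subseteq> E \<or> pairs B \<subseteq> E"
    proof (rule ccontr)
      assume "\<not> ?thesis"
      then obtain a1 a2 b1 b2 where a: "{a1, a2} \<notin> E" "a1 \<noteq> a2" "a1 \<in> A" "a2 \<in> A"
        and b: "{b1, b2} \<notin> E" "b1 \<noteq> b2" "b1 \<in> B" "b2 \<in> B"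
        by (metis subsetI pairsE)
      have aB: "a1 \<notin> B" "a2 \<notin> B" using AB[of a2 a1] AB[of a1 a2] a
        by (auto simp: closed_nbh_def in_neighbors_iff insert_commute)
      have bA: "b1 \<notin> A" "b2 \<notin> A" using AB[of b2 b1] AB[of b1 b2] b
        by (auto simp: closed_nbh_def in_neighbors_iff insert_commute)
      have ne: "a1 \<noteq> b1" "a1 \<noteq> b2" "a2 \<noteq> b1" "a2 \<noteq> b2" using aB b by auto
      have e: "{a1, b1} \<in> E" "{a2, b2} \<in> E"
        using AB a b ne by (auto simp: closed_nbh_def in_neighbors_iff insert_commute)
      \<comment> \<open>This switch changes nothing inside \<open>U\<close>, so
        \<open>{x, y}\<close> stays stuck, but \<open>a1\<close> and \<open>b1\<close> are no longer
        adjacent.\<close>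
      let ?E = "E - {{a1, b1}, {a2, b2}} \<union> {{a1, a2}, {b1, b2}}"
      have r: "realizes V d ?E"
        using realizes_switch2[OF E e a(1) b(1) a(2) b(2)] .
      have nU: "a1 \<notin> U" "a2 \<notin> U" "b1 \<notin> U" "b2 \<notin> U" using a b by (auto simp: A_def B_def)
      have eq: "?E \<inter> pairs U = E \<inter> pairs U"
        using nU by (auto simp: pairs_def)
      have st': "stuck V d (pairs U) ?E {x, y}" using stxy unfolding stuck_def eq .
      have nxy: "{x, y} \<notin> ?E" using xy nU by (auto simp: doubleton_eq_iff)
      have 1: "{x, a1} \<in> ?E - pairs U" "{y, b1} \<in> ?E - pairs U"
        using outA[OF a(3)] outB[OF b(3)] xy nU by (auto simp: doubleton_eq_iff)
      have "a1 \<in> closed_nbh ?E b1"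
        using stuck_switch2[OF r st' nxy xy(2) 1] .
      then show False using ne nU a b by (auto simp: closed_nbh_def in_neighbors_iff doubleton_eq_iff)
    qed
    have fin: "finite A" "finite B" unfolding A_def B_def using realizesD(6)[OF E] by auto
    have K: "thesis" if z: "z \<in> U" "C = neighbors E z - U" "pairs C \<subseteq> E" "r - 1 \<le> card C" for z C
    proof -
      obtain D where D: "D \<subseteq> C" "card D = r - 1" using z(4) by (meson obtain_subset_with_card_n)
      have fD: "finite D" using D(1) z(2) realizesD(6)[OF E] by (metis finite_Diff finite_subset)
      have "z \<notin> D" using D z by auto
      then have "card (insert z D) = r" using fD D(2) r1 by simp
      moreover have "insert z D \<subseteq> V" using D z(1,2) U realizesD(7)[OF E, of z] by auto
      moreover have "pairs (insert z D) \<subseteq> E"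
      proof
        fix e assume "e \<in> pairs (insert z D)"
        then obtain u v where e: "e = {u, v}" "u \<noteq> v" "u \<in> insert z D" "v \<in> insert z D" by (rule pairsE)
        have N: "w \<in> D \<Longrightarrow> {w, z} \<in> E" for w using D z by (auto simp: in_neighbors_iff)
        show "e \<in> E"
        proof (cases "u = z \<or> v = z")
          case True then show ?thesis using e N by (auto simp: insert_commute)
        next
          case False
          then have "e \<in> pairs C" using e D by auto
          then show ?thesis using z by auto
        qed
      qed
      ultimately show ?thesis using clique[OF E] by blast
    qed
    show ?thesis using cl
    proof
      assume "pairs A \<subseteq> E"
      then show ?thesis using K[OF xy(3) A_def] size[OF xy(3,4,2,1)] unfolding A_def by blast
    next
      assume "pairs B \<subseteq> E"
      then show ?thesis
        using K[OF xy(4) B_def] size[OF xy(4,3)] xy(1,2) unfolding B_def by (metis insert_commute)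
    qed
  qed
qed

section \<open>Counting the degree sum around a stuck edge\<close>

lemma sum_card_neighbors_commute:
  assumes "finite A" "finite B"
  shows "(\<Sum>w\<in>A. card (neighbors E w \<inter> B)) = (\<Sum>w\<in>B. card (neighbors E w \<inter> A))"
proof -
  have *: "card (neighbors E w \<inter> C) = (\<Sum>u\<in>C. of_bool (u \<in> neighbors E w))" if "finite C" for C w
    using that by (simp add: Int_commute)
  have "(\<Sum>w\<in>A. card (neighbors E w \<inter> B)) = (\<Sum>w\<in>A. \<Sum>u\<in>B. of_bool (u \<in> neighbors E w))"
    using * assms by simp
  also have "\<dots> = (\<Sum>u\<in>B. \<Sum>w\<in>A. of_bool (u \<in> neighbors E w))" by (rule sum.swap)
  also have "\<dots> = (\<Sum>u\<in>B. \<Sum>w\<in>A. of_bool (w \<in> neighbors E u))" by (simp add: neighbors_commute)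
  also have "\<dots> = (\<Sum>w\<in>B. card (neighbors E w \<inter> A))" using * assms by simp
  finally show ?thesis .
qed

lemma degree_partition3:
  assumes r: "realizes V d E" and Z: "Z \<subseteq> L" "L \<subseteq> V" and w: "w \<in> V"
  shows "d w = card (neighbors E w \<inter> Z) + card (neighbors E w \<inter> (L - Z))
    + card (neighbors E w \<inter> (V - L))"
proof -
  have fV: "finite V" using realizesD(2)[OF r] .
  have f: "finite Z" "finite L" using Z fV by (meson finite_subset)+
  have "neighbors E w = (neighbors E w \<inter> Z \<union> neighbors E w \<inter> (L - Z)) \<union> neighbors E w \<inter> (V - L)"
    using realizesD(7)[OF r, of w] Z by auto
  then have "d w = card ((neighbors E w \<inter> Z \<union> neighbors E w \<inter> (L - Z)) \<union> neighbors E w \<inter> (V - L))"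
    using realizesD(5)[OF r w] by simp
  also have "\<dots> = card (neighbors E w \<inter> Z \<union> neighbors E w \<inter> (L - Z)) + card (neighbors E w \<inter> (V - L))"
    using Z f fV by (intro card_Un_disjoint) auto
  also have "card (neighbors E w \<inter> Z \<union> neighbors E w \<inter> (L - Z))
    = card (neighbors E w \<inter> Z) + card (neighbors E w \<inter> (L - Z))"
    using f by (intro card_Un_disjoint) auto
  finally show ?thesis .
qed

lemma card_ordered_pairs_le:
  assumes "finite X"
  shows "finite {(p, q). p \<noteq> q \<and> {p, q} \<in> X}" "card {(p, q). p \<noteq> q \<and> {p, q} \<in> X} \<le> 2 * card X"
proof -
  define W where "W e = {(p, q). p \<noteq> q \<and> {p, q} = e}" for e :: "'a set"
  have 1: "finite (W e) \<and> card (W e) \<le> 2" for e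
  proof (cases "\<exists>a b. e = {a, b}")
    case True
    then obtain a b where "e = {a, b}" by blast
    then have sub: "W e \<subseteq> {(a, b), (b, a)}" unfolding W_def by (simp only: doubleton_eq_iff) blast
    have "card {(a, b), (b, a)} \<le> 2" using card_insert_le_m1[of 2 "{(b, a)}" "(a, b)"] by simp
    moreover have "card (W e) \<le> card {(a, b), (b, a)}" by (rule card_mono[OF _ sub]) simp
    moreover have "finite (W e)" by (rule finite_subset[OF sub]) simp
    ultimately show ?thesis by linarith
  next
    case False
    then have "W e = {}" unfolding W_def by blast
    then show ?thesis by simp
  qed
  have eq: "{(p, q). p \<noteq> q \<and> {p, q} \<in> X} = (\<Union>e\<in>X. W e)" unfolding W_def by blast
  show "finite {(p, q). p \<noteq> q \<and> {p, q} \<in> X}" unfolding eq using 1 assms by blast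
  have "card (\<Union>e\<in>X. W e) \<le> (\<Sum>e\<in>X. card (W e))" using assms by (rule card_UN_le)
  also have "\<dots> \<le> (\<Sum>e\<in>X. 2)" using 1 by (intro sum_mono) blast
  finally show "card {(p, q). p \<noteq> q \<and> {p, q} \<in> X} \<le> 2 * card X" unfolding eq by simp
qed

text \<open>Ordered pairs are counted, because the covering holds for both orientations of an edge:
  a pair starts in \<open>P1\<close>, or its reverse starts in \<open>P2\<close>, or it orients an
  edge of \<open>X\<close>. Doubling the number of edges that meet \<open>P1 \<union> P2\<close>
  would cost a factor of two.\<close>

lemma covered_edges_count:
  assumes r: "realizes V d E" and S: "S \<subseteq> V" and P: "P1 \<subseteq> S" "P2 \<subseteq> S" and X: "finite X"
    and cover: "\<And>p q. {p, q} \<in> E \<Longrightarrow> p \<in> S \<Longrightarrow> q \<in> S \<Longrightarrow> {p, q} \<in> X \<or> p \<in> P1 \<or> q \<in> P2"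
  shows "(\<Sum>w\<in>S. card (neighbors E w \<inter> S))
    \<le> (\<Sum>w\<in>P1. card (neighbors E w \<inter> S)) + (\<Sum>w\<in>P2. card (neighbors E w \<inter> S)) + 2 * card X"
proof -
  have fS: "finite S" "finite P1" "finite P2" using realizesD(2)[OF r] S P by (meson finite_subset)+
  let ?N = "\<lambda>w. neighbors E w \<inter> S"
  let ?X = "{(p, q). p \<noteq> q \<and> {p, q} \<in> X}"
  have card_Sig: "card (Sigma Q ?N) = (\<Sum>w\<in>Q. card (?N w))" if "finite Q" for Q
    using that fS by (intro card_SigmaI) auto
  have "Sigma S ?N \<subseteq> Sigma P1 ?N \<union> prod.swap ` Sigma P2 ?N \<union> ?X"
  proof (rule subsetI, rule ccontr)
    fix z assume z: "z \<in> Sigma S ?N" "z \<notin> Sigma P1 ?N \<union> prod.swap ` Sigma P2 ?N \<union> ?X"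
    then obtain p q where pq: "z = (p, q)" by (cases z)
    with z have a: "p \<in> S" "q \<in> neighbors E p" "q \<in> S" "(p, q) \<notin> ?X"
      "(p, q) \<notin> prod.swap ` Sigma P2 ?N" "p \<notin> P1" by blast+
    then have e: "{p, q} \<in> E" by (auto simp: in_neighbors_iff insert_commute)
    have "p \<noteq> q" using simple_graph_edgeD(3)[OF realizesD(1)[OF r] e] .
    have "q \<notin> P2" using a(1,2,5) by (auto simp: neighbors_commute image_iff)
    then show False using cover[OF e a(1,3)] a(4,6) \<open>p \<noteq> q\<close> by auto
  qed
  then have "card (Sigma S ?N) \<le> card (Sigma P1 ?N \<union> prod.swap ` Sigma P2 ?N \<union> ?X)"
    using fS card_ordered_pairs_le(1)[OF X] by (intro card_mono) auto
  also have "\<dots> \<le> card (Sigma P1 ?N) + card (prod.swap ` Sigma P2 ?N) + card ?X"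
    by (meson add_le_mono1 card_Un_le order_trans)
  also have "\<dots> \<le> card (Sigma P1 ?N) + card (Sigma P2 ?N) + 2 * card X"
    using card_ordered_pairs_le(2)[OF X] fS card_image_le[of "Sigma P2 ?N" prod.swap] by (auto intro: add_mono)
  finally show ?thesis using card_Sig fS by simp
qed

text \<open>The vertices of \<open>P1\<close> and \<open>P2\<close> that miss part of \<open>Z\<close> may have more neighbours outside \<open>L\<close>;
  the same defect lowers the degree sum over \<open>Z\<close>, once for each of \<open>P1\<close> and \<open>P2\<close>, and the two effects cancel.\<close>

lemma degree_sum_bound:
  assumes r: "realizes V d E" and L: "Z \<subseteq> L" "L \<subseteq> V"
    and small: "\<And>v. v \<in> V - L \<Longrightarrow> d v \<le> D" and mid: "\<And>v. v \<in> L - Z \<Longrightarrow> d v \<le> Dr"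
    and P: "P1 \<subseteq> V - L" "P2 \<subseteq> V - L" and X: "finite X"
    and cover: "\<And>p q. {p, q} \<in> E \<Longrightarrow> p \<in> V - L \<Longrightarrow> q \<in> V - L \<Longrightarrow> {p, q} \<in> X \<or> p \<in> P1 \<or> q \<in> P2"
    and k: "k = int (card Z)"
  shows "int (\<Sum>v\<in>V. d v) \<le> k * (k - 1) + 2 * k * (int (card V) - k) + 2 * int (card (L - Z)) * int Dr
    + (int D - k) * (int (card P1) + int (card P2)) + 2 * int (card X)"
proof -
  define S where "S = V - L"
  have fV: "finite V" using realizesD(2)[OF r] .
  have f: "finite Z" "finite L" "finite S" "finite P1" "finite P2"
    using L fV P unfolding S_def by (meson finite_subset finite_Diff)+
  let ?N = "\<lambda>w A. int (card (neighbors E w \<inter> A))"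
  have part: "int (d w) = ?N w Z + ?N w (L - Z) + ?N w S" if "w \<in> V" for w
    using degree_partition3[OF r L that] unfolding S_def by linarith
  have com: "(\<Sum>w\<in>A. ?N w B) = (\<Sum>w\<in>B. ?N w A)" if "finite A" "finite B" for A B
    using sum_card_neighbors_commute[OF that, of E] by (metis of_nat_sum)
  \<comment> \<open>\<open>M\<close> is the number of non-adjacent pairs between \<open>S\<close>
    and \<open>Z\<close>, the total defect.\<close>
  define M where "M = (\<Sum>w\<in>S. k - ?N w Z)"
  define T where "T = (\<Sum>w\<in>L-Z. int (d w))"
  have zz: "(\<Sum>w\<in>Z. ?N w Z) \<le> k * (k - 1)"
  proof -
    have "?N w Z \<le> k - 1" if "w \<in> Z" for w
    proof -
      have "neighbors E w \<inter> Z \<subseteq> Z - {w}" using realizesD(7)[OF r, of w] by auto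
      then have "card (neighbors E w \<inter> Z) \<le> card (Z - {w})" using f by (intro card_mono) auto
      moreover have "card Z \<ge> 1" using that f by (metis One_nat_def Suc_leI card_gt_0_iff empty_iff)
      ultimately show ?thesis using that f k by simp
    qed
    then have "(\<Sum>w\<in>Z. ?N w Z) \<le> (\<Sum>w\<in>Z. k - 1)" by (intro sum_mono)
    then show ?thesis using k by simp
  qed
  have sz: "(\<Sum>w\<in>S. ?N w Z) = k * int (card S) - M" by (simp add: M_def sum_subtractf)
  have Teq: "T = (\<Sum>w\<in>L-Z. ?N w Z) + (\<Sum>w\<in>L-Z. ?N w (L-Z)) + (\<Sum>w\<in>L-Z. ?N w S)"
    unfolding T_def sum.distrib[symmetric] using part L by (intro sum.cong) auto
  have Zeq: "(\<Sum>w\<in>Z. int (d w)) = (\<Sum>w\<in>Z. ?N w Z) + (\<Sum>w\<in>Z. ?N w (L-Z)) + (\<Sum>w\<in>Z. ?N w S)"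
    unfolding sum.distrib[symmetric] using part L by (intro sum.cong) auto
  have Seq: "(\<Sum>w\<in>S. int (d w)) = (\<Sum>w\<in>S. ?N w Z) + (\<Sum>w\<in>S. ?N w (L-Z)) + (\<Sum>w\<in>S. ?N w S)"
    unfolding sum.distrib[symmetric] using part L by (intro sum.cong) (auto simp: S_def)
  have "V = (Z \<union> (L - Z)) \<union> S" using L by (auto simp: S_def)
  then have "(\<Sum>v\<in>V. int (d v)) = (\<Sum>v\<in>(Z \<union> (L - Z)) \<union> S. int (d v))" by simp
  also have "\<dots> = (\<Sum>v\<in>Z \<union> (L - Z). int (d v)) + (\<Sum>w\<in>S. int (d w))"
    using f L by (intro sum.union_disjoint) (auto simp: S_def)
  also have "(\<Sum>v\<in>Z \<union> (L - Z). int (d v)) = (\<Sum>w\<in>Z. int (d w)) + T"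
    unfolding T_def using f by (intro sum.union_disjoint) auto
  finally have tot: "(\<Sum>v\<in>V. int (d v)) = (\<Sum>w\<in>Z. int (d w)) + T + (\<Sum>w\<in>S. int (d w))" .
  have Tle: "T \<le> int (card (L - Z)) * int Dr"
  proof -
    have "T \<le> (\<Sum>w\<in>L-Z. int Dr)" unfolding T_def using mid by (intro sum_mono) auto
    then show ?thesis by simp
  qed
  have Psum: "(\<Sum>w\<in>P. ?N w S) \<le> (int D - k) * int (card P) + M" if "P \<subseteq> S" for P
  proof -
    have "?N w Z \<le> k" for w using f k by (simp add: card_mono)
    then have mu: "0 \<le> k - ?N w Z" for w by (simp add: algebra_simps)
    have "(\<Sum>w\<in>P. ?N w S) \<le> (\<Sum>w\<in>P. (int D - k) + (k - ?N w Z))"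
    proof (rule sum_mono)
      fix w assume "w \<in> P"
      then have w: "w \<in> V" "d w \<le> D" using that small by (auto simp: S_def)
      show "?N w S \<le> (int D - k) + (k - ?N w Z)" using part[OF w(1)] w(2) by linarith
    qed
    also have "\<dots> = (int D - k) * int (card P) + (\<Sum>w\<in>P. k - ?N w Z)"
      by (simp add: sum.distrib sum_subtractf algebra_simps)
    also have "(\<Sum>w\<in>P. k - ?N w Z) \<le> M" unfolding M_def using that f mu by (intro sum_mono2) auto
    finally show ?thesis by simp
  qed
  have "(\<Sum>w\<in>S. card (neighbors E w \<inter> S))
    \<le> (\<Sum>w\<in>P1. card (neighbors E w \<inter> S)) + (\<Sum>w\<in>P2. card (neighbors E w \<inter> S)) + 2 * card X"
    using covered_edges_count[OF r, of S P1 P2 X] P X cover unfolding S_def by blast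
  then have "int (\<Sum>w\<in>S. card (neighbors E w \<inter> S))
    \<le> int ((\<Sum>w\<in>P1. card (neighbors E w \<inter> S)) + (\<Sum>w\<in>P2. card (neighbors E w \<inter> S)) + 2 * card X)"
    by (simp only: of_nat_le_iff)
  then have e0: "(\<Sum>w\<in>S. ?N w S) \<le> (\<Sum>w\<in>P1. ?N w S) + (\<Sum>w\<in>P2. ?N w S) + 2 * int (card X)"
    by simp
  have cS: "int (card S) \<le> int (card V) - k"
  proof -
    have "card S + card Z \<le> card V"
      using L f fV by (subst card_Un_disjoint[symmetric]) (auto simp: S_def intro: card_mono)
    then show ?thesis using k by simp
  qed
  have "0 \<le> k" using k by simp
  then have kS: "k * int (card S) \<le> k * (int (card V) - k)" using cS by (rule_tac mult_left_mono)
  have nn: "0 \<le> (\<Sum>w\<in>L-Z. ?N w (L-Z))" by (simp add: sum_nonneg)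
  \<comment> \<open>\<open>T\<close> counts once for the degrees in \<open>L - Z\<close> and at most
    once more for the edges from \<open>L - Z\<close> to \<open>Z\<close> and \<open>S\<close>, seen
    from their other ends. The edges between \<open>S\<close> and \<open>Z\<close> are seen from
    both sides, hence \<open>2 * M\<close>.\<close>
  have "(\<Sum>v\<in>V. int (d v)) \<le> k * (k - 1) + 2 * T + 2 * (k * int (card S)) - 2 * M + (\<Sum>w\<in>S. ?N w S)"
    using tot Zeq Seq Teq sz zz nn com[OF f(1,3)] com[of Z "L - Z"] com[of S "L - Z"] f by auto
  also have "(\<Sum>w\<in>S. ?N w S) \<le> (int D - k) * (int (card P1) + int (card P2)) + 2 * M + 2 * int (card X)"
    using e0 Psum[of P1] Psum[of P2] P unfolding S_def[symmetric] by (simp add: algebra_simps)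
  finally show ?thesis using Tle kS by (simp add: algebra_simps)
qed

text \<open>\<open>Z\<close> consists of the \<open>b\<close> in \<open>B\<close> whose neighbours
  outside \<open>U\<close> fit into neither of the closed neighbourhoods of \<open>x'\<close> and
  \<open>y'\<close>; the three-edge switch forces such \<open>b\<close> to be adjacent to both. For
  any other \<open>b\<close> in \<open>B\<close> these neighbours lie in a set of at most
  \<open>D + 1\<close> vertices, so \<open>d b\<close> is at most \<open>D + card U\<close>. For
  \<open>L - B\<close>, \<open>miss\<close> provides a vertex of \<open>B - Z\<close> and
  \<open>top\<close> says that its degree dominates. The fourth conclusion lets a caller exclude
  further vertices from \<open>Z\<close>.\<close>

lemma stuck_degree_sum_bound:
  assumes r: "realizes V d E" and st: "stuck V d H E {x, y}" "{x, y} \<notin> E" "x \<noteq> y"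
    and x': "{x, x'} \<in> E - H" "x' \<in> V - L" and y': "{y, y'} \<in> E - H" "y' \<in> V - L"
    and sub: "B \<subseteq> L" "L \<subseteq> U" "U \<subseteq> V"
    and small: "\<And>v. v \<in> V - L \<Longrightarrow> d v \<le> D"
    and H: "\<And>b q. b \<in> L \<Longrightarrow> q \<in> V - U \<Longrightarrow> {b, q} \<notin> H"
    and top: "\<And>a b. b \<in> B \<Longrightarrow> a \<in> L - B \<Longrightarrow> d a \<le> d b"
    and miss: "B = L \<or> (\<exists>b\<in>B. b \<notin> neighbors E x' \<or> b \<notin> neighbors E y')"
    and X: "{e \<in> E \<inter> H. e \<subseteq> V - L} \<subseteq> X" "finite X"
  obtains Z where "Z \<subseteq> B" "Z \<subseteq> neighbors E x'" "Z \<subseteq> neighbors E y'"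
    "\<And>b. b \<in> Z \<Longrightarrow> \<not> neighbors E b - U \<subseteq> closed_nbh E y'"
    "int (\<Sum>v\<in>V. d v) \<le> int (card Z) * (int (card Z) - 1)
      + 2 * int (card Z) * (int (card V) - int (card Z))
      + 2 * int (card (L - Z)) * (int D + int (card U))
      + 2 * (int D - int (card Z)) * (int D + 1 - int (card Z)) + 2 * int (card X)"
proof -
  have fV: "finite V" using realizesD(2)[OF r] .
  have fU: "finite U" "finite L" "finite B" using sub fV by (meson finite_subset)+
  have LV: "L \<subseteq> V" using sub by blast
  note sw = stuck_switch3[OF r st x'(1) y'(1)]
  define Z where "Z = {b \<in> B. \<not> neighbors E b - U \<subseteq> closed_nbh E x' \<and> \<not> neighbors E b - U \<subseteq> closed_nbh E y'}"
  have out: "{b, q} \<in> E - H" if "b \<in> L" "q \<in> neighbors E b - U" for b q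
  proof -
    have "q \<in> V - U" using that(2) realizesD(7)[OF r, of b] by auto
    then have "{b, q} \<notin> H" using H[OF that(1)] by blast
    then show ?thesis using that(2) by (auto simp: in_neighbors_iff insert_commute)
  qed
  have Zx: "Z \<subseteq> neighbors E x'"
  proof
    fix b assume b: "b \<in> Z"
    then obtain q where q: "q \<in> neighbors E b - U" "q \<notin> closed_nbh E y'" by (auto simp: Z_def)
    have "b \<in> L" using b sub by (auto simp: Z_def)
    then show "b \<in> neighbors E x'" using sw[OF out[OF _ q(1)]] q(2) x'(2) by (auto simp: closed_nbh_def)
  qed
  have Zy: "Z \<subseteq> neighbors E y'"
  proof
    fix b assume b: "b \<in> Z"
    then obtain q where q: "q \<in> neighbors E b - U" "q \<notin> closed_nbh E x'" by (auto simp: Z_def)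
    have "b \<in> L" using b sub by (auto simp: Z_def)
    then have "{q, b} \<in> E - H" using out[OF _ q(1)] by (simp add: insert_commute)
    then show "b \<in> neighbors E y'" using sw[of q b] q(2) y'(2) \<open>b \<in> L\<close> by (auto simp: closed_nbh_def)
  qed
  have cn: "card (closed_nbh E v) \<le> D + 1" if "v \<in> V - L" for v
    using that small[OF that] realizesD(5,6)[OF r, of v] by (simp add: closed_nbh_def card_insert_if)
  have midB: "d b \<le> D + card U" if "b \<in> B" "b \<notin> Z" for b
  proof -
    have "neighbors E b - U \<subseteq> closed_nbh E x' \<or> neighbors E b - U \<subseteq> closed_nbh E y'"
      using that by (simp add: Z_def)
    then obtain v where v: "v \<in> V - L" "neighbors E b - U \<subseteq> closed_nbh E v"
      using x'(2) y'(2) by metis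
    have bU: "b \<in> U" using that sub by auto
    have "neighbors E b \<subseteq> closed_nbh E v \<union> (U - {b})" using v(2) realizesD(7)[OF r, of b] by auto
    then have "card (neighbors E b) \<le> card (closed_nbh E v \<union> (U - {b}))"
      using fU realizesD(6)[OF r] by (intro card_mono) (auto simp: closed_nbh_def)
    also have "\<dots> \<le> card (closed_nbh E v) + card (U - {b})" by (rule card_Un_le)
    \<comment> \<open>\<open>b\<close> lies in \<open>U\<close> and is not its own neighbour, which
      makes up for the 1 of the closed neighbourhood.\<close>
    also have "\<dots> \<le> D + 1 + (card U - 1)" using cn[OF v(1)] bU fU by simp
    also have "\<dots> = D + card U" using bU fU card_gt_0_iff[of U] by auto
    finally show ?thesis using realizesD(5)[OF r, of b] bU sub by auto
  qed
  have mid: "d v \<le> D + card U" if v: "v \<in> L - Z" for v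
  proof (cases "v \<in> B")
    case True then show ?thesis using midB v by auto
  next
    case False
    then obtain b where b: "b \<in> B" "b \<notin> Z" using miss v Zx Zy by blast
    then show ?thesis using midB[OF b] top[OF b(1), of v] False v by auto
  qed
  \<comment> \<open>\<open>Z\<close> occupies \<open>card Z\<close> places of the closed
    neighbourhood and lies in \<open>L\<close>.\<close>
  have P: "int (card (closed_nbh E v \<inter> (V - L))) \<le> int D + 1 - int (card Z)"
    if v: "v \<in> V - L" "Z \<subseteq> neighbors E v" for v
  proof -
    have "closed_nbh E v \<inter> (V - L) \<subseteq> closed_nbh E v - Z" using sub by (auto simp: Z_def)
    then have "card (closed_nbh E v \<inter> (V - L)) \<le> card (closed_nbh E v - Z)"
      using realizesD(6)[OF r] by (intro card_mono) (auto simp: closed_nbh_def)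
    also have "\<dots> = card (closed_nbh E v) - card Z"
      using v(2) fU by (intro card_Diff_subset) (auto simp: closed_nbh_def Z_def)
    finally have "card (closed_nbh E v \<inter> (V - L)) \<le> card (closed_nbh E v) - card Z" .
    moreover have "card Z \<le> card (closed_nbh E v)"
      using v(2) realizesD(6)[OF r] by (intro card_mono) (auto simp: closed_nbh_def)
    ultimately show ?thesis using cn[OF v(1)] by linarith
  qed
  have "card Z \<le> D"
  proof -
    have "card Z \<le> card (neighbors E x')" using Zx realizesD(6)[OF r] by (intro card_mono)
    then show ?thesis using realizesD(5)[OF r, of x'] small[OF x'(2)] x'(2) by auto
  qed
  then have kD: "0 \<le> int D - int (card Z)" by simp
  have "int (\<Sum>v\<in>V. d v) \<le> int (card Z) * (int (card Z) - 1)
      + 2 * int (card Z) * (int (card V) - int (card Z))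
      + 2 * int (card (L - Z)) * int (D + card U)
      + (int D - int (card Z)) * (int (card (closed_nbh E x' \<inter> (V - L))) + int (card (closed_nbh E y' \<inter> (V - L))))
      + 2 * int (card X)"
  proof (rule degree_sum_bound[OF r _ LV small mid _ _ X(2) _ refl])
    show "Z \<subseteq> L" using sub by (auto simp: Z_def)
    fix p q assume pq: "{p, q} \<in> E" "p \<in> V - L" "q \<in> V - L"
    show "{p, q} \<in> X \<or> p \<in> closed_nbh E x' \<inter> (V - L) \<or> q \<in> closed_nbh E y' \<inter> (V - L)"
    proof (cases "{p, q} \<in> H")
      case True then show ?thesis using pq X(1) by auto
    next
      case False then show ?thesis using sw[of p q] pq by auto
    qed
  qed auto
  also have "(int D - int (card Z)) * (int (card (closed_nbh E x' \<inter> (V - L))) + int (card (closed_nbh E y' \<inter> (V - L))))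
    \<le> (int D - int (card Z)) * (2 * (int D + 1 - int (card Z)))"
    using P[OF x'(2) Zx] P[OF y'(2) Zy] kD by (intro mult_left_mono) auto
  finally have "int (\<Sum>v\<in>V. d v) \<le> int (card Z) * (int (card Z) - 1)
      + 2 * int (card Z) * (int (card V) - int (card Z))
      + 2 * int (card (L - Z)) * (int D + int (card U))
      + 2 * (int D - int (card Z)) * (int D + 1 - int (card Z)) + 2 * int (card X)"
    by (simp add: algebra_simps)
  then show thesis by (intro that[OF _ Zx Zy]) (simp_all add: Z_def)
qed

definition cross :: "'a set \<Rightarrow> 'a set \<Rightarrow> 'a set set" where
  "cross A B = {e. \<exists>a\<in>A. \<exists>b\<in>B. e = {a, b}}"

lemma cross_iff: "e \<in> cross A B \<longleftrightarrow> (\<exists>a\<in>A. \<exists>b\<in>B. e = {a, b})"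
  by (simp add: cross_def)

lemma crossI: "a \<in> A \<Longrightarrow> b \<in> B \<Longrightarrow> {a, b} \<in> cross A B"
  unfolding cross_iff by blast

lemma crossI': "a \<in> A \<Longrightarrow> b \<in> B \<Longrightarrow> {b, a} \<in> cross A B"
  using crossI[of a A b B] by (simp add: insert_commute)

section \<open>The hypotheses on the degrees and their numerical consequences\<close>

locale dense_degrees =
  fixes V :: "'a set" and d :: "'a \<Rightarrow> nat" and t :: nat
  assumes t: "t \<ge> 2" and card_V: "card V \<ge> 20 * t\<^sup>2 + 31 * t + 12"
    and graphical: "\<exists>E. realizes V d E"
    and degree_sum: "int (\<Sum>v\<in>V. d v) > 4 * int t * int (card V) - 4 * (int t)\<^sup>2 - 2 * int t"
begin

text \<open>The threshold is what \<open>clique_or_clique\<close> asks for with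
  \<open>card U = r = 3 * t + 2\<close>: \<open>6 * t + 1 = 2 * (3 * t + 2) - 3\<close>.\<close>

definition L :: "'a set" where "L = {v \<in> V. 6 * t < d v}"

lemma finite_V: "finite V" using graphical realizesD(2) by blast

lemma L_sub: "L \<subseteq> V" by (auto simp: L_def)

lemma finite_L: "finite L" using L_sub finite_V finite_subset by blast

lemma degree_small: "v \<in> V - L \<Longrightarrow> d v \<le> 6 * t" by (auto simp: L_def)

lemma card_V_int: "20 * (int t)\<^sup>2 + 31 * int t + 12 \<le> int (card V)"
proof -
  have "int (20 * t\<^sup>2 + 31 * t + 12) \<le> int (card V)" using card_V by (simp only: of_nat_le_iff)
  then show ?thesis by simp
qed

text \<open>\<open>k * (k - 1) + 2 * k * (n - k)\<close>, with \<open>n = card V\<close>, is the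
  degree sum of a \<open>k\<close>-clique joined to \<open>n - k\<close> isolated vertices; at
  \<open>k = 2 * t\<close> it is the assumed lower bound. Lowering \<open>k\<close> by
  \<open>j\<close> costs \<open>2 * j * n - 4 * j * t - j + j * j\<close>, and
  \<open>2 * n \<ge> 40 * t^2 + 62 * t + 24\<close> makes this more than the allowance for
  \<open>w\<close>.\<close>

lemma degree_sum_contradiction:
  assumes "int (\<Sum>v\<in>V. d v) \<le> k * (k - 1) + 2 * k * (int (card V) - k) + w"
    and k: "k = 2 * int t - j" and j: "1 \<le> j"
    and w: "w \<le> j * (40 * (int t)\<^sup>2 + 58 * int t + 22)"
  shows False
proof -
  let ?n = "int (card V)" and ?t = "int t"
  have n: "20 * ?t\<^sup>2 + 31 * ?t + 12 \<le> ?n" by (rule card_V_int)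
  have "4 * ?t * ?n - 4 * ?t\<^sup>2 - 2 * ?t < k * (k - 1) + 2 * k * (?n - k) + w"
    using assms(1) degree_sum by linarith
  then have 1: "2 * (j * ?n) < 4 * (j * ?t) + j - j * j + w"
    unfolding k by (simp add: algebra_simps power2_eq_square)
  have "j * (20 * ?t\<^sup>2 + 31 * ?t + 12) \<le> j * ?n" using n j by (intro mult_left_mono) auto
  then have 2: "20 * (j * ?t\<^sup>2) + 31 * (j * ?t) + 12 * j \<le> j * ?n" by (simp add: algebra_simps)
  have 3: "w \<le> 40 * (j * ?t\<^sup>2) + 58 * (j * ?t) + 22 * j" using w by (simp add: algebra_simps)
  show False using 1 2 3 j zero_le_square[of j] by linarith
qed

text \<open>The vertices of \<open>Q\<close> receive from outside at most the sum of the outer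
  degrees. So the whole sum is at most the square of \<open>card Q\<close> plus twice the outer sum,
  about \<open>(4 * t - 2) * n\<close>, which falls short by about \<open>2 * n\<close>.\<close>

lemma many_large_degrees:
  assumes "card Q \<le> 3 * t + 1" "Q \<subseteq> V" "\<And>v. v \<in> V - Q \<Longrightarrow> d v \<le> 2 * t - 1"
  shows False
proof -
  obtain E where r: "realizes V d E" using graphical by blast
  have fQ: "finite Q" using assms finite_V finite_subset by blast
  let ?N = "\<lambda>w A. card (neighbors E w \<inter> A)"
  have "(\<Sum>v\<in>Q. d v) = (\<Sum>v\<in>Q. ?N v Q + ?N v (V - Q))"
  proof (rule sum.cong)
    fix v assume "v \<in> Q"
    then show "d v = ?N v Q + ?N v (V - Q)"
      using degree_partition3[OF r, of Q Q v] assms(2) by auto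
  qed simp
  also have "\<dots> = (\<Sum>v\<in>Q. ?N v Q) + (\<Sum>v\<in>V-Q. ?N v Q)"
    using sum_card_neighbors_commute[of Q "V - Q" E] fQ finite_V by (simp add: sum.distrib)
  also have "(\<Sum>v\<in>Q. ?N v Q) \<le> (\<Sum>v\<in>Q. card Q)" using fQ by (intro sum_mono card_mono) auto
  also have "(\<Sum>v\<in>V-Q. ?N v Q) \<le> (\<Sum>v\<in>V-Q. d v)"
  proof (rule sum_mono)
    fix v assume "v \<in> V - Q"
    then show "?N v Q \<le> d v"
      using realizesD(5,6)[OF r, of v] by (metis DiffD1 Int_lower1 card_mono)
  qed
  finally have 1: "(\<Sum>v\<in>Q. d v) \<le> card Q * card Q + (\<Sum>v\<in>V-Q. d v)" by simp
  have "(\<Sum>v\<in>V-Q. d v) \<le> (\<Sum>v\<in>V-Q. 2 * t - 1)" using assms(3) by (intro sum_mono) auto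
  also have "\<dots> \<le> card V * (2 * t - 1)" using finite_V by (simp add: card_mono)
  finally have 2: "(\<Sum>v\<in>V-Q. d v) \<le> card V * (2 * t - 1)" .
  have "(\<Sum>v\<in>V. d v) = (\<Sum>v\<in>V-Q. d v) + (\<Sum>v\<in>Q. d v)"
    by (rule sum.subset_diff[OF assms(2) finite_V])
  then have "(\<Sum>v\<in>V. d v) \<le> card Q * card Q + 2 * (card V * (2 * t - 1))" using 1 2 by linarith
  moreover have "card Q * card Q \<le> (3 * t + 1) * (3 * t + 1)" using assms(1) by (intro mult_mono) auto
  ultimately have "(\<Sum>v\<in>V. d v) \<le> (3 * t + 1) * (3 * t + 1) + 2 * (card V * (2 * t - 1))" by linarith
  then have "int (\<Sum>v\<in>V. d v) \<le> int ((3 * t + 1) * (3 * t + 1) + 2 * (card V * (2 * t - 1)))"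
    by (simp only: of_nat_le_iff)
  also have "\<dots> = (3 * int t + 1) * (3 * int t + 1) + 2 * (int (card V) * (2 * int t - 1))"
    using t by (simp add: of_nat_diff) (simp add: algebra_simps)
  finally have a: "int (\<Sum>v\<in>V. d v) \<le> (3 * int t + 1) * (3 * int t + 1) + 2 * (int (card V) * (2 * int t - 1))" .
  have b: "int (\<Sum>v\<in>V. d v) \<le> 9 * (int t)\<^sup>2 + 6 * int t + 1 + 4 * (int t * int (card V)) - 2 * int (card V)"
    using a by (simp add: algebra_simps power2_eq_square)
  have c: "int (\<Sum>v\<in>V. d v) > 4 * (int t * int (card V)) - 4 * (int t)\<^sup>2 - 2 * int t"
    using degree_sum by simp
  have "2 \<le> int t" "0 \<le> (int t)\<^sup>2" using t by auto
  then show False using b c card_V_int by linarith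
qed

section \<open>Fewer than 2t vertices of large degree\<close>

text \<open>Otherwise the vertices of \<open>L\<close> contribute at most \<open>n\<close> each and
  almost all others at most \<open>2 * t + j - 1\<close>, in total \<open>(4 * t - 1) * n\<close> up
  to terms in \<open>t^2\<close>, which is too little. The size \<open>3 * t + 3\<close> is the
  largest one requested later, \<open>t + 2 * j + 3\<close> at \<open>j = t\<close>.\<close>

lemma exists_R_small_L:
  assumes p: "card L + j = 2 * t" "1 \<le> j"
  obtains R where "R \<subseteq> V - L" "card R = 3 * t + 3" "\<And>v. v \<in> R \<Longrightarrow> 2 * t + j \<le> d v"
proof -
  define Q where "Q = {v \<in> V - L. 2 * t + j \<le> d v}"
  obtain E where r: "realizes V d E" using graphical by blast
  have fQ: "finite Q" "Q \<subseteq> V - L" using finite_V by (auto simp: Q_def)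
  have "3 * t + 3 \<le> card Q"
  proof (rule ccontr)
    assume "\<not> ?thesis"
    then have m: "card Q \<le> 3 * t + 2" by simp
    have dle: "d v \<le> card V" if "v \<in> V" for v
    proof -
      have "card (neighbors E v) \<le> card V" using realizesD(7)[OF r, of v] finite_V by (intro card_mono) auto
      then show ?thesis using realizesD(5)[OF r that] by simp
    qed
    have "(\<Sum>v\<in>L. d v) \<le> (\<Sum>v\<in>L. card V)" using dle L_sub by (intro sum_mono) auto
    then have 1: "(\<Sum>v\<in>L. d v) \<le> card L * card V" by simp
    \<comment> \<open>The members of \<open>Q\<close> have degree at most \<open>6 * t\<close>,
      which the surcharge \<open>4 * t\<close> reaches because \<open>j \<ge> 1\<close>.\<close>
    have "(\<Sum>v\<in>V-L. d v) \<le> (\<Sum>v\<in>V-L. (2 * t + j - 1) + (if v \<in> Q then 4 * t else 0))"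
    proof (rule sum_mono)
      fix v assume v: "v \<in> V - L"
      then show "d v \<le> (2 * t + j - 1) + (if v \<in> Q then 4 * t else 0)"
        using degree_small[OF v] p by (auto simp: Q_def)
    qed
    also have "\<dots> = card (V - L) * (2 * t + j - 1) + card Q * (4 * t)"
      using fQ finite_V by (simp add: sum.distrib sum.inter_restrict[symmetric] Int_absorb1)
    also have "\<dots> \<le> card V * (2 * t + j - 1) + card Q * (4 * t)"
      using finite_V by (intro add_right_mono mult_right_mono card_mono) auto
    finally have 2: "(\<Sum>v\<in>V-L. d v) \<le> card V * (2 * t + j - 1) + card Q * (4 * t)" .
    have "(\<Sum>v\<in>V. d v) = (\<Sum>v\<in>V-L. d v) + (\<Sum>v\<in>L. d v)"
      by (rule sum.subset_diff[OF L_sub finite_V])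
    then have "(\<Sum>v\<in>V. d v) \<le> card V * (2 * t + j - 1) + card Q * (4 * t) + card L * card V"
      using 1 2 by linarith
    also have "\<dots> \<le> card V * (2 * t + j - 1) + (3 * t + 2) * (4 * t) + card L * card V"
      using m by (intro add_mono mult_right_mono) auto
    also have "\<dots> = card V * (4 * t - 1) + (3 * t + 2) * (4 * t)"
    proof -
      have "4 * t - 1 = (2 * t + j - 1) + card L" using p by simp
      then show ?thesis by (simp add: algebra_simps)
    qed
    finally have "int (\<Sum>v\<in>V. d v) \<le> int (card V * (4 * t - 1) + (3 * t + 2) * (4 * t))"
      by (simp only: of_nat_le_iff)
    also have "\<dots> = int (card V) * (4 * int t - 1) + (3 * int t + 2) * (4 * int t)"
      using t by (simp add: of_nat_diff) (simp add: algebra_simps)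
    finally have a: "int (\<Sum>v\<in>V. d v) \<le> int (card V) * (4 * int t - 1) + (3 * int t + 2) * (4 * int t)" .
    have b: "int (\<Sum>v\<in>V. d v) \<le> 4 * (int t * int (card V)) - int (card V) + 12 * (int t)\<^sup>2 + 8 * int t"
      using a by (simp add: algebra_simps power2_eq_square)
    have c: "int (\<Sum>v\<in>V. d v) > 4 * (int t * int (card V)) - 4 * (int t)\<^sup>2 - 2 * int t"
      using degree_sum by simp
    have "2 \<le> int t" "2 * int t \<le> (int t)\<^sup>2" using t by (auto simp: power2_eq_square)
    then show False using b c card_V_int by linarith
  qed
  then obtain R where "R \<subseteq> Q" "card R = 3 * t + 3" by (meson obtain_subset_with_card_n)
  then show thesis using that[of R] by (auto simp: Q_def)
qed

text \<open>The degrees in \<open>R\<close> suffice for the target: a vertex of \<open>R\<close> has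
  target degree at most \<open>card L + 2 * j0 = 2 * t + j0\<close>. Hence an endpoint of a missing
  target edge has an edge outside \<open>H\<close>. All pairs between \<open>L\<close> and
  \<open>U\<close> are in \<open>H\<close>, so the other end of that edge avoids \<open>L\<close>,
  and the stuck-edge bound applies with \<open>B = L\<close>.\<close>

lemma small_L_completion:
  assumes p: "card L + j0 = 2 * t" "1 \<le> j0" and R: "R \<subseteq> V - L" "\<And>v. v \<in> R \<Longrightarrow> 2 * t + j0 \<le> d v"
    and J: "J \<subseteq> pairs R" "\<And>v. v \<in> R \<Longrightarrow> card (neighbors J v) \<le> 2 * j0"
    and cR: "card R \<le> 3 * t + 3" "card L + card R \<le> 4 * t + 3"
  obtains E where "realizes V d E" "pairs L \<subseteq> E" "cross L R \<subseteq> E" "J \<subseteq> E"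
proof -
  define H where "H = pairs L \<union> cross L R \<union> J"
  define U where "U = L \<union> R"
  obtain E1 where "realizes V d E1" using graphical by blast
  then obtain E where r: "realizes V d E" and st: "\<And>e. e \<in> H - E \<Longrightarrow> stuck V d H E e"
    using realizes_maximal[of V d E1 "{}" H] by auto
  have fR: "finite R" using R finite_V finite_subset by (metis finite_Diff)
  have fJ: "finite J" using J fR finite_subset finite_pairs by blast
  have cU: "card U = card L + card R" unfolding U_def using finite_L fR R by (intro card_Un_disjoint) auto
  have UV: "U \<subseteq> V" "L \<subseteq> U" using R L_sub by (auto simp: U_def)
  have HU: "H \<subseteq> pairs U"
  proof -
    have "L \<inter> R = {}" using R(1) by blast
    then have "cross L R \<subseteq> pairs U" by (auto simp: cross_iff U_def disjoint_iff)
    moreover have "pairs L \<subseteq> pairs U" "pairs R \<subseteq> pairs U" by (auto simp: pairs_def U_def)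
    ultimately show ?thesis using J(1) by (auto simp: H_def)
  qed
  have fU: "finite U" using UV finite_V finite_subset by blast
  have sgU: "simple_graph U H" using HU fU by (simp add: simple_graph_iff)
  have fin_nJ: "finite (neighbors J v)" "neighbors J v \<subseteq> R" if "v \<in> R" for v
  proof -
    show "neighbors J v \<subseteq> R" using J(1) by (auto simp: in_neighbors_iff dest!: subsetD)
    then show "finite (neighbors J v)" using fR finite_subset by blast
  qed
  have out: "\<exists>x'. {x, x'} \<in> E - H \<and> x' \<in> V - L" if xy: "{x, y} \<in> H" "{x, y} \<notin> E" for x y
  proof -
    have "{x, y} \<in> pairs U" using xy(1) HU by blast
    then have U: "x \<in> U" "y \<in> U" "x \<noteq> y" unfolding pair_in_pairs by blast+
    have fH: "finite (neighbors H x)" by (rule finite_neighbors[OF sgU])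
    have "card (neighbors H x - {y}) < d x"
    proof (cases "x \<in> L")
      case True
      have "neighbors H x - {y} \<subseteq> U - {x, y}"
        using neighbors_subset[OF sgU, of x] by blast
      then have "card (neighbors H x - {y}) \<le> card (U - {x, y})"
        using fU by (metis card_mono finite_Diff)
      also have "\<dots> \<le> card U - 2" using U fU by (subst card_Diff_subset) auto
      also have "\<dots> < d x" using True cU cR(2) t by (auto simp: L_def)
      finally show ?thesis .
    next
      case False
      then have xR: "x \<in> R" using U by (auto simp: U_def)
      have "neighbors H x \<subseteq> L \<union> neighbors J x"
        using False by (auto simp: H_def in_neighbors_iff cross_iff doubleton_eq_iff)
      then have "card (neighbors H x) \<le> card (L \<union> neighbors J x)"
        using finite_L fin_nJ[OF xR] by (intro card_mono) auto
      also have "\<dots> \<le> card L + card (neighbors J x)" by (rule card_Un_le)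
      also have "\<dots> \<le> 2 * t + j0" using J(2)[OF xR] p by simp
      finally have "card (neighbors H x) \<le> 2 * t + j0" .
      moreover have "y \<in> neighbors H x" using xy(1) by (simp add: in_neighbors_iff insert_commute)
      moreover have "card (neighbors H x - {y}) < card (neighbors H x)"
        using fH calculation(2) by (rule card_Diff1_less)
      ultimately show ?thesis using R(2)[OF xR] by linarith
    qed
    then have "\<not> neighbors E x \<subseteq> neighbors H x - {y}"
      using realizesD(5)[OF r, of x] U UV card_mono[of "neighbors H x - {y}" "neighbors E x"] fH by auto
    moreover have "y \<notin> neighbors E x" using xy(2) by (simp add: in_neighbors_iff insert_commute)
    ultimately obtain x' where x': "x' \<in> neighbors E x" "x' \<notin> neighbors H x" by blast
    have e: "{x, x'} \<in> E - H" using x' by (simp add: in_neighbors_iff insert_commute)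
    have e': "x' \<in> V" "x \<noteq> x'" using realizesD(7)[OF r, of x] x'(1) by blast+
    have "x' \<notin> L"
    proof
      assume "x' \<in> L"
      then have "{x, x'} \<in> H" using U(1) e'(2) by (auto simp: H_def U_def intro: crossI')
      then show False using e by blast
    qed
    then show ?thesis using e e'(1) by blast
  qed
  show thesis
  proof (cases "H \<subseteq> E")
    case True then show ?thesis using that[OF r] by (auto simp: H_def)
  next
    case False
    then obtain x y where xy: "{x, y} \<in> H" "{x, y} \<notin> E" "x \<noteq> y"
      using HU by (metis pairsE subsetD subsetI)
    obtain x' where x': "{x, x'} \<in> E - H" "x' \<in> V - L" using out[OF xy(1,2)] by blast
    obtain y' where y': "{y, y'} \<in> E - H" "y' \<in> V - L" using out[of y x] xy(1,2) by (metis insert_commute)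
    have stxy: "stuck V d H E {x, y}" using st xy by blast
    have Hout: "{b, q} \<notin> H" if "b \<in> L" "q \<in> V - U" for b q using HU that by auto
    have X: "{e \<in> E \<inter> H. e \<subseteq> V - L} \<subseteq> J" by (auto simp: H_def pairs_def cross_iff card_2_iff)
    obtain Z where Z: "Z \<subseteq> L" and bound: "int (\<Sum>v\<in>V. d v) \<le> int (card Z) * (int (card Z) - 1)
      + 2 * int (card Z) * (int (card V) - int (card Z))
      + 2 * int (card (L - Z)) * (int (6 * t) + int (card U))
      + 2 * (int (6 * t) - int (card Z)) * (int (6 * t) + 1 - int (card Z)) + 2 * int (card J)"
      by (rule stuck_degree_sum_bound[OF r stxy xy(2,3) x' y' subset_refl UV(2,1) degree_small Hout _ _ X fJ])
        auto
    have J_le: "card J \<le> card R * (2 * j0)"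
    proof -
      have "J \<subseteq> (\<Union>v\<in>R. (\<lambda>u. {u, v}) ` neighbors J v)"
      proof
        fix e assume e: "e \<in> J"
        then obtain u v where "e = {u, v}" "v \<in> R" using J(1) by (meson pairsE subsetD)
        moreover have "u \<in> neighbors J v" using e calculation(1) by (simp add: in_neighbors_iff)
        ultimately show "e \<in> (\<Union>v\<in>R. (\<lambda>u. {u, v}) ` neighbors J v)" by blast
      qed
      then have "card J \<le> card (\<Union>v\<in>R. (\<lambda>u. {u, v}) ` neighbors J v)"
        using fR fin_nJ by (intro card_mono) auto
      also have "\<dots> \<le> (\<Sum>v\<in>R. card ((\<lambda>u. {u, v}) ` neighbors J v))" using fR by (rule card_UN_le)
      also have "\<dots> \<le> (\<Sum>v\<in>R. 2 * j0)"
        by (intro sum_mono order_trans[OF card_image_le[OF fin_nJ(1)] J(2)])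
      finally show ?thesis by simp
    qed
    \<comment> \<open>\<open>j\<close> is the deficit of \<open>Z\<close>, at least the deficit
      \<open>j0\<close> of \<open>L\<close>; all errors have to be paid by multiples of
      \<open>j\<close>.\<close>
    define j where "j = 2 * t - card Z"
    have cZ: "card Z \<le> card L" using Z finite_L by (intro card_mono)
    have k: "int (card Z) = 2 * int t - int j" using cZ p by (simp add: j_def)
    have jj: "j0 \<le> j" "j \<le> 2 * t" using cZ p by (auto simp: j_def)
    have a: "card (L - Z) \<le> j" using Z finite_L p by (simp add: card_Diff_subset finite_subset j_def)
    have "card (L - Z) * (6 * t + card U) \<le> j * (10 * t + 3)" using a cU cR(2) by (intro mult_mono) auto
    moreover have "card J \<le> j * (6 * t + 6)"
    proof -
      have "card R * (2 * j0) \<le> (3 * t + 3) * (2 * j)" using cR(1) jj by (intro mult_mono) auto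
      then show ?thesis using J_le by (simp add: algebra_simps)
    qed
    ultimately have "card (L - Z) * (6 * t + card U) + card J \<le> j * (16 * t + 9)" by (simp add: algebra_simps)
    then have "int (card (L - Z) * (6 * t + card U) + card J) \<le> int (j * (16 * t + 9))"
      by (simp only: of_nat_le_iff)
    then have w1: "int (card (L - Z)) * (int (6 * t) + int (card U)) + int (card J) \<le> int j * (16 * int t + 9)"
      by simp
    have w2: "(4 * int t + int j) * (4 * int t + int j + 1) \<le> int j * (16 * (int t)\<^sup>2 + 14 * int t + 1)"
    proof -
      have j1: "1 \<le> int j" using jj p by simp
      have "int j * int j \<le> int j * (2 * int t)" using jj by (intro mult_left_mono) auto
      moreover have "1 * (16 * (int t)\<^sup>2 + 4 * int t) \<le> int j * (16 * (int t)\<^sup>2 + 4 * int t)"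
        using j1 by (intro mult_right_mono) auto
      ultimately show ?thesis by (simp add: algebra_simps power2_eq_square)
    qed
    \<comment> \<open>The linear factor is relaxed to a quadratic one so that, together with
      \<open>w2\<close>, it adds up to exactly half of the allowance in
      \<open>degree_sum_contradiction\<close>.\<close>
    have w3: "int j * (16 * int t + 9) \<le> int j * (4 * (int t)\<^sup>2 + 15 * int t + 10)"
    proof -
      have "16 * int t + 9 \<le> 4 * (int t)\<^sup>2 + 15 * int t + 10"
        using t self_le_power[of "int t" 2] zero_le_power2[of "int t"] by linarith
      then show ?thesis by (intro mult_left_mono) auto
    qed
    have "int (\<Sum>v\<in>V. d v) \<le> int (card Z) * (int (card Z) - 1)
      + 2 * int (card Z) * (int (card V) - int (card Z))
      + (2 * (int (card (L - Z)) * (int (6 * t) + int (card U)) + int (card J))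
      + 2 * ((4 * int t + int j) * (4 * int t + int j + 1)))"
      using bound unfolding k by (simp add: algebra_simps)
    then have False
    proof (rule degree_sum_contradiction[OF _ k])
      show "1 \<le> int j" using jj p by simp
      show "2 * (int (card (L - Z)) * (int (6 * t) + int (card U)) + int (card J))
        + 2 * ((4 * int t + int j) * (4 * int t + int j + 1)) \<le> int j * (40 * (int t)\<^sup>2 + 58 * int t + 22)"
        using w1 w2 w3 by (simp add: algebra_simps)
    qed
    then show ?thesis ..
  qed
qed

end

section \<open>At least 2t vertices of large degree: joining the top 2t to the outside\<close>

lemma top_subset:
  fixes f :: "'a \<Rightarrow> nat"
  assumes "finite A" "k \<le> card A"
  obtains B where "B \<subseteq> A" "card B = k" "\<And>a b. b \<in> B \<Longrightarrow> a \<in> A - B \<Longrightarrow> f a \<le> f b"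
proof -
  have "\<exists>B\<subseteq>A. card B = k \<and> (\<forall>b\<in>B. \<forall>a\<in>A-B. f a \<le> f b)" using assms(2)
  proof (induction k)
    case 0 then show ?case by (intro exI[of _ "{}"]) auto
  next
    case (Suc k)
    then obtain B where B: "B \<subseteq> A" "card B = k" "\<forall>b\<in>B. \<forall>a\<in>A-B. f a \<le> f b" by auto
    have fin: "finite (A - B)" "finite B" using assms(1) B(1) finite_subset by auto
    have "card (A - B) > 0" using B Suc.prems fin by (simp add: card_Diff_subset)
    then have ne: "A - B \<noteq> {}" by (metis card.empty less_irrefl)
    have "Max (f ` (A - B)) \<in> f ` (A - B)" using fin(1) ne by (intro Max_in) simp_all
    then obtain m where m: "m \<in> A - B" "f m = Max (f ` (A - B))" by (metis imageE)
    have mx: "f a \<le> f m" if "a \<in> A - B" for a using m(2) that fin by simp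
    show ?case
    proof (intro exI[of _ "insert m B"] conjI)
      show "insert m B \<subseteq> A" using m B by auto
      show "card (insert m B) = Suc k" using m B fin by simp
      show "\<forall>b\<in>insert m B. \<forall>a\<in>A - insert m B. f a \<le> f b" using B(3) mx by auto
    qed
  qed
  then show thesis using that by auto
qed

lemma degree_split:
  assumes "realizes V d E" "v \<in> V"
  shows "d v = card (neighbors E v - U) + card (neighbors E v \<inter> U)"
proof -
  have "d v = card ((neighbors E v - U) \<union> (neighbors E v \<inter> U))"
    using realizesD(5)[OF assms] by (simp add: Un_Diff_Int)
  also have "\<dots> = card (neighbors E v - U) + card (neighbors E v \<inter> U)"
    using realizesD(6)[OF assms(1)] by (intro card_Un_disjoint) auto
  finally show ?thesis .
qed

lemma pair_not_in_cross_pairs: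
  assumes "q \<notin> U" "L \<subseteq> U" "R \<subseteq> U" "B \<subseteq> U"
  shows "{b, q} \<notin> pairs L \<union> cross B R" "{q, b} \<notin> pairs L \<union> cross B R"
  using assms by (auto simp: cross_iff doubleton_eq_iff)

context dense_degrees
begin

text \<open>Here the lower bound on the degree sum is sharp. If all vertices of \<open>S\<close> had
  degree at most \<open>2 * t\<close>, this bound would cover both their degrees and their edges to
  \<open>B\<close> and \<open>w\<close>. The total would be at most
  \<open>2 * t * (2 * t - 1) + 4 * t + 4 * t * (n - 2 * t - 1)\<close>, which is exactly
  \<open>4 * t * n - 4 * t^2 - 2 * t\<close>.\<close>

lemma large_degree_outside:
  assumes B: "B \<subseteq> V" "card B = 2 * t" and w: "w \<in> V - B"
  obtains y where "y \<in> V - B" "y \<noteq> w" "2 * t + 1 \<le> d y"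
proof -
  note y = that
  have "\<exists>y\<in>V - B - {w}. 2 * t < d y"
  proof (rule ccontr)
    assume "\<not> ?thesis"
    then have le: "\<And>v. v \<in> V - B - {w} \<Longrightarrow> d v \<le> 2 * t" by (meson not_le)
    obtain E where r: "realizes V d E" using graphical by blast
    define S where "S = V - B - {w}"
    have f: "finite B" "finite S" using B finite_V finite_subset by (auto simp: S_def)
    let ?N = "\<lambda>v A. card (neighbors E v \<inter> A)"
    have part: "d v = ?N v B + ?N v {w} + ?N v S" if "v \<in> V" for v
    proof -
      have "neighbors E v \<inter> (insert w B - B) = neighbors E v \<inter> {w}" using w by auto
      moreover have "V - insert w B = S" using w by (auto simp: S_def)
      ultimately show ?thesis using degree_partition3[OF r, of B "insert w B" v] B w that by auto
    qed
    have "(\<Sum>v\<in>B. d v) = (\<Sum>v\<in>B. ?N v B + ?N v {w} + ?N v S)" using part B by (intro sum.cong) auto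
    then have sB: "(\<Sum>v\<in>B. d v) = (\<Sum>v\<in>B. ?N v B) + ?N w B + (\<Sum>v\<in>S. ?N v B)"
      using sum_card_neighbors_commute[of B "{w}" E] sum_card_neighbors_commute[of B S E] f
      by (simp add: sum.distrib)
    have "(\<Sum>v\<in>B. ?N v B) \<le> (\<Sum>v\<in>B. 2 * t - 1)"
    proof (rule sum_mono)
      fix v assume v: "v \<in> B"
      have "neighbors E v \<inter> B \<subseteq> B - {v}" using realizesD(7)[OF r, of v] by auto
      then have "?N v B \<le> card (B - {v})" using f by (intro card_mono) auto
      then show "?N v B \<le> 2 * t - 1" using v B f by simp
    qed
    then have BB: "(\<Sum>v\<in>B. ?N v B) \<le> 2 * t * (2 * t - 1)" using B by simp
    have dw: "d w = ?N w B + (\<Sum>v\<in>S. ?N v {w})"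
      using part[of w] w realizesD(7)[OF r, of w] sum_card_neighbors_commute[of S "{w}" E] f by auto
    have wB: "?N w B \<le> 2 * t" using B f by (metis Int_lower2 card_mono)
    have "(\<Sum>v\<in>S. d v) \<le> (\<Sum>v\<in>S. 2 * t)" using le by (intro sum_mono) (auto simp: S_def)
    then have dS: "(\<Sum>v\<in>S. d v) \<le> card S * (2 * t)" by simp
    have "(\<Sum>v\<in>S. ?N v B + ?N v {w}) \<le> (\<Sum>v\<in>S. 2 * t)"
    proof (rule sum_mono)
      fix v assume v: "v \<in> S"
      then show "?N v B + ?N v {w} \<le> 2 * t" using part[of v] le[of v] by (simp add: S_def)
    qed
    then have NS: "(\<Sum>v\<in>S. ?N v B) + (\<Sum>v\<in>S. ?N v {w}) \<le> card S * (2 * t)" by (simp add: sum.distrib)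
    have VU: "V = insert w (B \<union> S)" using B w by (auto simp: S_def)
    have "(\<Sum>v\<in>V. d v) = d w + (\<Sum>v\<in>B \<union> S. d v)"
      unfolding VU using f w by (subst sum.insert) (auto simp: S_def)
    also have "(\<Sum>v\<in>B \<union> S. d v) = (\<Sum>v\<in>B. d v) + (\<Sum>v\<in>S. d v)"
      using f by (intro sum.union_disjoint) (auto simp: S_def)
    finally have "(\<Sum>v\<in>V. d v) \<le> 2 * t * (2 * t - 1) + 4 * t + 2 * (card S * (2 * t))"
      using sB BB dw wB dS NS by linarith
    then have "int (\<Sum>v\<in>V. d v) \<le> int (2 * t * (2 * t - 1) + 4 * t + 2 * (card S * (2 * t)))"
      by (simp only: of_nat_le_iff)
    also have "\<dots> = 2 * int t * (2 * int t - 1) + 4 * int t + 4 * int t * int (card S)"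
      using t by (simp add: of_nat_diff)
    also have "int (card S) = int (card V) - 2 * int t - 1"
    proof -
      have "card V = Suc (card (B \<union> S))" unfolding VU using f w by (subst card_insert_disjoint) (auto simp: S_def)
      also have "card (B \<union> S) = card B + card S" using f by (intro card_Un_disjoint) (auto simp: S_def)
      finally show ?thesis using B by simp
    qed
    finally show False using degree_sum by (simp add: algebra_simps power2_eq_square)
  qed
  then obtain v where "v \<in> V - B - {w}" "2 * t < d v" by blast
  then show thesis using y[of v] by simp
qed

text \<open>For use with \<open>k = card Z\<close>, \<open>a = card (L - Z)\<close>,
  \<open>u = card U\<close> and \<open>X = {}\<close>. A deficit \<open>j\<close> allows about
  \<open>40 * j * t^2\<close> of error, and the fixed cost is about \<open>32 * t^2\<close>. If
  \<open>card L\<close> may be as large as \<open>3 * t + 1\<close>, the term with \<open>a\<close>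
  adds about \<open>18 * t^2\<close>; a deficit of 2 pays for this, while 1 in general does not.
  This is the reason for the two alternatives.\<close>

lemma small_switch_contradiction:
  assumes bound: "int (\<Sum>v\<in>V. d v) \<le> int k * (int k - 1) + 2 * int k * (int (card V) - int k)
      + 2 * int a * (int (6 * t) + int u) + 2 * (int (6 * t) - int k) * (int (6 * t) + 1 - int k)
      + 2 * int (card ({} :: 'a set set))"
    and k: "k + j = 2 * t" and u: "u = 3 * t + 2"
    and j: "1 \<le> j \<and> a \<le> j + 1 \<or> 2 \<le> j \<and> a \<le> t + 1 + j"
  shows False
proof -
  let ?t = "int t" and ?j = "int j"
  have k': "int k = 2 * ?t - ?j" using k by linarith
  have b: "int (\<Sum>v\<in>V. d v) \<le> int k * (int k - 1) + 2 * int k * (int (card V) - int k)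
      + (2 * int a * (9 * ?t + 2) + 2 * (4 * ?t + ?j) * (4 * ?t + ?j + 1))"
    using bound unfolding k' u by (simp add: algebra_simps)
  have jj: "?j * ?j \<le> 2 * (?j * ?t)" using k mult_left_mono[of ?j "2 * ?t" ?j] by (simp add: algebra_simps)
  have ex: "2 * (4 * ?t + ?j) * (4 * ?t + ?j + 1) = 32 * ?t\<^sup>2 + 8 * ?t + 16 * (?j * ?t) + 2 * (?j * ?j) + 2 * ?j"
    by (simp add: algebra_simps power2_eq_square)
  have T: "?t \<le> ?t\<^sup>2" "?j * ?t \<le> ?j * ?t\<^sup>2"
    using t self_le_power[of ?t 2] by (auto intro: mult_left_mono)
  have w: "2 * int a * (9 * ?t + 2) + 2 * (4 * ?t + ?j) * (4 * ?t + ?j + 1)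
    \<le> ?j * (40 * ?t\<^sup>2 + 58 * ?t + 22)"
    using j
  proof
    assume j: "1 \<le> j \<and> a \<le> j + 1"
    then have "int a * (9 * ?t + 2) \<le> (?j + 1) * (9 * ?t + 2)" by (intro mult_right_mono) auto
    then have a: "int a * (9 * ?t + 2) \<le> 9 * (?j * ?t) + 2 * ?j + 9 * ?t + 2" by (simp add: algebra_simps)
    have "1 * ?t \<le> ?j * ?t" "1 * ?t\<^sup>2 \<le> ?j * ?t\<^sup>2" using j by (intro mult_right_mono; simp)+
    then have "18 * (?j * ?t) + 4 * ?j + 18 * ?t + 4 + 32 * ?t\<^sup>2 + 8 * ?t + 16 * (?j * ?t) + 2 * (?j * ?j) + 2 * ?j
      \<le> 40 * (?j * ?t\<^sup>2) + 58 * (?j * ?t) + 22 * ?j" using j jj T by linarith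
    then show ?thesis using a ex by (simp add: algebra_simps)
  next
    assume j: "2 \<le> j \<and> a \<le> t + 1 + j"
    then have "int a * (9 * ?t + 2) \<le> (?t + 1 + ?j) * (9 * ?t + 2)" by (intro mult_right_mono) auto
    then have a: "int a * (9 * ?t + 2) \<le> 9 * ?t\<^sup>2 + 11 * ?t + 2 + 9 * (?j * ?t) + 2 * ?j"
      by (simp add: algebra_simps power2_eq_square)
    have "2 * ?t \<le> ?j * ?t" "2 * ?t\<^sup>2 \<le> ?j * ?t\<^sup>2" using j by (intro mult_right_mono; simp)+
    then have "18 * ?t\<^sup>2 + 22 * ?t + 4 + 18 * (?j * ?t) + 4 * ?j + 32 * ?t\<^sup>2 + 8 * ?t + 16 * (?j * ?t) + 2 * (?j * ?j) + 2 * ?j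
      \<le> 40 * (?j * ?t\<^sup>2) + 58 * (?j * ?t) + 22 * ?j" using j jj T by linarith
    then show ?thesis using a ex by (simp add: algebra_simps)
  qed
  have "1 \<le> ?j" using j by auto
  from degree_sum_contradiction[OF b k' this w] show False .
qed

text \<open>Let \<open>{x, y}\<close> be missing and stuck. Every neighbour \<open>x'\<close> of
  \<open>x\<close> outside \<open>U\<close> misses some vertex of \<open>B\<close>, or its degree
  would exceed that of \<open>y\<close>, against the choice of \<open>R\<close>. If \<open>y\<close>
  has a neighbour outside \<open>L\<close>, then both \<open>x\<close> and a missed vertex drop out
  of \<open>Z\<close>, and the deficit 2 suffices. If all neighbours of \<open>y\<close> are in
  \<open>L\<close>, the partner \<open>y'\<close> has no degree bound a priori; comparing
  \<open>d y'\<close> with degrees in \<open>B\<close> supplies one.\<close>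

lemma complete_top_outside:
  assumes r1: "realizes V d E1" "pairs L \<subseteq> E1"
    and B: "B \<subseteq> L" "card B = 2 * t" "\<And>a b. b \<in> B \<Longrightarrow> a \<in> L - B \<Longrightarrow> d a \<le> d b"
    and R: "R \<subseteq> V - L" "card L + card R = 3 * t + 2" "\<And>a b. b \<in> R \<Longrightarrow> a \<in> V - L - R \<Longrightarrow> d a \<le> d b"
  obtains E where "realizes V d E" "pairs L \<subseteq> E" "cross B R \<subseteq> E"
proof -
  define H where "H = pairs L \<union> cross B R"
  define U where "U = L \<union> R"
  obtain E where r: "realizes V d E" and LE: "pairs L \<subseteq> E" and st: "\<And>e. e \<in> H - E \<Longrightarrow> stuck V d H E e"
    using realizes_maximal[OF r1, of H] by (auto simp: H_def)
  have fR: "finite R" using R(1) finite_V finite_subset by (metis finite_Diff)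
  have fB: "finite B" using B(1) finite_L finite_subset by blast
  have LR: "L \<inter> R = {}" using R(1) by blast
  have U: "card U = 3 * t + 2" "U \<subseteq> V" "L \<subseteq> U" "R \<subseteq> U" "B \<subseteq> U" "finite U"
    using R B(1) L_sub finite_L fR LR by (auto simp: U_def card_Un_disjoint)
  have pB: "2 * t \<le> card L" using B finite_L by (metis card_mono)
  show thesis
  proof (cases "cross B R \<subseteq> E")
    case True then show ?thesis using that[OF r LE] by blast
  next
    case False
    then obtain x y where xy: "x \<in> B" "y \<in> R" "{x, y} \<notin> E" unfolding cross_def by blast
    have xL: "x \<in> L" "x \<in> V" and yV: "y \<in> V" "y \<notin> L" "y \<notin> B" and xny: "x \<noteq> y"
      using xy B(1) R(1) L_sub by blast+
    have stxy: "stuck V d H E {x, y}" using st xy crossI[OF xy(1,2)] by (simp add: H_def)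
    define No where "No v = neighbors E v - U" for v
    have fNo: "finite (No v)" for v unfolding No_def using realizesD(6)[OF r] by simp
    have Hout: "{b, q} \<notin> H" if "q \<notin> U" for b q
      using pair_not_in_cross_pairs(1)[OF that U(3,4,5)] by (simp add: H_def)
    have No_edge: "{b, q} \<in> E - H" "q \<in> V - L" "q \<in> V - U" if "q \<in> No b" for b q
    proof -
      have q: "q \<in> neighbors E b" "q \<notin> U" using that by (auto simp: No_def)
      show "{b, q} \<in> E - H" using q(1) Hout[OF q(2)] by (simp add: in_neighbors_iff insert_commute)
      show "q \<in> V - L" "q \<in> V - U" using q U(3) realizesD(7)[OF r, of b] by blast+
    qed
    have y_edge: "{y, y'} \<in> E - H" if "y' \<in> neighbors E y - B" for y'
    proof -
      have "{y, y'} \<notin> cross B R"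
        using that yV(3) by (auto simp: cross_iff doubleton_eq_iff)
      moreover have "{y, y'} \<notin> pairs L" using yV(2) by simp
      ultimately show ?thesis using that by (simp add: H_def in_neighbors_iff insert_commute)
    qed
    have st2: "x' \<in> closed_nbh E y'" if "x' \<in> No x" "y' \<in> neighbors E y - B" for x' y'
      using stuck_switch2[OF r stxy xy(3) xny No_edge(1)[OF that(1)] y_edge[OF that(2)]] .
    have nx: "No x \<noteq> {}"
    proof
      assume "No x = {}"
      then have "neighbors E x \<subseteq> U - {x}" using realizesD(7)[OF r, of x] by (auto simp: No_def)
      then have "card (neighbors E x) \<le> card (U - {x})" using U(6) by (intro card_mono) auto
      also have "\<dots> \<le> 3 * t + 2" using U(1,6) by (metis card_Diff1_le)
      finally show False using realizesD(5)[OF r xL(2)] xL(1) t by (auto simp: L_def)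
    qed
    \<comment> \<open>\<open>R\<close> holds the largest degrees outside \<open>L\<close>, so
      otherwise all vertices of degree at least \<open>2 * t\<close> would lie in
      \<open>U - {y}\<close>, a set of \<open>3 * t + 1\<close> vertices.\<close>
    have dy: "2 * t \<le> d y"
    proof (rule ccontr)
      assume "\<not> 2 * t \<le> d y"
      then have le: "d y \<le> 2 * t - 1" by simp
      show False
      proof (rule many_large_degrees[of "U - {y}"])
        show "card (U - {y}) \<le> 3 * t + 1" using U xy(2) by auto
        show "U - {y} \<subseteq> V" using U by auto
        fix v assume "v \<in> V - (U - {y})"
        then consider "v = y" | "v \<in> V - L - R" by (auto simp: U_def)
        then show "d v \<le> 2 * t - 1" using le R(3)[OF xy(2)] by cases (simp, meson order_trans)
      qed
    qed
    have NyB: "card (neighbors E y \<inter> B) \<le> 2 * t - 1"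
    proof -
      have "neighbors E y \<inter> B \<subseteq> B - {x}" using xy(3) by (auto simp: in_neighbors_iff)
      then have "card (neighbors E y \<inter> B) \<le> card (B - {x})" using fB by (intro card_mono) auto
      then show ?thesis using xy(1) B(2) fB by simp
    qed
    have ny: "neighbors E y - B \<noteq> {}"
    proof
      assume "neighbors E y - B = {}"
      then have "d y = card (neighbors E y \<inter> B)" using degree_split[OF r yV(1), of B] by (metis add_0 card.empty)
      then show False using NyB dy t by simp
    qed
    have miss: "\<exists>z\<in>B. z \<notin> neighbors E x'" if x': "x' \<in> No x" for x'
    proof (rule ccontr)
      assume "\<not> ?thesis"
      then have BN: "B \<subseteq> neighbors E x'" by blast
      define A where "A = neighbors E y - B"
      \<comment> \<open>\<open>x'\<close> is not its own neighbour; if it lies in \<open>A\<close>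
        it is traded for \<open>y\<close>, then a neighbour of \<open>x'\<close>, and the size is
        kept.\<close>
      define A' where "A' = (if x' \<in> A then insert y (A - {x'}) else A)"
      have fA: "finite A" unfolding A_def using realizesD(6)[OF r] by simp
      have yA: "y \<notin> A" unfolding A_def using realizesD(7)[OF r, of y] by blast
      have cA: "card A' = card A"
      proof (cases "x' \<in> A")
        case True
        then have "card A' = Suc (card (A - {x'}))" using fA yA unfolding A'_def by simp
        also have "\<dots> = card A" by (rule card_Suc_Diff1[OF fA True])
        finally show ?thesis .
      qed (simp add: A'_def)
      have "A \<subseteq> insert x' (neighbors E x')" using st2[OF x'] closed_nbh_commute[of x' E]
        by (auto simp: A_def closed_nbh_def)
      moreover have "x' \<in> A \<Longrightarrow> y \<in> neighbors E x'" using neighbors_commute[of x' E y] by (simp add: A_def)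
      moreover have "A \<inter> B = {}" by (auto simp: A_def)
      ultimately have "A' \<union> B \<subseteq> neighbors E x'" "A' \<inter> B = {}" using BN yV(3) by (auto simp: A'_def)
      \<comment> \<open>\<open>x'\<close> has \<open>2 * t\<close> neighbours in \<open>B\<close>
        where \<open>y\<close> has at most \<open>2 * t - 1\<close>, and as many others; so
        \<open>d x'\<close> exceeds \<open>d y\<close>.\<close>
      then have "card A' + card B \<le> card (neighbors E x')"
        using fB fA realizesD(6)[OF r]
        by (subst card_Un_disjoint[symmetric]) (auto simp: A'_def intro!: card_mono)
      moreover have "d y = card A + card (neighbors E y \<inter> B)"
        unfolding A_def by (rule degree_split[OF r yV(1)])
      moreover have "x' \<in> V - L - R" using No_edge(3)[OF x'] by (auto simp: U_def)
      moreover have "d x' \<le> d y" using R(3)[OF xy(2)] calculation(3) by blast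
      moreover have "card (neighbors E x') = d x'" using realizesD(5)[OF r, of x'] calculation(3) by blast
      ultimately show False using cA NyB B(2) t by linarith
    qed
    have XE: "{e \<in> E \<inter> H. e \<subseteq> V - L} \<subseteq> {}"
      using B(1) by (auto simp: H_def pairs_def cross_iff card_2_iff)
    obtain x' where x': "x' \<in> No x" using nx by blast
    obtain z where z: "z \<in> B" "z \<notin> neighbors E x'" using miss[OF x'] by blast
    have zx: "z \<noteq> x" using z(2) x' neighbors_commute[of x E x'] by (auto simp: No_def)
    have False
    proof (cases "\<exists>y'\<in>neighbors E y - B. y' \<notin> L")
      case True
      then obtain y' where y': "y' \<in> neighbors E y - B" "y' \<notin> L" by blast
      have y'V: "y' \<in> V - L" using y' realizesD(7)[OF r, of y] by blast
      have ms: "B = L \<or> (\<exists>b\<in>B. b \<notin> neighbors E x' \<or> b \<notin> neighbors E y')" using z by blast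
      have Hout': "{b, q} \<notin> H" if "b \<in> L" "q \<in> V - U" for b q using Hout that by blast
      obtain Z where Z: "Z \<subseteq> B" "Z \<subseteq> neighbors E x'" "Z \<subseteq> neighbors E y'"
        "\<And>b. b \<in> Z \<Longrightarrow> \<not> neighbors E b - U \<subseteq> closed_nbh E y'"
        and bound: "int (\<Sum>v\<in>V. d v) \<le> int (card Z) * (int (card Z) - 1)
        + 2 * int (card Z) * (int (card V) - int (card Z))
        + 2 * int (card (L - Z)) * (int (6 * t) + int (card U))
        + 2 * (int (6 * t) - int (card Z)) * (int (6 * t) + 1 - int (card Z)) + 2 * int (card ({} :: 'a set set))"
        by (rule stuck_degree_sum_bound[OF r stxy xy(3) xny No_edge(1,2)[OF x'] y_edge[OF y'(1)] y'V
              B(1) U(3,2) degree_small Hout' B(3) ms XE finite.emptyI]) auto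
      \<comment> \<open>By the two-edge switch the outer neighbours of \<open>x\<close> all lie in
        the closed neighbourhood of \<open>y'\<close>, which excludes \<open>x\<close>;
        \<open>z\<close> is excluded because it misses \<open>x'\<close>.\<close>
      have "x \<notin> Z" using Z(4)[of x] st2[OF _ y'(1)] by (auto simp: No_def)
      moreover have "z \<notin> Z" using z Z(2) by blast
      ultimately have "Z \<subseteq> B - {x, z}" using Z(1) by blast
      then have "card Z \<le> card (B - {x, z})" using fB by (intro card_mono) auto
      also have "\<dots> = 2 * t - 2" using xy(1) z(1) zx B(2) fB by (subst card_Diff_subset) auto
      finally have cZ: "card Z \<le> 2 * t - 2" .
      have "card (L - Z) = card L - card Z"
        by (rule card_Diff_subset[OF finite_subset[OF Z(1) fB] order_trans[OF Z(1) B(1)]])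
      moreover have "card R > 0" using xy(2) fR card_gt_0_iff by blast
      ultimately have a: "card (L - Z) \<le> t + 1 + (2 * t - card Z)" using R(2) cZ pB by linarith
      show False
        by (rule small_switch_contradiction[OF bound _ U(1), of "2 * t - card Z"]) (use a cZ t in auto)
    next
      case False
      then obtain y' where y': "y' \<in> neighbors E y - B" "y' \<in> L" using ny by blast
      have y'V: "y' \<in> V" "y' \<in> L - B" using y' L_sub by blast+
      have sw: "p \<in> closed_nbh E w \<or> q \<in> closed_nbh E y'" if "w \<in> No x" "{p, q} \<in> E - H" for w p q
        using stuck_switch3[OF r stxy xy(3) xny No_edge(1)[OF that(1)] y_edge[OF y'(1)] that(2)] .
      \<comment> \<open>Only the confinement by \<open>y'\<close> is recorded. As \<open>y'\<close>
        is in \<open>L\<close>, the size of its neighbourhood is not yet bounded; the estimates up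
        to \<open>y'No\<close> provide a bound in terms of \<open>g\<close>.\<close>
      define C where "C = {b \<in> L. No b \<subseteq> closed_nbh E y'}"
      define g where "g = card (B \<inter> C)"
      define Z where "Z = B - C"
      define r' where "r' = card R - 1"
      have cR: "card R = r' + 1" "r' \<le> t"
      proof -
        have "card R > 0" using xy(2) fR card_gt_0_iff by blast
        then show "card R = r' + 1" by (simp add: r'_def)
        have "card (insert y' B) \<le> card L" using y'V(2) B(1) finite_L by (intro card_mono) auto
        then have "2 * t + 1 \<le> card L" using y'V(2) fB B(2) by simp
        then show "r' \<le> t" using R(2) by (simp add: r'_def)
      qed
      have LC: "b \<in> neighbors E w" if b: "b \<in> L" "b \<notin> C" and w: "w \<in> No x" for b w
      proof -
        obtain q where q: "q \<in> No b" "q \<notin> closed_nbh E y'" using b by (auto simp: C_def)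
        then have "b \<in> closed_nbh E w" using sw[OF w No_edge(1)[OF q(1)]] by blast
        then show ?thesis using No_edge(2)[OF w] b(1) by (auto simp: closed_nbh_def)
      qed
      have xC: "x \<in> C" using st2[OF _ y'(1)] xL(1) by (auto simp: C_def)
      have NoC: "No b \<subseteq> No y'" if "b \<in> C" for b
        using that y'(2) U(3) by (auto simp: C_def No_def closed_nbh_def)
      have dL: "d v = card (No v) + card (neighbors E v \<inter> R) + (card L - 1)" if v: "v \<in> L" for v
      proof -
        have "neighbors E v \<inter> L = L - {v}"
        proof
          show "neighbors E v \<inter> L \<subseteq> L - {v}" using realizesD(7)[OF r, of v] by blast
          show "L - {v} \<subseteq> neighbors E v \<inter> L"
          proof
            fix u assume "u \<in> L - {v}"
            then have "{u, v} \<in> pairs L" using v by simp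
            then show "u \<in> neighbors E v \<inter> L" using LE \<open>u \<in> L - {v}\<close> by (auto simp: in_neighbors_iff)
          qed
        qed
        moreover have "neighbors E v \<inter> U = neighbors E v \<inter> L \<union> neighbors E v \<inter> R" by (auto simp: U_def)
        moreover have "card (neighbors E v \<inter> L \<union> neighbors E v \<inter> R)
          = card (neighbors E v \<inter> L) + card (neighbors E v \<inter> R)"
          using finite_L fR LR by (intro card_Un_disjoint) auto
        moreover have "d v = card (No v) + card (neighbors E v \<inter> U)"
          unfolding No_def using v L_sub by (intro degree_split[OF r]) auto
        ultimately show ?thesis using v finite_L by simp
      qed
      have NyR: "1 \<le> card (neighbors E y' \<inter> R)"
      proof -
        have "y \<in> neighbors E y' \<inter> R" using y'(1) xy(2) neighbors_commute[of y E y'] by blast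
        then show ?thesis using fR card_gt_0_iff[of "neighbors E y' \<inter> R"] by auto
      qed
      \<comment> \<open>\<open>No z\<close> and the part of \<open>No x\<close> missed by
        \<open>z\<close> are disjoint subsets of \<open>No y'\<close>. Since
        \<open>d y' \<le> d z\<close> and \<open>L\<close> is a clique, \<open>No y'\<close> exceeds
        \<open>No z\<close> by at most the surplus of \<open>z\<close> in neighbours in
        \<open>R\<close>, which is at most \<open>card R - 1\<close> because \<open>y'\<close> is
        adjacent to \<open>y\<close>.\<close>
      have missed: "card (No x - neighbors E z) \<le> r'" if z: "z \<in> B \<inter> C" for z
      proof -
        have "No z \<union> (No x - neighbors E z) \<subseteq> No y'" using NoC[of z] NoC[OF xC] z by auto
        then have "card (No z \<union> (No x - neighbors E z)) \<le> card (No y')" using fNo by (intro card_mono)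
        moreover have "card (No z \<union> (No x - neighbors E z)) = card (No z) + card (No x - neighbors E z)"
          using fNo by (intro card_Un_disjoint) (auto simp: No_def)
        moreover have "d y' \<le> d z" using B(3) z y'V(2) by blast
        moreover have "card (neighbors E z \<inter> R) \<le> card R" using fR by (intro card_mono) auto
        ultimately show ?thesis using dL[OF y'(2)] dL[of z] z B(1) NyR cR(1) by auto
      qed
      \<comment> \<open>Each vertex of \<open>No x\<close> is missed by some vertex of
        \<open>B\<close>, which lies in \<open>C\<close> and differs from \<open>x\<close>; these
        \<open>g - 1\<close> vertices miss at most \<open>r'\<close> each.\<close>
      have xNo: "card (No x) \<le> (g - 1) * r'"
      proof -
        have sub: "No x \<subseteq> (\<Union>z\<in>B \<inter> C - {x}. No x - neighbors E z)"
        proof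
          fix w assume w: "w \<in> No x"
          obtain z where z: "z \<in> B" "z \<notin> neighbors E w" using miss[OF w] by blast
          then have "z \<in> C" using LC[OF _ _ w] B(1) by blast
          moreover have "z \<noteq> x" using z(2) w neighbors_commute[of x E w] by (auto simp: No_def)
          moreover have "w \<notin> neighbors E z" using z(2) neighbors_commute[of w E z] by blast
          ultimately show "w \<in> (\<Union>z\<in>B \<inter> C - {x}. No x - neighbors E z)" using z(1) w by blast
        qed
        have "card (No x) \<le> card (\<Union>z\<in>B \<inter> C - {x}. No x - neighbors E z)"
          using fB fNo by (intro card_mono[OF _ sub]) simp
        also have "\<dots> \<le> (\<Sum>z\<in>B \<inter> C - {x}. card (No x - neighbors E z))" using fB by (intro card_UN_le) simp
        also have "\<dots> \<le> (\<Sum>z\<in>B \<inter> C - {x}. r')" using missed by (intro sum_mono) blast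
        also have "\<dots> = (g - 1) * r'" using xC xy(1) fB by (simp add: g_def)
        finally show ?thesis .
      qed
      have g2: "2 \<le> g"
      proof -
        have "z \<in> C" using LC[OF _ _ x'] z B(1) by blast
        then have "card {x, z} \<le> g" unfolding g_def using z(1) xy(1) xC fB by (intro card_mono) auto
        then show ?thesis using zx by simp
      qed
      \<comment> \<open>The bound passes from \<open>No x\<close> to \<open>No y'\<close> by
        \<open>d y' \<le> d x\<close>; the extra \<open>r'\<close> accounts for neighbours of
        \<open>x\<close> in \<open>R - {y}\<close>.\<close>
      have y'No: "card (No y') \<le> g * r'"
      proof -
        have "neighbors E x \<inter> R \<subseteq> R - {y}" using xy(3) by (auto simp: in_neighbors_iff insert_commute)
        then have "card (neighbors E x \<inter> R) \<le> card (R - {y})" using fR by (intro card_mono) auto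
        also have "\<dots> = r'" using xy(2) fR cR(1) by simp
        finally have "card (No y') \<le> (g - 1) * r' + r'"
          using B(3)[OF xy(1) y'V(2)] dL[OF y'(2)] dL[OF xL(1)] xNo by linarith
        also have "\<dots> = g * r'" using g2 by (cases g) auto
        finally show ?thesis .
      qed
      have dC: "d v \<le> g * r' + (3 * t + 1)" if "v \<in> C" for v
      proof -
        have "card (No v) \<le> card (No y')" using NoC[OF that] fNo by (intro card_mono)
        moreover have "card (neighbors E v \<inter> R) \<le> card R" using fR by (intro card_mono) auto
        moreover have "v \<in> L" using that by (simp add: C_def)
        ultimately show ?thesis using dL[of v] y'No R(2) pB t by linarith
      qed
      have mid: "d v \<le> g * r' + (3 * t + 1)" if v: "v \<in> L - Z" for v
      proof (cases "v \<in> C")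
        case True then show ?thesis by (rule dC)
      next
        case False
        then have "v \<in> L - B" using v by (auto simp: Z_def)
        then show ?thesis using B(3)[OF xy(1)] dC[OF xC] by (meson order_trans)
      qed
      have gle: "g \<le> 2 * t" unfolding g_def using B(2) fB by (metis Int_lower1 card_mono)
      have cZ: "card Z + g = 2 * t"
      proof -
        have "card Z = card B - g" unfolding Z_def g_def using fB by (intro card_Diff_subset_Int) simp
        then show ?thesis using gle B(2) by simp
      qed
      have ZL: "Z \<subseteq> L" using B(1) by (auto simp: Z_def)
      have Zx: "Z \<subseteq> neighbors E x'" using LC[OF _ _ x'] B(1) by (auto simp: Z_def)
      define P1 where "P1 = closed_nbh E x' \<inter> (V - L)"
      define P2 where "P2 = closed_nbh E y' \<inter> (V - L)"
      have P1: "card P1 \<le> 4 * t + g + 1"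
      proof -
        have "P1 \<subseteq> insert x' (neighbors E x' - Z)" using ZL by (auto simp: P1_def closed_nbh_def)
        then have "card P1 \<le> card (insert x' (neighbors E x' - Z))"
          using realizesD(6)[OF r] by (intro card_mono) auto
        also have "\<dots> \<le> card (neighbors E x' - Z) + 1"
          using realizesD(6)[OF r] by (simp add: card_insert_if)
        also have "card (neighbors E x' - Z) = card (neighbors E x') - card Z"
          by (rule card_Diff_subset[OF finite_subset[OF ZL finite_L] Zx])
        finally show ?thesis
          using realizesD(5)[OF r, of x'] degree_small[OF No_edge(2)[OF x']] No_edge(2)[OF x'] cZ by auto
      qed
      have P2: "card P2 \<le> g * r' + r' + 1"
      proof -
        have "P2 \<subseteq> No y' \<union> R" using y'(2) by (auto simp: P2_def closed_nbh_def No_def U_def)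
        then have "card P2 \<le> card (No y' \<union> R)" using fNo fR by (intro card_mono) auto
        also have "\<dots> \<le> card (No y') + card R" by (rule card_Un_le)
        finally show ?thesis using y'No cR(1) by simp
      qed
      have a: "card (L - Z) \<le> t + 1 + g"
      proof -
        have "card (L - Z) = card L - card Z"
          by (rule card_Diff_subset[OF finite_subset[OF ZL finite_L] ZL])
        then show ?thesis using cZ R(2) cR(1) by linarith
      qed
      let ?g = "int g" and ?t = "int t"
      have bound: "int (\<Sum>v\<in>V. d v) \<le> int (card Z) * (int (card Z) - 1)
        + 2 * int (card Z) * (int (card V) - int (card Z))
        + 2 * int (card (L - Z)) * int (g * r' + (3 * t + 1))
        + (int (6 * t) - int (card Z)) * (int (card P1) + int (card P2)) + 2 * int (card ({} :: 'a set set))"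
      proof (rule degree_sum_bound[OF r ZL L_sub degree_small mid _ _ finite.emptyI _ refl])
        show "P1 \<subseteq> V - L" "P2 \<subseteq> V - L" by (auto simp: P1_def P2_def)
        fix p q assume pq: "{p, q} \<in> E" "p \<in> V - L" "q \<in> V - L"
        have "{p, q} \<notin> H" using XE pq by auto
        then show "{p, q} \<in> {} \<or> p \<in> P1 \<or> q \<in> P2"
          using sw[OF x', of p q] pq by (auto simp: P1_def P2_def)
      qed auto
      \<comment> \<open>Here \<open>g\<close> is the deficit; it is at least 2 because
        \<open>B \<inter> C\<close> contains \<open>x\<close> and the vertex \<open>z\<close> missed
        by \<open>x'\<close>.\<close>
      have kg: "int (card Z) = 2 * ?t - ?g" using cZ by linarith
      have w: "2 * int (card (L - Z)) * int (g * r' + (3 * t + 1))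
        + (int (6 * t) - int (card Z)) * (int (card P1) + int (card P2)) + 2 * int (card ({} :: 'a set set))
        \<le> ?g * (40 * ?t\<^sup>2 + 58 * ?t + 22)"
      proof -
        have gr: "g * r' \<le> g * t" using cR(2) by simp
        have "card (L - Z) * (g * r' + (3 * t + 1)) \<le> (t + 1 + g) * (g * t + (3 * t + 1))"
          using a gr by (intro mult_mono) auto
        moreover have "(4 * t + g) * (card P1 + card P2) \<le> (4 * t + g) * (4 * t + g + 1 + (g * t + t + 1))"
        proof (rule mult_left_mono)
          show "card P1 + card P2 \<le> 4 * t + g + 1 + (g * t + t + 1)" using P1 P2 gr cR(2) by linarith
        qed simp
        ultimately have "2 * (card (L - Z) * (g * r' + (3 * t + 1))) + (4 * t + g) * (card P1 + card P2)
          \<le> 2 * ((t + 1 + g) * (g * t + (3 * t + 1))) + (4 * t + g) * (4 * t + g + 1 + (g * t + t + 1))"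
          by linarith
        also have "\<dots> \<le> g * (40 * t\<^sup>2 + 58 * t + 22)"
        proof -
          have "g * g \<le> g * (2 * t)" using gle by simp
          then have gg: "g * g \<le> 2 * (g * t)" by simp
          have "g * g * t \<le> g * (2 * t) * t" using gle by (intro mult_right_mono) auto
          then have ggt: "g * g * t \<le> 2 * (g * t\<^sup>2)" by (simp add: power2_eq_square)
          have gt: "2 * t \<le> g * t" "2 * t\<^sup>2 \<le> g * t\<^sup>2" using g2 by auto
          have "2 * ((t + 1 + g) * (g * t + (3 * t + 1))) + (4 * t + g) * (4 * t + g + 1 + (g * t + t + 1))
            = 6 * (g * t\<^sup>2) + 26 * t\<^sup>2 + 16 * t + 2 + 3 * (g * g * t) + 17 * (g * t) + 4 * g + g * g"
            by (simp add: algebra_simps power2_eq_square)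
          also have "\<dots> \<le> 40 * (g * t\<^sup>2) + 58 * (g * t) + 22 * g" using gg ggt gt g2 by linarith
          finally show ?thesis by (simp add: algebra_simps)
        qed
        finally have fin: "int (2 * (card (L - Z) * (g * r' + (3 * t + 1))) + (4 * t + g) * (card P1 + card P2))
          \<le> int (g * (40 * t\<^sup>2 + 58 * t + 22))" by (simp only: of_nat_le_iff)
        have eq: "int (6 * t) - int (card Z) = int (4 * t + g)" using kg by simp
        show ?thesis using fin unfolding eq by (simp add: algebra_simps)
      qed
      show False
        by (rule degree_sum_contradiction[OF _ kg _ w]) (use bound g2 in linarith)+
    qed
    then show ?thesis ..
  qed
qed

end

section \<open>One edge among the vertices off the 2t-clique\<close>

context dense_degrees
begin

text \<open>Two vertices \<open>y1\<close>, \<open>y2\<close> of \<open>R\<close> have degree above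
  \<open>2 * t\<close>, hence neighbours outside \<open>L\<close>. If they cannot be made adjacent,
  take such a neighbour \<open>x'\<close> of \<open>y1\<close>. If \<open>x'\<close> is adjacent to
  all of \<open>L\<close>, the edge \<open>{y1, x'}\<close> serves once \<open>x'\<close> is taken
  into \<open>W\<close>, which is why \<open>W\<close> may differ from \<open>R\<close>. If not,
  \<open>Z\<close> is a proper subset of \<open>L\<close> and the count gives a
  contradiction.\<close>

lemma exists_edge_in_R:
  assumes p: "card L = 2 * t"
    and r1: "realizes V d E1" "pairs L \<subseteq> E1" "cross L R \<subseteq> E1"
    and R: "R \<subseteq> V - L" "card R = t + 2" "\<And>a b. b \<in> R \<Longrightarrow> a \<in> V - L - R \<Longrightarrow> d a \<le> d b"
  obtains E W c e where "realizes V d E" "pairs L \<subseteq> E" "cross L W \<subseteq> E" "W \<subseteq> V - L" "card W = t + 2"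
    "c \<in> W" "e \<in> W" "{c, e} \<in> E"
proof -
  note goal = that
  have fR: "finite R" using R(1) finite_V finite_subset by (metis finite_Diff)
  \<comment> \<open>The vertex of large degree may lie outside \<open>R\<close>; then every vertex
    of \<open>R\<close> has at least its degree.\<close>
  have ex: "\<exists>y\<in>R - {w}. 2 * t + 1 \<le> d y" if "w \<in> V - L" for w
  proof -
    obtain y where y: "y \<in> V - L" "y \<noteq> w" "2 * t + 1 \<le> d y"
      using large_degree_outside[OF L_sub p \<open>w \<in> V - L\<close>] by blast
    show ?thesis
    proof (cases "y \<in> R")
      case True then show ?thesis using y by blast
    next
      case False
      have "1 \<le> card R - 1" using R(2) by simp
      also have "\<dots> \<le> card (R - {w})" using fR by (simp add: card_Diff_singleton_if)
      finally have "R - {w} \<noteq> {}" by (metis card.empty not_one_le_zero)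
      then obtain v where "v \<in> R - {w}" by blast
      then show ?thesis using R(3)[of v y] y False by (metis DiffD1 DiffI order_trans)
    qed
  qed
  have "R \<noteq> {}" using R(2) by auto
  then obtain y0 where "y0 \<in> R" by blast
  then obtain y1 where y1: "y1 \<in> R" "2 * t + 1 \<le> d y1" using ex[of y0] R(1) by blast
  then obtain y2 where y2: "y2 \<in> R" "y2 \<noteq> y1" "2 * t + 1 \<le> d y2" using ex[of y1] R(1) by blast
  define H where "H = (pairs L \<union> cross L R) \<union> {{y1, y2}}"
  define U where "U = L \<union> R"
  have LR: "L \<inter> R = {}" using R(1) by blast
  have U: "card U = 3 * t + 2" "U \<subseteq> V" "L \<subseteq> U" "R \<subseteq> U" "finite U"
    using R p L_sub finite_L fR LR by (auto simp: U_def card_Un_disjoint)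
  have K: "pairs L \<union> cross L R \<subseteq> E1" "pairs L \<union> cross L R \<subseteq> H" using r1 by (auto simp: H_def)
  obtain E where r: "realizes V d E" and KE: "pairs L \<union> cross L R \<subseteq> E"
    and st: "\<And>e. e \<in> H - E \<Longrightarrow> stuck V d H E e"
    using realizes_maximal[OF r1(1) K] by auto
  have LE: "pairs L \<subseteq> E" "cross L R \<subseteq> E" using KE by auto
  show thesis
  proof (cases "{y1, y2} \<in> E")
    case True
    then show ?thesis using goal[OF r LE R(1,2) y1(1) y2(1)] by blast
  next
    case False
    have sw: thesis if y: "y \<in> R" "w \<in> neighbors E y" "w \<notin> L" "L \<subseteq> neighbors E w" for y w
    proof -
      have w: "w \<in> V - L" "{y, w} \<in> E"
        using y realizesD(7)[OF r, of y] in_neighbors_iff[of w E y] by (blast, simp add: insert_commute)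
      have yw: "y \<noteq> w" using y(2) realizesD(7)[OF r, of y] by blast
      have "\<exists>W. W \<subseteq> insert w R \<and> card W = t + 2 \<and> y \<in> W \<and> w \<in> W"
      proof (cases "w \<in> R")
        case True then show ?thesis using y R(2) by (intro exI[of _ R]) auto
      next
        case False
        have "1 \<le> card (R - {y})" using R(2) fR y(1) by simp
        then have "R - {y} \<noteq> {}" by (metis card.empty not_one_le_zero)
        then obtain v where v: "v \<in> R" "v \<noteq> y" by blast
        have "card (insert w (R - {v})) = Suc (card (R - {v}))" using False fR by simp
        also have "\<dots> = card R" by (rule card_Suc_Diff1[OF fR v(1)])
        finally show ?thesis using v y R(2) by (intro exI[of _ "insert w (R - {v})"]) auto
      qed
      then obtain W where W: "W \<subseteq> insert w R" "card W = t + 2" "y \<in> W" "w \<in> W" by blast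
      have "cross L W \<subseteq> E"
      proof
        fix e assume "e \<in> cross L W"
        then obtain a b where e: "e = {a, b}" "a \<in> L" "b \<in> W" unfolding cross_iff by blast
        show "e \<in> E"
        proof (cases "b = w")
          case True then show ?thesis using y(4) e by (auto simp: in_neighbors_iff)
        next
          case False
          then have "b \<in> R" using e(3) W(1) by blast
          then have "e \<in> cross L R" using crossI[OF e(2)] e(1) by simp
          then show ?thesis using LE by blast
        qed
      qed
      moreover have "W \<subseteq> V - L" using W(1) w(1) R(1) by blast
      ultimately show ?thesis using goal[OF r LE(1) _ _ W(2,3,4) w(2)] by blast
    qed
    have nb: "\<exists>w. {y, w} \<in> E - H \<and> w \<in> V - L \<and> w \<in> neighbors E y" if y: "y = y1 \<or> y = y2" for y
    proof -
      have yR: "y \<in> R" "2 * t + 1 \<le> d y" "y \<notin> L" "y \<in> V" using y y1 y2 R(1) by blast+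
      have "\<not> neighbors E y \<subseteq> L"
      proof
        assume "neighbors E y \<subseteq> L"
        then have "card (neighbors E y) \<le> card L" using finite_L by (intro card_mono)
        then show False using realizesD(5)[OF r yR(4)] yR(2) p by simp
      qed
      then obtain w where w: "w \<in> neighbors E y" "w \<notin> L" by blast
      have e: "{y, w} \<in> E" using w by (simp add: in_neighbors_iff insert_commute)
      moreover have "{y, w} \<notin> cross L R" using w(2) yR(3) by (auto simp: cross_iff doubleton_eq_iff)
      moreover have "{y, w} \<notin> pairs L" using w(2) by simp
      moreover have "{y, w} \<noteq> {y1, y2}" using e False by metis
      ultimately show ?thesis using w realizesD(7)[OF r, of y] by (auto simp: H_def)
    qed
    obtain x' where x': "{y1, x'} \<in> E - H" "x' \<in> V - L" "x' \<in> neighbors E y1" using nb[of y1] by blast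
    obtain y' where y': "{y2, y'} \<in> E - H" "y' \<in> V - L" using nb[of y2] by blast
    show ?thesis
    proof (cases "L \<subseteq> neighbors E x'")
      case True then show ?thesis using sw[OF y1(1) x'(3)] x'(2) by blast
    next
      case nsub: False
      have stxy: "stuck V d H E {y1, y2}" using st False by (simp add: H_def)
      have Hout: "{b, q} \<notin> H" if "b \<in> L" "q \<in> V - U" for b q
        using pair_not_in_cross_pairs(1)[of q U L R L b] U(3,4) that y1(1) y2(1)
        by (auto simp: H_def doubleton_eq_iff)
      have XE: "{e \<in> E \<inter> H. e \<subseteq> V - L} \<subseteq> {}"
        using False by (auto simp: H_def pairs_def cross_iff card_2_iff)
      obtain Z where Z: "Z \<subseteq> L" "Z \<subseteq> neighbors E x'"
        and bound: "int (\<Sum>v\<in>V. d v) \<le> int (card Z) * (int (card Z) - 1)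
        + 2 * int (card Z) * (int (card V) - int (card Z))
        + 2 * int (card (L - Z)) * (int (6 * t) + int (card U))
        + 2 * (int (6 * t) - int (card Z)) * (int (6 * t) + 1 - int (card Z)) + 2 * int (card ({} :: 'a set set))"
        by (rule stuck_degree_sum_bound[OF r stxy False y2(2)[symmetric] x'(1,2) y'
              subset_refl U(3,2) degree_small Hout _ _ XE finite.emptyI]) auto
      have "card Z < card L" using Z nsub finite_L by (intro psubset_card_mono) auto
      moreover have "card (L - Z) = card L - card Z"
        by (rule card_Diff_subset[OF finite_subset[OF Z(1) finite_L] Z(1)])
      ultimately have False
        by (intro small_switch_contradiction[OF bound _ U(1), of "2 * t - card Z"]) (use p in auto)
      then show ?thesis ..
    qed
  qed
qed

text \<open>The single vertex \<open>l\<close> of \<open>L - B\<close> counts among the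
  \<open>t + 2\<close> vertices joined to \<open>B\<close>, and the edge is sought at
  \<open>l\<close>. If \<open>{l, y1}\<close> is stuck, \<open>l\<close> still has a neighbour
  \<open>x'\<close> outside \<open>U\<close>, as its degree exceeds \<open>6 * t\<close>. Either
  \<open>x'\<close> is adjacent to all of \<open>B\<close> and takes the place of \<open>y1\<close>,
  or \<open>Z\<close> is a proper subset of \<open>B\<close>.\<close>

lemma exists_edge_at_extra:
  assumes p: "card L = 2 * t + 1"
    and B: "B \<subseteq> L" "card B = 2 * t" "\<And>a b. b \<in> B \<Longrightarrow> a \<in> L - B \<Longrightarrow> d a \<le> d b"
    and r1: "realizes V d E1" "pairs L \<subseteq> E1" "cross B R \<subseteq> E1"
    and R: "R \<subseteq> V - L" "card R = t + 1" "\<And>a b. b \<in> R \<Longrightarrow> a \<in> V - L - R \<Longrightarrow> d a \<le> d b"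
  obtains E W c e where "realizes V d E" "pairs B \<subseteq> E" "cross B W \<subseteq> E" "W \<subseteq> V - B" "card W = t + 2"
    "c \<in> W" "e \<in> W" "{c, e} \<in> E"
proof -
  note goal = that
  have fR: "finite R" using R(1) finite_V finite_subset by (metis finite_Diff)
  have fB: "finite B" using B(1) finite_L finite_subset by blast
  have "card (L - B) = 1" using card_Diff_subset[OF fB B(1)] B(2) p by simp
  then obtain l where l: "L - B = {l}" by (auto simp: card_1_singleton_iff)
  then have lL: "l \<in> L" "l \<notin> B" "l \<in> V" "L = insert l B" using L_sub B(1) by blast+
  obtain y where y: "y \<in> V - B" "y \<noteq> l" "2 * t + 1 \<le> d y"
    using large_degree_outside[of B l] B(1,2) lL L_sub by blast
  have "\<exists>y1\<in>R. 2 * t + 1 \<le> d y1"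
  proof (cases "y \<in> R")
    case True then show ?thesis using y by blast
  next
    case False
    have "R \<noteq> {}" using R(2) by auto
    then obtain v where "v \<in> R" by blast
    moreover have "y \<in> V - L - R" using y lL(4) False by blast
    ultimately show ?thesis using R(3)[of v y] y(3) by (meson order_trans)
  qed
  then obtain y1 where y1: "y1 \<in> R" "2 * t + 1 \<le> d y1" by blast
  have y1V: "y1 \<in> V" "y1 \<notin> L" using y1 R(1) by blast+
  define H where "H = (pairs L \<union> cross B R) \<union> {{l, y1}}"
  define U where "U = L \<union> R"
  have LR: "L \<inter> R = {}" using R(1) by blast
  have U: "card U = 3 * t + 2" "U \<subseteq> V" "L \<subseteq> U" "R \<subseteq> U" "B \<subseteq> U" "finite U"
    using R p L_sub B(1) finite_L fR LR by (auto simp: U_def card_Un_disjoint)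
  have K: "pairs L \<union> cross B R \<subseteq> E1" "pairs L \<union> cross B R \<subseteq> H" using r1 by (auto simp: H_def)
  obtain E where r: "realizes V d E" and KE: "pairs L \<union> cross B R \<subseteq> E"
    and st: "\<And>e. e \<in> H - E \<Longrightarrow> stuck V d H E e"
    using realizes_maximal[OF r1(1) K] by auto
  have LE: "pairs L \<subseteq> E" "cross B R \<subseteq> E" using KE by auto
  have BE: "pairs B \<subseteq> E" using LE(1) B(1) by (auto simp: pairs_def)
  have lB: "{a, l} \<in> E" if "a \<in> B" for a
  proof -
    have "{a, l} \<in> pairs L" using that lL B(1) by auto
    then show ?thesis using LE(1) by blast
  qed
  show thesis
  proof (cases "{l, y1} \<in> E")
    case True
    have "cross B (insert l R) \<subseteq> E" using LE(2) lB unfolding cross_def by blast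
    moreover have "insert l R \<subseteq> V - B" using lL R(1) B(1) by blast
    moreover have "card (insert l R) = t + 2" using R fR lL(1) LR by (subst card_insert_disjoint) auto
    ultimately show ?thesis using goal[OF r BE, of "insert l R" l y1] y1 True by blast
  next
    case False
    have "\<not> neighbors E l \<subseteq> U"
    proof
      assume "neighbors E l \<subseteq> U"
      then have "card (neighbors E l) \<le> card U" using U(6) by (intro card_mono)
      then show False using realizesD(5)[OF r lL(3)] lL(1) U(1) t by (auto simp: L_def)
    qed
    then obtain x' where x': "x' \<in> neighbors E l" "x' \<notin> U" by blast
    have x'V: "x' \<in> V - L" "x' \<in> V" "x' \<notin> R" using x' U(3,4) realizesD(7)[OF r, of l] by blast+
    have lx: "{l, x'} \<in> E" using x'(1) by (simp add: in_neighbors_iff insert_commute)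
    have Hout: "{b, q} \<notin> H" if "b \<in> L" "q \<in> V - U" for b q
      using pair_not_in_cross_pairs(1)[of q U L R B b] U(3,4,5) that y1(1) lL(1)
      by (auto simp: H_def doubleton_eq_iff)
    have lx': "{l, x'} \<in> E - H" using lx Hout[OF lL(1)] x'(2) x'V by blast
    show ?thesis
    proof (cases "B \<subseteq> neighbors E x'")
      case True
      define W where "W = insert l (insert x' (R - {y1}))"
      have "card (R - {y1}) = t" using y1(1) R(2) fR by simp
      then have "card W = t + 2" unfolding W_def using fR x'V lL(1) LR by (auto simp: card_insert_if)
      moreover have "cross B W \<subseteq> E"
      proof
        fix e assume "e \<in> cross B W"
        then obtain a b where e: "e = {a, b}" "a \<in> B" "b \<in> W" unfolding cross_iff by blast
        consider "b = l" | "b = x'" | "b \<in> R" using e(3) by (auto simp: W_def)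
        then show "e \<in> E"
        proof cases
          case 1 then show ?thesis using lB e by simp
        next
          case 2 then show ?thesis using True e by (auto simp: in_neighbors_iff)
        next
          case 3
          then have "e \<in> cross B R" using crossI[OF e(2)] e(1) by simp
          then show ?thesis using LE(2) by blast
        qed
      qed
      moreover have "W \<subseteq> V - B" unfolding W_def using lL x'V R(1) B(1) by blast
      ultimately show ?thesis using goal[OF r BE, of W l x'] lx by (auto simp: W_def)
    next
      case nsub: False
      have "\<not> neighbors E y1 \<subseteq> B"
      proof
        assume "neighbors E y1 \<subseteq> B"
        then have "card (neighbors E y1) \<le> card B" using fB by (intro card_mono)
        then show False using realizesD(5)[OF r y1V(1)] y1(2) B(2) by simp
      qed
      then obtain y' where y': "y' \<in> neighbors E y1" "y' \<notin> B" by blast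
      have e: "{y1, y'} \<in> E" using y' by (simp add: in_neighbors_iff insert_commute)
      have "y' \<noteq> l" using e False by (metis insert_commute)
      then have y'L: "y' \<in> V - L" using y' lL(4) realizesD(7)[OF r, of y1] by blast
      have "{y1, y'} \<notin> cross B R" using y'(2) y1V(2) B(1) by (auto simp: cross_iff doubleton_eq_iff)
      moreover have "{y1, y'} \<notin> pairs L" using y1V(2) by simp
      moreover have "{y1, y'} \<noteq> {l, y1}" using e False by metis
      ultimately have yH: "{y1, y'} \<in> E - H" using e by (simp add: H_def)
      have stxy: "stuck V d H E {l, y1}" using st False by (simp add: H_def)
      have ne: "l \<noteq> y1" using lL(1) y1V(2) by blast
      have XE: "{e \<in> E \<inter> H. e \<subseteq> V - L} \<subseteq> {}"
        using lL(1) B(1) by (auto simp: H_def pairs_def cross_iff card_2_iff)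
      have ms: "B = L \<or> (\<exists>b\<in>B. b \<notin> neighbors E x' \<or> b \<notin> neighbors E y')" using nsub by blast
      obtain Z where Z: "Z \<subseteq> B" "Z \<subseteq> neighbors E x'"
        and bound: "int (\<Sum>v\<in>V. d v) \<le> int (card Z) * (int (card Z) - 1)
        + 2 * int (card Z) * (int (card V) - int (card Z))
        + 2 * int (card (L - Z)) * (int (6 * t) + int (card U))
        + 2 * (int (6 * t) - int (card Z)) * (int (6 * t) + 1 - int (card Z)) + 2 * int (card ({} :: 'a set set))"
        by (rule stuck_degree_sum_bound[OF r stxy False ne lx' x'V(1) yH y'L
              B(1) U(3,2) degree_small Hout B(3) ms XE finite.emptyI]) auto
      have "card Z < card B" using Z nsub fB by (intro psubset_card_mono) auto
      moreover have "card (L - Z) = card L - card Z"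
        by (rule card_Diff_subset[OF finite_subset[OF Z(1) fB] order_trans[OF Z(1) B(1)]])
      ultimately have False
        by (intro small_switch_contradiction[OF bound _ U(1), of "2 * t - card Z"]) (use p B(2) in auto)
      then show ?thesis ..
    qed
  qed
qed

text \<open>The size of \<open>L\<close> decides where the extra edge comes from: off
  \<open>L\<close> or at the surplus vertex for sizes \<open>2 * t\<close> and
  \<open>2 * t + 1\<close>; from \<open>2 * t + 2\<close> on, the clique on \<open>L\<close> already
  contains it.\<close>

lemma large_L_realization:
  assumes p: "2 * t \<le> card L" "card L \<le> 3 * t + 1" and r0: "realizes V d E0" "pairs L \<subseteq> E0"
  obtains E A W c e where "realizes V d E" "A \<subseteq> V" "card A = 2 * t" "W \<subseteq> V - A" "card W = t + 2"
    "pairs A \<subseteq> E" "cross A W \<subseteq> E" "c \<in> W" "e \<in> W" "{c, e} \<in> E"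
proof -
  note goal = that
  obtain B where B: "B \<subseteq> L" "card B = 2 * t" "\<And>a b. b \<in> B \<Longrightarrow> a \<in> L - B \<Longrightarrow> d a \<le> d b"
    using top_subset[OF finite_L p(1), of d] by blast
  have BV: "B \<subseteq> V" using B(1) L_sub by blast
  have "t\<^sup>2 \<ge> t" using t self_le_power[of t 2] by simp
  then have "3 * t + 2 \<le> card V" using card_V by linarith
  then have "3 * t + 2 - card L \<le> card (V - L)"
    using card_Diff_subset[OF finite_L L_sub] by simp
  then obtain R where R: "R \<subseteq> V - L" "card R = 3 * t + 2 - card L"
    "\<And>a b. b \<in> R \<Longrightarrow> a \<in> V - L - R \<Longrightarrow> d a \<le> d b"
    using top_subset[of "V - L" "3 * t + 2 - card L" d] finite_V by blast
  have R2: "card L + card R = 3 * t + 2" using R(2) p by simp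
  obtain E where E: "realizes V d E" "pairs L \<subseteq> E" "cross B R \<subseteq> E"
    using complete_top_outside[OF r0 B R(1) R2 R(3)] by blast
  consider "card L = 2 * t" | "card L = 2 * t + 1" | "2 * t + 2 \<le> card L" using p by linarith
  then show thesis
  proof cases
    case 1
    have BL: "B = L" using card_subset_eq[OF finite_L B(1)] B(2) 1 by simp
    have cR: "card R = t + 2" using R2 1 by simp
    show ?thesis
    proof (rule exists_edge_in_R[OF 1 E(1,2) E(3)[unfolded BL] R(1) cR R(3)])
      fix E' W c e
      assume a: "realizes V d E'" "pairs L \<subseteq> E'" "cross L W \<subseteq> E'" "W \<subseteq> V - L" "card W = t + 2"
        "c \<in> W" "e \<in> W" "{c, e} \<in> E'"
      show thesis by (rule goal[OF a(1) L_sub 1 a(4,5,2,3,6,7,8)])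
    qed
  next
    case 2
    have cR: "card R = t + 1" using R2 2 by simp
    show ?thesis
    proof (rule exists_edge_at_extra[OF 2 B E R(1) cR R(3)])
      fix E' W c e
      assume a: "realizes V d E'" "pairs B \<subseteq> E'" "cross B W \<subseteq> E'" "W \<subseteq> V - B" "card W = t + 2"
        "c \<in> W" "e \<in> W" "{c, e} \<in> E'"
      show thesis by (rule goal[OF a(1) BV B(2) a(4,5,2,3,6,7,8)])
    qed
  next
    case 3
    have fB: "finite B" using B(1) finite_L finite_subset by blast
    have cLB: "card (L - B) = card L - 2 * t" using card_Diff_subset[OF fB B(1)] B(2) by simp
    then have "2 \<le> card (L - B)" using 3 by simp
    then obtain D where "D \<subseteq> L - B" "card D = 2" by (meson obtain_subset_with_card_n)
    then obtain c e where ce: "c \<in> L - B" "e \<in> L - B" "c \<noteq> e" by (auto simp: card_2_iff)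
    have fR: "finite R" using R(1) finite_V finite_subset by (metis finite_Diff)
    have "card ((L - B) \<union> R) = card (L - B) + card R"
      using finite_L fR R(1) by (intro card_Un_disjoint) auto
    then have "card ((L - B) \<union> R) = t + 2" using cLB R2 3 by simp
    moreover have "pairs B \<subseteq> E" using E(2) B(1) by (auto simp: pairs_def)
    moreover have "cross B ((L - B) \<union> R) \<subseteq> E"
    proof
      fix f assume "f \<in> cross B ((L - B) \<union> R)"
      then obtain a b where f: "f = {a, b}" "a \<in> B" "b \<in> (L - B) \<union> R" unfolding cross_iff by blast
      show "f \<in> E"
      proof (cases "b \<in> R")
        case True then show ?thesis using crossI[OF f(2) True] f(1) E(3) by blast
      next
        case False
        then have "{a, b} \<in> pairs L" using f B(1) by auto
        then show ?thesis using f(1) E(2) by blast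
      qed
    qed
    moreover have "{c, e} \<in> pairs L" using ce by simp
    then have "{c, e} \<in> E" using E(2) by blast
    moreover have "(L - B) \<union> R \<subseteq> V - B" using L_sub R(1) B(1) by blast
    ultimately show ?thesis using goal[OF E(1) BV B(2), of "(L - B) \<union> R" c e] ce by blast
  qed
qed

end

section \<open>Three-colourings of 2-trees\<close>

text \<open>Up to renaming colours this is the unique proper 3-colouring of a 2-tree. Any two of its
  classes span a tree, and the last clause records the edge count of that tree.\<close>

definition two_tree_colouring :: "'a set \<Rightarrow> 'a set set \<Rightarrow> ('a \<Rightarrow> nat) \<Rightarrow> bool" where
  "two_tree_colouring W F c \<longleftrightarrow> (\<forall>v\<in>W. c v < 3) \<and> (\<forall>x y. {x, y} \<in> F \<longrightarrow> c x \<noteq> c y)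
    \<and> (\<forall>v\<in>W. \<forall>i<3. c v \<noteq> i \<longrightarrow> (\<exists>u\<in>W. {u, v} \<in> F \<and> c u = i))
    \<and> (\<forall>i<3. \<forall>j<3. i \<noteq> j \<longrightarrow>
        card {e \<in> F. c ` e = {i, j}} + 1 = card {v \<in> W. c v = i} + card {v \<in> W. c v = j})"

lemma two_tree_simple: "two_tree W F \<Longrightarrow> simple_graph W F"
  by (cases rule: two_tree.cases) (auto simp: simple_graph_def complete_graph_def)

lemma triangle_colouring:
  assumes "complete_graph W F" "card W = 3"
  shows "\<exists>c. two_tree_colouring W F c"
proof -
  have fW: "finite W" and F: "F = pairs W" using assms(1) by (auto simp: complete_graph_def pairs_def)
  obtain c where c: "bij_betw c W {0..<3::nat}"
    using ex_bij_betw_finite_nat[OF fW] assms(2) by auto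
  have inj: "inj_on c W" and im: "c ` W = {0..<3}" using c by (auto simp: bij_betw_def)
  have rep: "\<exists>u\<in>W. c u = i \<and> {v \<in> W. c v = i} = {u}" if "i < 3" for i
  proof -
    have "i \<in> c ` W" using im that by simp
    then obtain u where u: "u \<in> W" "c u = i" by blast
    then have "{v \<in> W. c v = i} = {u}" using inj_onD[OF inj] by blast
    then show ?thesis using u by blast
  qed
  have "two_tree_colouring W F c" unfolding two_tree_colouring_def
  proof (intro conjI allI ballI impI)
    show "c v < 3" if "v \<in> W" for v using im that by auto
    show "c x \<noteq> c y" if "{x, y} \<in> F" for x y
      using that inj unfolding F pair_in_pairs by (auto dest: inj_onD)
    show "\<exists>u\<in>W. {u, v} \<in> F \<and> c u = i" if vi: "v \<in> W" "i < 3" "c v \<noteq> i" for v i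
    proof -
      obtain u where "u \<in> W" "c u = i" using rep[OF vi(2)] by blast
      then show ?thesis using vi unfolding F pair_in_pairs by auto
    qed
    fix i j :: nat assume ij: "i < 3" "j < 3" "i \<noteq> j"
    obtain u where u: "u \<in> W" "c u = i" "{v \<in> W. c v = i} = {u}" using rep[OF ij(1)] by blast
    obtain w where w: "w \<in> W" "c w = j" "{v \<in> W. c v = j} = {w}" using rep[OF ij(2)] by blast
    have "{e \<in> F. c ` e = {i, j}} = {{u, w}}"
    proof
      show "{{u, w}} \<subseteq> {e \<in> F. c ` e = {i, j}}" using u w ij unfolding F by auto
      show "{e \<in> F. c ` e = {i, j}} \<subseteq> {{u, w}}"
      proof
        fix e assume "e \<in> {e \<in> F. c ` e = {i, j}}"
        then obtain p q where e: "e = {p, q}" "p \<in> W" "q \<in> W" "{c p, c q} = {i, j}"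
          unfolding F by (auto elim!: pairsE)
        have "{p, q} = {u, w}" using e u w inj by (auto simp: doubleton_eq_iff dest: inj_onD)
        then show "e \<in> {{u, w}}" using e by simp
      qed
    qed
    then show "card {e \<in> F. c ` e = {i, j}} + 1 = card {v \<in> W. c v = i} + card {v \<in> W. c v = j}"
      using u w by simp
  qed
  then show ?thesis by blast
qed

text \<open>The new vertex gets the colour absent from \<open>{a, b}\<close>. For each pair of
  classes that contains this colour, exactly one vertex and one edge are added.\<close>

lemma extend_colouring:
  assumes s: "simple_graph W F" "v \<in> W" and N: "neighbors F v = {a, b}" and ab: "{a, b} \<in> F"
    and c0: "two_tree_colouring (W - {v}) (delete_vertex F v) c"
  shows "\<exists>c'. two_tree_colouring W F c'"
proof -
  let ?W = "W - {v}" and ?F = "delete_vertex F v"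
  have fW: "finite W" using s by (simp add: simple_graph_iff)
  have fF: "finite F" using s(1) fW finite_subset finite_pairs unfolding simple_graph_iff by blast
  have av: "{a, v} \<in> F" "{b, v} \<in> F" using N by (auto simp: in_neighbors_iff[symmetric])
  have ne: "a \<noteq> v" "b \<noteq> v" "a \<noteq> b" and W: "a \<in> ?W" "b \<in> ?W"
    using simple_graph_edgeD[OF s(1) av(1)] simple_graph_edgeD[OF s(1) av(2)] simple_graph_edgeD[OF s(1) ab] by auto
  have F0: "?F = {e \<in> F. v \<notin> e}" by (simp add: delete_vertex_def)
  have FF: "F = insert {a, v} (insert {b, v} ?F)"
  proof
    show "insert {a, v} (insert {b, v} ?F) \<subseteq> F" using av by (auto simp: F0)
    show "F \<subseteq> insert {a, v} (insert {b, v} ?F)"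
    proof
      fix e assume e: "e \<in> F"
      then have "e \<in> pairs W" using s(1) by (auto simp: simple_graph_iff)
      then obtain p q where pq: "e = {p, q}" by (auto elim: pairsE)
      show "e \<in> insert {a, v} (insert {b, v} ?F)"
      proof (cases "v \<in> e")
        case True
        then obtain u where u: "e = {u, v}" using pq by auto
        then have "u \<in> {a, b}" using e N by (auto simp: in_neighbors_iff[symmetric])
        then show ?thesis using u by auto
      qed (use e F0 in auto)
    qed
  qed
  have FD: "e = {a, v} \<or> e = {b, v} \<or> e \<in> ?F" if "e \<in> F" for e
    using that by (subst (asm) FF) blast
  have FF0: "?F \<subseteq> F" by (auto simp: F0)
  have abF: "{a, b} \<in> ?F" using ab ne by (simp add: F0)
  have col: "\<And>u. u \<in> ?W \<Longrightarrow> c u < 3" and proper: "\<And>x y. {x, y} \<in> ?F \<Longrightarrow> c x \<noteq> c y"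
    and nb: "\<And>u i. u \<in> ?W \<Longrightarrow> i < 3 \<Longrightarrow> c u \<noteq> i \<Longrightarrow> \<exists>w\<in>?W. {w, u} \<in> ?F \<and> c w = i"
    and cnt: "\<And>i j. i < 3 \<Longrightarrow> j < 3 \<Longrightarrow> i \<noteq> j \<Longrightarrow>
      card {e \<in> ?F. c ` e = {i, j}} + 1 = card {u \<in> ?W. c u = i} + card {u \<in> ?W. c u = j}"
    using c0 unfolding two_tree_colouring_def by blast+
  \<comment> \<open>The colours 0, 1, 2 add up to 3, so \<open>k\<close> is the third one.\<close>
  define k where "k = 3 - c a - c b"
  have k: "k < 3" "k \<noteq> c a" "k \<noteq> c b" "c a < 3" "c b < 3" "c a \<noteq> c b"
    using proper[OF abF] col[OF W(1)] col[OF W(2)] unfolding k_def by arith+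
  define c' where "c' = c(v := k)"
  have c'v: "c' v = k" and c'o: "u \<noteq> v \<Longrightarrow> c' u = c u" for u by (auto simp: c'_def)
  have c'ab: "c' a = c a" "c' b = c b" using c'o ne by auto
  have im: "c' ` e = c ` e" if "e \<in> ?F" for e
  proof (rule image_cong)
    fix x assume "x \<in> e"
    then have "x \<noteq> v" using that by (auto simp: F0)
    then show "c' x = c x" by (rule c'o)
  qed simp
  have "two_tree_colouring W F c'" unfolding two_tree_colouring_def
  proof (intro conjI allI ballI impI)
    show "c' u < 3" if "u \<in> W" for u using col[of u] that k c'v c'o by (cases "u = v") auto
    show "c' x \<noteq> c' y" if xy: "{x, y} \<in> F" for x y
    proof -
      consider "{x, y} = {a, v}" | "{x, y} = {b, v}" | "{x, y} \<in> ?F" using FD[OF xy] by blast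
      then show ?thesis
      proof cases
        case 3
        then have "x \<noteq> v" "y \<noteq> v" by (auto simp: F0)
        then show ?thesis using proper[OF 3] c'o by simp
      qed (use k c'v c'ab in \<open>auto simp: doubleton_eq_iff\<close>)
    qed
    show "\<exists>w\<in>W. {w, u} \<in> F \<and> c' w = i" if u: "u \<in> W" "i < 3" "c' u \<noteq> i" for u i
    proof (cases "u = v")
      case True
      then have "i = c a \<or> i = c b" using u k c'v by auto
      then show ?thesis using True av W c'ab by blast
    next
      case False
      then obtain w where "w \<in> ?W" "{w, u} \<in> ?F" "c w = i" using nb[of u i] u c'o by auto
      then show ?thesis using c'o[of w] FF0 by blast
    qed
    fix i j :: nat assume ij: "i < 3" "j < 3" "i \<noteq> j"
    let ?A = "{e \<in> ?F. c ` e = {i, j}}"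
    have fA: "finite ?A" using fF by (simp add: F0)
    have nin: "{a, v} \<notin> ?A" "{b, v} \<notin> ?A" "{a, v} \<noteq> {b, v}" using ne by (auto simp: F0 doubleton_eq_iff)
    have ia: "c' ` {a, v} = {c a, k}" "c' ` {b, v} = {c b, k}" using c'v c'ab by auto
    have "{e \<in> F. c' ` e = {i, j}} = (if {c a, k} = {i, j} then {{a, v}} else {})
      \<union> (if {c b, k} = {i, j} then {{b, v}} else {}) \<union> ?A"
    proof -
      have "{e \<in> F. c' ` e = {i, j}} = {e \<in> {{a, v}}. c' ` e = {i, j}} \<union> {e \<in> {{b, v}}. c' ` e = {i, j}}
        \<union> {e \<in> ?F. c' ` e = {i, j}}" using FD FF0 av by blast
      also have "{e \<in> {{a, v}}. c' ` e = {i, j}} = (if {c a, k} = {i, j} then {{a, v}} else {})"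
        using ia(1) by auto
      also have "{e \<in> {{b, v}}. c' ` e = {i, j}} = (if {c b, k} = {i, j} then {{b, v}} else {})"
        using ia(2) by auto
      also have "{e \<in> ?F. c' ` e = {i, j}} = ?A" using im by auto
      finally show ?thesis .
    qed
    then have 1: "card {e \<in> F. c' ` e = {i, j}}
      = of_bool ({c a, k} = {i, j}) + of_bool ({c b, k} = {i, j}) + card ?A"
      using nin fA by (auto simp: card_insert_if)
    have cls: "card {u \<in> W. c' u = l} = card {u \<in> ?W. c u = l} + of_bool (l = k)" for l
    proof -
      have "{u \<in> W. c' u = l} = (if l = k then insert v {u \<in> ?W. c u = l} else {u \<in> ?W. c u = l})"
        using s(2) c'v c'o by (auto simp: c'_def split: if_splits)
      then show ?thesis using fW by simp
    qed
    have "of_bool ({c a, k} = {i, j}) + of_bool ({c b, k} = {i, j}) = of_bool (i = k) + (of_bool (j = k) :: nat)"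
      using k ij by (auto simp: doubleton_eq_iff)
    then show "card {e \<in> F. c' ` e = {i, j}} + 1 = card {u \<in> W. c' u = i} + card {u \<in> W. c' u = j}"
      using 1 cls[of i] cls[of j] cnt[OF ij] by linarith
  qed
  then show ?thesis by blast
qed

lemma two_tree_has_colouring: "two_tree W F \<Longrightarrow> \<exists>c. two_tree_colouring W F c"
proof (induction rule: two_tree.induct)
  case (K3 V E)
  then show ?case by (rule triangle_colouring)
next
  case (extend V E v a b)
  then obtain c where "two_tree_colouring (V - {v}) (delete_vertex E v) c" by blast
  then show ?case by (rule extend_colouring[OF extend.hyps(1,2,4,5)])
qed

definition nbrs_in :: "'a set set \<Rightarrow> 'a set \<Rightarrow> 'a set \<Rightarrow> 'a set" where
  "nbrs_in F T S = {u \<in> T. \<exists>s\<in>S. {s, u} \<in> F}"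

text \<open>The classes are sorted by size. Deleting the smallest one leaves only the edges between
  \<open>C\<close> and \<open>T\<close>, whose number is that of a tree.\<close>

lemma two_tree_classes:
  assumes tt: "two_tree W F"
  obtains X C T where "W = X \<union> C \<union> T" "X \<inter> C = {}" "X \<inter> T = {}" "C \<inter> T = {}"
    "\<And>x y. {x, y} \<in> F \<Longrightarrow> x \<in> C \<Longrightarrow> y \<notin> C" "\<And>x y. {x, y} \<in> F \<Longrightarrow> x \<in> T \<Longrightarrow> y \<notin> T"
    "card X \<le> card C" "card C \<le> card T"
    "(\<Sum>v\<in>C. card (nbrs_in F T {v})) + 1 = card C + card T" "\<And>v. v \<in> C \<Longrightarrow> 1 \<le> card (nbrs_in F T {v})"
proof -
  obtain c where c: "two_tree_colouring W F c" using two_tree_has_colouring[OF tt] by blast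
  have s: "simple_graph W F" using two_tree_simple[OF tt] .
  have fW: "finite W" using s by (simp add: simple_graph_iff)
  have col: "\<And>u. u \<in> W \<Longrightarrow> c u < 3" and proper: "\<And>x y. {x, y} \<in> F \<Longrightarrow> c x \<noteq> c y"
    and nb: "\<And>u i. u \<in> W \<Longrightarrow> i < 3 \<Longrightarrow> c u \<noteq> i \<Longrightarrow> \<exists>w\<in>W. {w, u} \<in> F \<and> c w = i"
    and cnt: "\<And>i j. i < 3 \<Longrightarrow> j < 3 \<Longrightarrow> i \<noteq> j \<Longrightarrow>
      card {e \<in> F. c ` e = {i, j}} + 1 = card {u \<in> W. c u = i} + card {u \<in> W. c u = j}"
    using c unfolding two_tree_colouring_def by blast+
  let ?C = "\<lambda>i. {u \<in> W. c u = i}"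
  have "\<exists>i j k. {i, j, k} = {0, 1, 2::nat} \<and> i \<noteq> j \<and> i \<noteq> k \<and> j \<noteq> k \<and> card (?C i) \<le> card (?C j) \<and> card (?C j) \<le> card (?C k)"
  proof -
    define f where "f i = card (?C i)" for i
    have "\<exists>i j k. {i, j, k} = {0, 1, 2::nat} \<and> i \<noteq> j \<and> i \<noteq> k \<and> j \<noteq> k \<and> f i \<le> f j \<and> f j \<le> f k"
    proof -
      consider "f 0 \<le> f 1 \<and> f 1 \<le> f 2" | "f 0 \<le> f 2 \<and> f 2 \<le> f 1" | "f 1 \<le> f 0 \<and> f 0 \<le> f 2"
        | "f 1 \<le> f 2 \<and> f 2 \<le> f 0" | "f 2 \<le> f 0 \<and> f 0 \<le> f 1" | "f 2 \<le> f 1 \<and> f 1 \<le> f 0" by linarith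
      then show ?thesis
      proof cases
        case 1 then show ?thesis by (intro exI[of _ 0] exI[of _ 1] exI[of _ 2]) auto
      next
        case 2 then show ?thesis by (intro exI[of _ 0] exI[of _ 2] exI[of _ 1]) auto
      next
        case 3 then show ?thesis by (intro exI[of _ 1] exI[of _ 0] exI[of _ 2]) auto
      next
        case 4 then show ?thesis by (intro exI[of _ 1] exI[of _ 2] exI[of _ 0]) auto
      next
        case 5 then show ?thesis by (intro exI[of _ 2] exI[of _ 0] exI[of _ 1]) auto
      next
        case 6 then show ?thesis by (intro exI[of _ 2] exI[of _ 1] exI[of _ 0]) auto
      qed
    qed
    then show ?thesis by (simp add: f_def)
  qed
  then obtain i j k where ijk: "{i, j, k} = {0, 1, 2::nat}" "i \<noteq> j" "i \<noteq> k" "j \<noteq> k"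
    "card (?C i) \<le> card (?C j)" "card (?C j) \<le> card (?C k)" by blast
  have "j \<in> {0, 1, 2}" "k \<in> {0, 1, 2}" unfolding ijk(1)[symmetric] by simp_all
  then have lt: "j < 3" "k < 3" by auto
  have cases: "c u = i \<or> c u = j \<or> c u = k" if "u \<in> W" for u
  proof -
    have "c u = 0 \<or> c u = 1 \<or> c u = 2" using col[OF that] by arith
    then have "c u \<in> {0, 1, 2}" by simp
    then have "c u \<in> {i, j, k}" unfolding ijk(1) .
    then show ?thesis by simp
  qed
  define C where "C = ?C j"
  define T where "T = ?C k"
  have f: "finite C" "finite T" using fW by (auto simp: C_def T_def)
  have nT: "nbrs_in F T {v} = {u \<in> T. {v, u} \<in> F}" for v by (auto simp: nbrs_in_def)
  have sum: "(\<Sum>v\<in>C. card (nbrs_in F T {v})) = card {e \<in> F. c ` e = {j, k}}"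
  proof -
    have "(\<Sum>v\<in>C. card (nbrs_in F T {v})) = card (SIGMA v:C. nbrs_in F T {v})"
      using f by (intro card_SigmaI[symmetric]) (auto simp: nbrs_in_def)
    also have "\<dots> = card {e \<in> F. c ` e = {j, k}}"
    proof (rule bij_betw_same_card[of "\<lambda>(v, u). {v, u}"])
      show "bij_betw (\<lambda>(v, u). {v, u}) (SIGMA v:C. nbrs_in F T {v}) {e \<in> F. c ` e = {j, k}}"
        unfolding bij_betw_def
      proof
        show "inj_on (\<lambda>(v, u). {v, u}) (SIGMA v:C. nbrs_in F T {v})"
          using ijk(4) by (auto simp: inj_on_def nbrs_in_def C_def T_def doubleton_eq_iff)
        show "(\<lambda>(v, u). {v, u}) ` (SIGMA v:C. nbrs_in F T {v}) = {e \<in> F. c ` e = {j, k}}"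
        proof
          show "(\<lambda>(v, u). {v, u}) ` (SIGMA v:C. nbrs_in F T {v}) \<subseteq> {e \<in> F. c ` e = {j, k}}"
            by (auto simp: nbrs_in_def C_def T_def)
          show "{e \<in> F. c ` e = {j, k}} \<subseteq> (\<lambda>(v, u). {v, u}) ` (SIGMA v:C. nbrs_in F T {v})"
          proof
            fix e assume e: "e \<in> {e \<in> F. c ` e = {j, k}}"
            then have "e \<in> pairs W" using s by (auto simp: simple_graph_iff)
            then obtain p q where pq: "e = {p, q}" "p \<in> W" "q \<in> W" by (rule pairsE)
            then have "{c p, c q} = {j, k}" using e by simp
            then consider "c p = j" "c q = k" | "c p = k" "c q = j" by (auto simp: doubleton_eq_iff)
            then obtain v u where vu: "e = {v, u}" "v \<in> C" "u \<in> T"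
            proof cases
              case 1 then show ?thesis using that[of p q] pq by (simp add: C_def T_def)
            next
              case 2 then show ?thesis using that[of q p] pq by (simp add: C_def T_def insert_commute)
            qed
            then have "(v, u) \<in> (SIGMA v:C. nbrs_in F T {v})" using e by (simp add: nT)
            then show "e \<in> (\<lambda>(v, u). {v, u}) ` (SIGMA v:C. nbrs_in F T {v})"
              by (rule rev_image_eqI) (simp add: vu)
          qed
        qed
      qed
    qed
    finally show ?thesis .
  qed
  show thesis
  proof (rule that[of "?C i" C T])
    show "W = ?C i \<union> C \<union> T" using cases by (auto simp: C_def T_def)
    show "?C i \<inter> C = {}" "?C i \<inter> T = {}" "C \<inter> T = {}" using ijk(2-4) by (auto simp: C_def T_def)
    show "\<And>x y. {x, y} \<in> F \<Longrightarrow> x \<in> C \<Longrightarrow> y \<notin> C" using proper by (fastforce simp: C_def)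
    show "\<And>x y. {x, y} \<in> F \<Longrightarrow> x \<in> T \<Longrightarrow> y \<notin> T" using proper by (fastforce simp: T_def)
    show "card (?C i) \<le> card C" "card C \<le> card T" using ijk(5,6) by (auto simp: C_def T_def)
    show "(\<Sum>v\<in>C. card (nbrs_in F T {v})) + 1 = card C + card T"
      using sum cnt[OF lt ijk(4)] by (simp add: C_def T_def)
    fix v assume v: "v \<in> C"
    then obtain u where "u \<in> W" "{u, v} \<in> F" "c u = k" using nb[of v k] lt ijk(4) by (auto simp: C_def)
    then have "u \<in> nbrs_in F T {v}" by (simp add: nbrs_in_def T_def insert_commute)
    moreover have "finite (nbrs_in F T {v})" using f by (simp add: nbrs_in_def)
    ultimately show "1 \<le> card (nbrs_in F T {v})" by (metis One_nat_def Suc_leI card_gt_0_iff empty_iff)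
  qed
qed

section \<open>Splitting a 2-tree and embedding the pieces\<close>

text \<open>The \<open>s\<close> smallest values have at most the overall average; the inequality is
  multiplied out to stay in the natural numbers.\<close>

lemma bottom_subset_average:
  fixes f :: "'a \<Rightarrow> nat"
  assumes "finite C" "s \<le> card C"
  obtains S where "S \<subseteq> C" "card S = s" "sum f S * card C \<le> s * sum f C"
proof -
  obtain B where B: "B \<subseteq> C" "card B = card C - s" "\<And>a b. b \<in> B \<Longrightarrow> a \<in> C - B \<Longrightarrow> f a \<le> f b"
    using top_subset[OF assms(1), of "card C - s" f] by auto
  define S where "S = C - B"
  have fB: "finite B" using B(1) assms(1) finite_subset by blast
  have cS: "card S = s" using card_Diff_subset[OF fB B(1)] B(2) assms(2) by (simp add: S_def)
  have "(\<Sum>a\<in>S. \<Sum>b\<in>B. f a) \<le> (\<Sum>a\<in>S. \<Sum>b\<in>B. f b)"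
    by (intro sum_mono) (auto simp: S_def B(3))
  then have le: "card B * sum f S \<le> s * sum f B" using cS by (simp add: sum_distrib_left mult.commute)
  have C: "sum f C = sum f S + sum f B" unfolding S_def by (rule sum.subset_diff[OF B(1) assms(1)])
  have "card C = s + card B" using B(2) assms(2) by simp
  then have "sum f S * card C \<le> s * sum f C" using le C by (simp add: algebra_simps)
  then show thesis using that[of S] cS by (auto simp: S_def)
qed

lemma card_nbrs_in_le:
  assumes "finite S"
  shows "card (nbrs_in F T S) \<le> (\<Sum>v\<in>S. card (nbrs_in F T {v}))"
proof -
  have "nbrs_in F T S = (\<Union>v\<in>S. nbrs_in F T {v})" by (auto simp: nbrs_in_def)
  then show ?thesis using card_UN_le[OF assms, of "\<lambda>v. nbrs_in F T {v}"] by simp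
qed

text \<open>After removing \<open>2t - j\<close> vertices, what remains of a 2-tree fits into the disjoint union of
  \<open>K\<^bsub>j+1,2j\<^esub>\<close>, one edge and isolated vertices.\<close>

lemma two_tree_split:
  assumes tt: "two_tree W F" and card_W: "card W = 3 * t + 2" and t: "2 \<le> t" and j: "j \<le> t"
  obtains X S T where "W = X \<union> S \<union> T" "X \<inter> S = {}" "X \<inter> T = {}" "S \<inter> T = {}" "card X = 2 * t - j"
    "\<And>x y. {x, y} \<in> F \<Longrightarrow> x \<in> S \<Longrightarrow> y \<notin> S" "\<And>x y. {x, y} \<in> F \<Longrightarrow> x \<in> T \<Longrightarrow> y \<notin> T"
    "card S \<le> j + 1 \<and> card (nbrs_in F T S) \<le> 2 * j \<or>
     (\<exists>v\<in>S. \<exists>u\<in>T. card (S - {v}) \<le> j \<and> nbrs_in F T {v} = {u} \<and> u \<notin> nbrs_in F T (S - {v})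
       \<and> card (nbrs_in F T (S - {v})) \<le> 2 * j)"
proof -
  note goal = that
  obtain X1 C T where cl: "W = X1 \<union> C \<union> T" "X1 \<inter> C = {}" "X1 \<inter> T = {}" "C \<inter> T = {}"
    and ind: "\<And>x y. {x, y} \<in> F \<Longrightarrow> x \<in> C \<Longrightarrow> y \<notin> C" "\<And>x y. {x, y} \<in> F \<Longrightarrow> x \<in> T \<Longrightarrow> y \<notin> T"
    and le: "card X1 \<le> card C" "card C \<le> card T"
    and sum: "(\<Sum>v\<in>C. card (nbrs_in F T {v})) + 1 = card C + card T"
    and pos: "\<And>v. v \<in> C \<Longrightarrow> 1 \<le> card (nbrs_in F T {v})"
    using two_tree_classes[OF tt] by metis
  have fW: "finite W" using two_tree_simple[OF tt] by (simp add: simple_graph_iff)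
  have f: "finite X1" "finite C" "finite T" using fW cl(1) by auto
  have cX: "card (X1 \<union> C) = card X1 + card C" using f cl by (intro card_Un_disjoint)
  have "card W = card (X1 \<union> C) + card T" unfolding cl(1) using f cl by (intro card_Un_disjoint) auto
  then have total: "card X1 + card C + card T = 3 * t + 2" using cX card_W by simp
  show thesis
  proof (cases "card X1 + card C \<le> 2 * t - j")
    case True
    have "2 * t - j - (card X1 + card C) \<le> card T" using total by linarith
    then obtain Y where Y: "Y \<subseteq> T" "card Y = 2 * t - j - (card X1 + card C)"
      by (meson obtain_subset_with_card_n)
    have "card (X1 \<union> C \<union> Y) = card (X1 \<union> C) + card Y"
      using f Y(1) cl finite_subset[OF Y(1)] by (intro card_Un_disjoint) auto
    then have "card (X1 \<union> C \<union> Y) = 2 * t - j" using Y(2) cX True by simp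
    then show ?thesis
      by (intro goal[of "X1 \<union> C \<union> Y" "{}" "T - Y"]) (use cl Y ind in \<open>auto simp: nbrs_in_def\<close>)
  next
    case False
    \<comment> \<open>\<open>s\<close> vertices of \<open>C\<close> find no place in
      \<open>X\<close>; those with the fewest neighbours in \<open>T\<close> are left over.\<close>
    define s where "s = card X1 + card C - (2 * t - j)"
    have s: "s + 2 * t = card X1 + card C + j" using False j by (simp add: s_def)
    have "s \<le> card C" using s le total j by linarith
    then obtain S where S: "S \<subseteq> C" "card S = s"
      and avg: "(\<Sum>v\<in>S. card (nbrs_in F T {v})) * card C \<le> s * (\<Sum>v\<in>C. card (nbrs_in F T {v}))"
      using bottom_subset_average[OF f(2), of s "\<lambda>v. card (nbrs_in F T {v})"] by blast
    have fS: "finite S" using S(1) f(2) finite_subset by blast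
    define \<Sigma> where "\<Sigma> = (\<Sum>v\<in>S. card (nbrs_in F T {v}))"
    define X where "X = X1 \<union> (C - S)"
    have "card X = card X1 + card (C - S)" unfolding X_def using f cl by (intro card_Un_disjoint) auto
    also have "card (C - S) = card C - s" using card_Diff_subset[OF fS S(1)] S(2) by simp
    finally have "card X = 2 * t - j" using \<open>s \<le> card C\<close> s by linarith
    note g = goal[of X S T, OF _ _ _ _ this]
    have ne: "W = X \<union> S \<union> T" "X \<inter> S = {}" "X \<inter> T = {}" "S \<inter> T = {}"
      using cl S(1) by (auto simp: X_def)
    have indS: "\<And>x y. {x, y} \<in> F \<Longrightarrow> x \<in> S \<Longrightarrow> y \<notin> S" using ind(1) S(1) by blast
    note g = g[OF ne indS ind(2)]
    have NT: "card (nbrs_in F T S) \<le> card T" using f(3) by (intro card_mono) (auto simp: nbrs_in_def)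
    have NS: "card (nbrs_in F T S) \<le> \<Sigma>" unfolding \<Sigma>_def by (rule card_nbrs_in_le[OF fS])
    \<comment> \<open>The two smaller classes together have at most two thirds of
      \<open>3 * t + 2\<close> vertices, hence at most \<open>2 * t + 1\<close>.\<close>
    have sj: "s \<le> j + 1" using s le total by linarith
    show ?thesis
    proof (cases "s = j + 1")
      case True
      have sizes: "card C = t + 1" "card T = t + 1" using True s le total by linarith+
      \<comment> \<open>On average a vertex of \<open>C\<close> has
        \<open>(2 * t + 1) / (t + 1) < 2\<close> neighbours in \<open>T\<close>, so the
        \<open>j + 1\<close> vertices of \<open>S\<close> have fewer than \<open>2 * j + 2\<close>
        in total.\<close>
      have "\<Sigma> * (t + 1) \<le> (j + 1) * (2 * t + 1)" 
      proof -
        have "(\<Sum>v\<in>C. card (nbrs_in F T {v})) = 2 * t + 1" using sum sizes by simp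
        then show ?thesis using avg unfolding \<Sigma>_def sizes(1) True by simp
      qed
      also have "\<dots> < (2 * j + 2) * (t + 1)" by simp
      finally have "\<Sigma> < 2 * j + 2" using mult_less_cancel2 by blast
      then have S1: "\<Sigma> \<le> 2 * j + 1" by simp
      show ?thesis
      proof (cases "card (nbrs_in F T S) \<le> 2 * j")
        case small: True
        show ?thesis by (rule g) (use small S(2) sj in auto)
      next
        case big: False
        \<comment> \<open>Now \<open>S\<close> has one neighbour too many for
          \<open>K_{j+1,2j}\<close>. Some \<open>v\<close> has a single neighbour \<open>u\<close>,
          and \<open>u\<close> is not shared, since the rest of \<open>S\<close> has at most
          \<open>2 * j\<close> neighbours. The pair \<open>v\<close>, \<open>u\<close> is the
          separate edge of the target.\<close>
        have "\<exists>v\<in>S. card (nbrs_in F T {v}) < 2"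
        proof (rule ccontr)
          assume "\<not> ?thesis"
          then have "(\<Sum>v\<in>S. 2) \<le> \<Sigma>" unfolding \<Sigma>_def by (intro sum_mono) (meson not_le)
          then show False using S(2) True S1 by simp
        qed
        then obtain v where v: "v \<in> S" "card (nbrs_in F T {v}) < 2" by blast
        then have "card (nbrs_in F T {v}) = 1" using pos[of v] S(1) by fastforce
        then obtain u where u: "nbrs_in F T {v} = {u}" by (meson card_1_singletonE)
        have uT: "u \<in> T" using u by (auto simp: nbrs_in_def)
        have "\<Sigma> = card (nbrs_in F T {v}) + (\<Sum>v\<in>S-{v}. card (nbrs_in F T {v}))"
          unfolding \<Sigma>_def using fS v(1) by (rule sum.remove)
        then have rest: "card (nbrs_in F T (S - {v})) \<le> 2 * j"
          using card_nbrs_in_le[of "S - {v}" F T] fS u S1 by simp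
        have un: "nbrs_in F T S = insert u (nbrs_in F T (S - {v}))"
        proof -
          have "nbrs_in F T S = nbrs_in F T {v} \<union> nbrs_in F T (S - {v})"
            using v(1) by (auto simp: nbrs_in_def)
          then show ?thesis using u by simp
        qed
        have "u \<notin> nbrs_in F T (S - {v})"
        proof
          assume "u \<in> nbrs_in F T (S - {v})"
          then have "nbrs_in F T S = nbrs_in F T (S - {v})" using un by (simp add: insert_absorb)
          then show False using big rest by simp
        qed
        moreover have "card (S - {v}) \<le> j" using v(1) fS S(2) True by simp
        ultimately show ?thesis
          by (intro g disjI2 bexI[of _ v] bexI[of _ u] conjI) (use v(1) uT u rest in auto)
      qed
    next
      case False
      define k where "k = j - s"
      have k: "j = s + k" using False sj by (simp add: k_def)
      have nk: "card X1 + card C + k = 2 * t" "card T = t + 2 + k" using s k total by linarith+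
      have small: "card (nbrs_in F T S) \<le> 2 * j"
      proof (rule ccontr)
        assume "\<not> ?thesis"
        then have big: "2 * j + 1 \<le> \<Sigma>" "2 * j < card T" using NS NT by linarith+
        let ?m = "int (card C)" and ?s = "int s" and ?k = "int k" and ?t = "int t"
        have "(2 * j + 1) * card C \<le> \<Sigma> * card C" using big(1) by (intro mult_right_mono) auto
        also have "\<dots> \<le> s * (card C + t + 1 + k)" 
        proof -
          have "(\<Sum>v\<in>C. card (nbrs_in F T {v})) = card C + t + 1 + k" using sum nk(2) by simp
          then show ?thesis using avg unfolding \<Sigma>_def by simp
        qed
        finally have "int ((2 * j + 1) * card C) \<le> int (s * (card C + t + 1 + k))" by (simp only: of_nat_le_iff)
        then have 1: "(2 * ?s + 2 * ?k + 1) * ?m \<le> ?s * (?m + ?t + 1 + ?k)"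
          by (simp add: k algebra_simps)
        \<comment> \<open>\<open>X1\<close> is no larger than \<open>C\<close>, and together they
          have \<open>2 * t - k\<close> vertices.\<close>
        have "2 * ?t - ?k \<le> 2 * ?m" using nk(1) le(1) by linarith
        then have "(?s + 2 * ?k + 1) * (2 * ?t - ?k) \<le> (?s + 2 * ?k + 1) * (2 * ?m)"
          by (intro mult_left_mono) auto
        then have 2: "(?s + 2 * ?k + 1) * (2 * ?t - ?k) \<le> 2 * (?s * (?t + 1 + ?k))"
          using 1 by (simp add: algebra_simps)
        then have 3: "4 * (?k * ?t) - 2 * (?k * ?k) + 2 * ?t - ?k \<le> 3 * (?k * ?s) + 2 * ?s"
          by (simp add: algebra_simps)
        have "?k * ?s \<le> ?k * (?t - ?k)" using k j by (intro mult_left_mono) auto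
        then have 4: "?k * ?s \<le> ?k * ?t - ?k * ?k" by (simp add: algebra_simps)
        show False
        proof (cases "k = 0")
          case True
          \<comment> \<open>Inequality 3 forces \<open>s = j = t\<close>; then \<open>T\<close> has
            \<open>t + 2\<close> vertices, and \<open>2 * t < t + 2\<close> contradicts
            \<open>t \<ge> 2\<close>.\<close>
          then show False using 3 k j big(2) nk(2) t by simp
        next
          case False
          have "0 \<le> ?k * ?t" "0 \<le> ?k * ?k" by auto
          then show False using 3 4 False k j by linarith
        qed
      qed
      show ?thesis by (rule g) (use small S(2) sj in auto)
    qed
  qed
qed

lemma inj_on_extend:
  assumes "finite Y" "finite R" "card Y \<le> card R" "Y0 \<subseteq> Y" "inj_on g Y0" "g ` Y0 \<subseteq> R"
  obtains h where "inj_on h Y" "h ` Y \<subseteq> R" "\<And>y. y \<in> Y0 \<Longrightarrow> h y = g y"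
proof -
  have f0: "finite Y0" using assms finite_subset by blast
  have "card (Y - Y0) = card Y - card Y0" by (rule card_Diff_subset[OF f0 assms(4)])
  moreover have "card (R - g ` Y0) = card R - card Y0"
    using card_Diff_subset[of "g ` Y0" R] f0 assms(5,6) by (simp add: card_image)
  ultimately have "card (Y - Y0) \<le> card (R - g ` Y0)" using assms(3) by simp
  then obtain h where h: "h ` (Y - Y0) \<subseteq> R - g ` Y0" "inj_on h (Y - Y0)"
    using card_le_inj[of "Y - Y0" "R - g ` Y0"] assms(1,2) by auto
  define q where "q y = (if y \<in> Y0 then g y else h y)" for y
  have "inj_on q (Y0 \<union> (Y - Y0))"
    using assms(5) h by (subst inj_on_Un) (auto simp: q_def inj_on_def)
  moreover have "Y0 \<union> (Y - Y0) = Y" using assms(4) by blast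
  moreover have "q ` Y \<subseteq> R" using h(1) assms(6) by (auto simp: q_def)
  ultimately show thesis using that[of q] by (simp add: q_def)
qed

lemma inj_on_disjoint_pieces:
  assumes "finite A" "finite B" "finite P" "finite Q" "card A \<le> card P" "card B \<le> card Q"
    "A \<inter> B = {}" "P \<inter> Q = {}"
  obtains g where "inj_on g (A \<union> B)" "g ` A \<subseteq> P" "g ` B \<subseteq> Q"
proof -
  obtain p where p: "p ` A \<subseteq> P" "inj_on p A" using card_le_inj[OF assms(1,3,5)] by blast
  obtain q where q: "q ` B \<subseteq> Q" "inj_on q B" using card_le_inj[OF assms(2,4,6)] by blast
  define g where "g y = (if y \<in> A then p y else q y)" for y
  have B: "g y = q y" if "y \<in> B" for y using that assms(7) by (auto simp: g_def)
  have gi: "g ` A = p ` A" "g ` B = q ` B" using B by (auto simp: g_def)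
  have "inj_on g A" using p(2) by (simp add: g_def inj_on_def)
  moreover have "inj_on g B" using q(2) B by (simp add: inj_on_def)
  moreover have "g ` A \<inter> g ` B = {}" using gi p(1) q(1) assms(8) by blast
  ultimately have "inj_on g (A \<union> B)" by (subst inj_on_Un) blast
  then show thesis using that[of g] gi p(1) q(1) by simp
qed

text \<open>\<open>X\<close> goes to \<open>A\<close>, \<open>S\<close> to \<open>P\<close> and the
  neighbours of \<open>S\<close> in \<open>T\<close> to \<open>Q\<close>. The other vertices of
  \<open>T\<close> go anywhere in \<open>R\<close>: all their edges lead to \<open>X\<close>, and
  \<open>A\<close> is completely joined to \<open>R\<close>. In the exceptional case
  \<open>v\<close> and \<open>u\<close> go to \<open>c\<close> and \<open>e\<close>.\<close>

lemma embed_two_tree: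
  assumes tt: "two_tree W F" and card_W: "card W = 3 * t + 2" and t: "2 \<le> t" and j: "j \<le> t"
    and A: "A \<subseteq> V" "R \<subseteq> V" "finite A" "finite R" "A \<inter> R = {}" "card A = 2 * t - j" "t + 2 + j \<le> card R"
    and E: "pairs A \<subseteq> E" "cross A R \<subseteq> E"
    and PQ: "P \<subseteq> R" "Q \<subseteq> R" "P \<inter> Q = {}" "card P = j + 1" "card Q = 2 * j" "cross P Q \<subseteq> E"
    and ce: "c \<in> R - P - Q" "e \<in> R - P - Q" "c \<noteq> e" "{c, e} \<in> E"
  shows "contains_subgraph V E W F"
proof -
  obtain X S T where W: "W = X \<union> S \<union> T" "X \<inter> S = {}" "X \<inter> T = {}" "S \<inter> T = {}" "card X = 2 * t - j"
    and ind: "\<And>x y. {x, y} \<in> F \<Longrightarrow> x \<in> S \<Longrightarrow> y \<notin> S" "\<And>x y. {x, y} \<in> F \<Longrightarrow> x \<in> T \<Longrightarrow> y \<notin> T"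
    and split: "card S \<le> j + 1 \<and> card (nbrs_in F T S) \<le> 2 * j \<or>
     (\<exists>v\<in>S. \<exists>u\<in>T. card (S - {v}) \<le> j \<and> nbrs_in F T {v} = {u} \<and> u \<notin> nbrs_in F T (S - {v})
       \<and> card (nbrs_in F T (S - {v})) \<le> 2 * j)"
    by (rule two_tree_split[OF tt card_W t j]) (rule that)
  have sg: "simple_graph W F" by (rule two_tree_simple[OF tt])
  have fW: "finite W" using sg by (simp add: simple_graph_iff)
  have f: "finite X" "finite S" "finite T" using fW W(1) by auto
  have fPQ: "finite P" "finite Q" using PQ(1,2) A(4) finite_subset by blast+
  define Y where "Y = S \<union> T"
  have fY: "finite Y" using f by (simp add: Y_def)
  have XY: "X \<inter> Y = {}" "W = X \<union> Y" using W by (auto simp: Y_def)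
  have "card W = card X + card Y" unfolding XY(2) using f fY XY(1) by (intro card_Un_disjoint)
  then have cY: "card Y \<le> card R" using card_W W(5) j A(7) by linarith
  have nT: "nbrs_in F T S' \<subseteq> T" for S' by (auto simp: nbrs_in_def)
  have "\<exists>h. inj_on h Y \<and> h ` Y \<subseteq> R \<and> (\<forall>s\<in>S. \<forall>u\<in>T. {s, u} \<in> F \<longrightarrow> {h s, h u} \<in> E)"
    using split
  proof
    assume a: "card S \<le> j + 1 \<and> card (nbrs_in F T S) \<le> 2 * j"
    define N where "N = nbrs_in F T S"
    have N: "finite N" "S \<inter> N = {}" "N \<subseteq> T" using f(3) nT[of S] W(4) finite_subset by (auto simp: N_def)
    obtain g where g: "inj_on g (S \<union> N)" "g ` S \<subseteq> P" "g ` N \<subseteq> Q"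
      using inj_on_disjoint_pieces[OF f(2) N(1) fPQ _ _ N(2) PQ(3)] a PQ(4,5) by (auto simp: N_def)
    have "S \<union> N \<subseteq> Y" "g ` (S \<union> N) \<subseteq> R" using N(3) g PQ(1,2) by (auto simp: Y_def)
    then obtain h where h: "inj_on h Y" "h ` Y \<subseteq> R" "\<And>y. y \<in> S \<union> N \<Longrightarrow> h y = g y"
      using inj_on_extend[OF fY A(4) cY _ g(1)] by metis
    have "{h s, h u} \<in> E" if su: "s \<in> S" "u \<in> T" "{s, u} \<in> F" for s u
    proof -
      have "u \<in> N" using su by (auto simp: N_def nbrs_in_def)
      then have "h s \<in> P" "h u \<in> Q" using h(3) g(2,3) su(1) by auto
      then show ?thesis using crossI[of "h s" P "h u" Q] PQ(6) by blast
    qed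
    then show ?thesis using h by blast
  next
    assume "\<exists>v\<in>S. \<exists>u\<in>T. card (S - {v}) \<le> j \<and> nbrs_in F T {v} = {u} \<and> u \<notin> nbrs_in F T (S - {v})
       \<and> card (nbrs_in F T (S - {v})) \<le> 2 * j"
    then obtain v u where vu: "v \<in> S" "u \<in> T" "card (S - {v}) \<le> j" "nbrs_in F T {v} = {u}"
      "u \<notin> nbrs_in F T (S - {v})" "card (nbrs_in F T (S - {v})) \<le> 2 * j" by blast
    define S' where "S' = S - {v}"
    define N where "N = nbrs_in F T S'"
    have N: "finite N" "S' \<inter> N = {}" "N \<subseteq> T" "finite S'"
      using f nT[of S'] W(4) finite_subset by (auto simp: N_def S'_def)
    obtain g where g: "inj_on g (S' \<union> N)" "g ` S' \<subseteq> P" "g ` N \<subseteq> Q"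
      using inj_on_disjoint_pieces[OF N(4,1) fPQ _ _ N(2) PQ(3)] vu(3,6) PQ(4,5) by (auto simp: N_def S'_def)
    define g' where "g' = g(v := c, u := e)"
    have out: "v \<notin> S' \<union> N" "u \<notin> S' \<union> N" "u \<noteq> v" using vu N(3) W(4) by (auto simp: S'_def N_def)
    have g'0: "g' y = g y" if "y \<in> S' \<union> N" for y using that out by (auto simp: g'_def)
    have g'1: "g' v = c" "g' u = e" using out(3) by (auto simp: g'_def)
    have im: "g' ` (S' \<union> N) \<subseteq> P \<union> Q" using g'0 g(2,3) by auto
    have "inj_on g' (S' \<union> N)" using g(1) g'0 by (metis inj_on_cong)
    then have "inj_on g' (insert v (insert u (S' \<union> N)))"
      using im ce g'1 out by (auto simp: inj_on_insert)
    moreover have "insert v (insert u (S' \<union> N)) \<subseteq> Y" using vu N(3) by (auto simp: Y_def S'_def)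
    moreover have "g' ` insert v (insert u (S' \<union> N)) \<subseteq> R" using im ce g'1 PQ(1,2) by auto
    ultimately obtain h where h: "inj_on h Y" "h ` Y \<subseteq> R"
      "\<And>y. y \<in> insert v (insert u (S' \<union> N)) \<Longrightarrow> h y = g' y"
      using inj_on_extend[OF fY A(4) cY] by metis
    have "{h s, h w} \<in> E" if sw: "s \<in> S" "w \<in> T" "{s, w} \<in> F" for s w
    proof (cases "s = v")
      case True
      then have "w \<in> nbrs_in F T {v}" using sw by (auto simp: nbrs_in_def)
      then have "w = u" using vu(4) by simp
      then show ?thesis using True h(3)[of v] h(3)[of u] g'1 ce(4) by simp
    next
      case False
      then have s': "s \<in> S'" "w \<in> N" using sw by (auto simp: S'_def N_def nbrs_in_def)
      then have "h s = g s" "h w = g w" using h(3)[of s] h(3)[of w] g'0 by auto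
      then have "h s \<in> P" "h w \<in> Q" using s' g(2,3) by auto
      then show ?thesis using crossI[of "h s" P "h w" Q] PQ(6) by blast
    qed
    then show ?thesis using h by blast
  qed
  then obtain h where h: "inj_on h Y" "h ` Y \<subseteq> R"
    "\<forall>s\<in>S. \<forall>u\<in>T. {s, u} \<in> F \<longrightarrow> {h s, h u} \<in> E" by (elim exE conjE)
  obtain q where q: "q ` X \<subseteq> A" "inj_on q X" using card_le_inj[OF f(1) A(3)] W(5) A(6) by auto
  define \<phi> where "\<phi> w = (if w \<in> X then q w else h w)" for w
  have \<phi>X: "\<phi> w = q w" "\<phi> w \<in> A" if "w \<in> X" for w using that q(1) by (auto simp: \<phi>_def)
  have \<phi>Y: "\<phi> w = h w" "\<phi> w \<in> R" if "w \<in> Y" for w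
  proof -
    have "w \<notin> X" using that XY(1) by blast
    then show "\<phi> w = h w" by (simp add: \<phi>_def)
    then show "\<phi> w \<in> R" using that h(2) by auto
  qed
  have iX: "inj_on \<phi> X" using q(2) \<phi>X(1) by (simp add: inj_on_def)
  have iY: "inj_on \<phi> Y" using h(1) \<phi>Y(1) by (simp add: inj_on_def)
  have sub: "\<phi> ` X \<subseteq> A" "\<phi> ` Y \<subseteq> R" using \<phi>X(2) \<phi>Y(2) by auto
  then have "\<phi> ` X \<inter> \<phi> ` Y = {}" using A(5) by blast
  then have inj: "inj_on \<phi> W" unfolding XY(2) using iX iY by (subst inj_on_Un) blast
  have im: "\<phi> ` W \<subseteq> V" unfolding XY(2) using sub A(1,2) by blast
  have "\<phi> ` f \<in> E" if f: "f \<in> F" for f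
  proof -
    have "f \<in> pairs W" using f sg by (auto simp: simple_graph_iff)
    then obtain x y where xy: "f = {x, y}" "x \<noteq> y" "x \<in> W" "y \<in> W" by (rule pairsE)
    have img: "\<phi> ` f = {\<phi> x, \<phi> y}" using xy(1) by simp
    have ne: "\<phi> x \<noteq> \<phi> y" using inj xy by (auto dest: inj_onD)
    have XYe: "{\<phi> a, \<phi> b} \<in> E" if "a \<in> X" "b \<in> Y" for a b
      using crossI[OF \<phi>X(2)[OF that(1)] \<phi>Y(2)[OF that(2)]] E(2) by blast
    have ST: "{\<phi> a, \<phi> b} \<in> E" if ab: "a \<in> S" "b \<in> T" "{a, b} \<in> F" for a b
      using h(3) \<phi>Y(1)[of a] \<phi>Y(1)[of b] ab by (simp add: Y_def)
    consider "x \<in> X" "y \<in> X" | "x \<in> X" "y \<in> Y" | "x \<in> Y" "y \<in> X" | "x \<in> Y" "y \<in> Y"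
      using xy XY(2) by blast
    then show ?thesis
    proof cases
      case 1
      then have "{\<phi> x, \<phi> y} \<in> pairs A" using \<phi>X(2) ne by simp
      then show ?thesis unfolding img using E(1) by blast
    next
      case 2 then show ?thesis using XYe[of x y] img by simp
    next
      case 3 then show ?thesis using XYe[of y x] img by (simp add: insert_commute)
    next
      case 4
      have e: "{x, y} \<in> F" "{y, x} \<in> F" using f xy(1) by (auto simp: insert_commute)
      have "x \<in> S \<and> y \<in> T \<or> x \<in> T \<and> y \<in> S" using 4 ind(1)[OF e(1)] ind(2)[OF e(1)] by (auto simp: Y_def)
      then show ?thesis using ST[of x y] ST[of y x] e img by (auto simp: insert_commute)
    qed
  qed
  then show ?thesis unfolding contains_subgraph_def using inj im by blast
qed

lemma clique_contains:
  assumes "simple_graph W F" "Q \<subseteq> V" "finite Q" "card W \<le> card Q" "pairs Q \<subseteq> E"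
  shows "contains_subgraph V E W F"
proof -
  have "finite W" using assms(1) by (simp add: simple_graph_iff)
  then obtain f where f: "f ` W \<subseteq> Q" "inj_on f W" using card_le_inj[of W Q] assms(3,4) by blast
  have "f ` e \<in> E" if "e \<in> F" for e
  proof -
    have "e \<in> pairs W" using that assms(1) by (auto simp: simple_graph_iff)
    then obtain x y where xy: "e = {x, y}" "x \<noteq> y" "x \<in> W" "y \<in> W" by (rule pairsE)
    then have "f x \<noteq> f y" using f(2) by (auto dest: inj_onD)
    then have "{f x, f y} \<in> pairs Q" using xy f(1) by auto
    then show ?thesis using assms(5) xy(1) by auto
  qed
  then show ?thesis unfolding contains_subgraph_def using f assms(2) by blast
qed

section \<open>Realizations that contain every 2-tree\<close>

context dense_degrees
begin

text \<open>The spare degree \<open>2 * j\<close> within \<open>R\<close> decides the target. For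
  \<open>j \<le> t\<close> it suffices for \<open>K_{j+1,2j}\<close> and an edge. For
  \<open>j > t\<close> it is at least \<open>t + 1 + j\<close>, so \<open>R\<close> can be made a
  clique of \<open>t + 2 + j\<close> vertices, and \<open>L \<union> R\<close> is one of
  \<open>3 * t + 2\<close>.\<close>

lemma universal_small_L:
  assumes p: "card L < 2 * t"
  shows "\<exists>E. realizes V d E \<and>
    (\<forall>(W :: 'b set) F. two_tree W F \<and> card W = 3 * t + 2 \<longrightarrow> contains_subgraph V E W F)"
proof -
  define j where "j = 2 * t - card L"
  have j: "card L + j = 2 * t" "1 \<le> j" using p by (auto simp: j_def)
  obtain R0 where R0: "R0 \<subseteq> V - L" "card R0 = 3 * t + 3" "\<And>v. v \<in> R0 \<Longrightarrow> 2 * t + j \<le> d v"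
    using exists_R_small_L[OF j] by blast
  have fR0: "finite R0" using R0(2) card.infinite by fastforce
  show ?thesis
  proof (cases "j \<le> t")
    case True
    \<comment> \<open>This size holds both \<open>P\<close>, \<open>Q\<close>, \<open>c\<close>,
      \<open>e\<close>, which take \<open>3 * j + 3\<close> vertices, and the
      \<open>t + 2 + j\<close> vertices of a 2-tree off \<open>X\<close>.\<close>
    have "t + 2 * j + 3 \<le> card R0" using True R0(2) by simp
    then obtain R where R: "R \<subseteq> R0" "card R = t + 2 * j + 3" by (meson obtain_subset_with_card_n)
    have fR: "finite R" using R(1) fR0 finite_subset by blast
    obtain P where P: "P \<subseteq> R" "card P = j + 1"
      using obtain_subset_with_card_n[of "j + 1" R] R(2) by auto
    have fP: "finite P" using P(1) fR finite_subset by blast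
    have "card (R - P) = t + j + 2" using card_Diff_subset[OF fP P(1)] P(2) R(2) by simp
    then obtain Q where Q: "Q \<subseteq> R - P" "card Q = 2 * j"
      using obtain_subset_with_card_n[of "2 * j" "R - P"] True by auto
    have fQ: "finite Q" using Q(1) fR finite_subset by blast
    have "2 \<le> card (R - P - Q)"
      using card_Diff_subset[OF fQ Q(1)] Q(2) \<open>card (R - P) = t + j + 2\<close> True by simp
    then obtain D where D: "D \<subseteq> R - P - Q" "card D = 2" by (meson obtain_subset_with_card_n)
    obtain c e where "D = {c, e}" "c \<noteq> e" using D(2) by (auto simp: card_2_iff)
    then have ce: "c \<in> R - P - Q" "e \<in> R - P - Q" "c \<noteq> e" using D(1) by blast+
    have PQ: "P \<inter> Q = {}" using Q(1) by blast
    define J where "J = cross P Q \<union> {{c, e}}"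
    have JR: "J \<subseteq> pairs R"
    proof
      fix f assume "f \<in> J"
      then consider a b where "f = {a, b}" "a \<in> P" "b \<in> Q" | "f = {c, e}"
        unfolding J_def cross_def by blast
      then show "f \<in> pairs R"
      proof cases
        case (1 a b)
        then have "a \<noteq> b" "a \<in> R" "b \<in> R" using PQ P(1) Q(1) by blast+
        then show ?thesis using 1 by simp
      next
        case 2 then show ?thesis using ce by simp
      qed
    qed
    have Jdeg: "card (neighbors J v) \<le> 2 * j" for v
    proof -
      have "\<exists>M. neighbors J v \<subseteq> M \<and> finite M \<and> card M \<le> 2 * j"
      proof -
        consider "v \<in> P" | "v \<in> Q" "v \<notin> P" | "v = c" | "v = e" | "v \<notin> P" "v \<notin> Q" "v \<noteq> c" "v \<noteq> e" by blast
        then show ?thesis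
        proof cases
          case 1
          then have "neighbors J v \<subseteq> Q"
            using PQ ce by (auto simp: J_def in_neighbors_iff cross_iff doubleton_eq_iff)
          then show ?thesis using fQ Q(2) by (intro exI[of _ Q]) simp
        next
          case 2
          then have "neighbors J v \<subseteq> P"
            using ce by (auto simp: J_def in_neighbors_iff cross_iff doubleton_eq_iff)
          then show ?thesis using fP P(2) j(2) by (intro exI[of _ P]) simp
        next
          case 3
          then have "neighbors J v \<subseteq> {e}"
            using ce by (auto simp: J_def in_neighbors_iff cross_iff doubleton_eq_iff)
          then show ?thesis using j(2) by (intro exI[of _ "{e}"]) simp
        next
          case 4
          then have "neighbors J v \<subseteq> {c}"
            using ce by (auto simp: J_def in_neighbors_iff cross_iff doubleton_eq_iff)
          then show ?thesis using j(2) by (intro exI[of _ "{c}"]) simp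
        next
          case 5
          then have "neighbors J v \<subseteq> {}"
            by (auto simp: J_def in_neighbors_iff cross_iff doubleton_eq_iff)
          then show ?thesis by (intro exI[of _ "{}"]) simp
        qed
      qed
      then show ?thesis by (meson card_mono order_trans)
    qed
    have RL: "R \<subseteq> V - L" using R(1) R0(1) by blast
    obtain E where E: "realizes V d E" "pairs L \<subseteq> E" "cross L R \<subseteq> E" "J \<subseteq> E"
    proof (rule small_L_completion[OF j RL _ JR Jdeg])
      show "\<And>v. v \<in> R \<Longrightarrow> 2 * t + j \<le> d v" using R(1) R0(3) by blast
      show "card R \<le> 3 * t + 3" "card L + card R \<le> 4 * t + 3" using R(2) True j(1) by linarith+
    qed
    have RV: "R \<subseteq> V" "L \<inter> R = {}" using RL by blast+
    have cL: "card L = 2 * t - j" "t + 2 + j \<le> card R" using j R(2) by linarith+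
    have QR: "Q \<subseteq> R" using Q(1) by blast
    have JE: "cross P Q \<subseteq> E" "{c, e} \<in> E" using E(4) by (auto simp: J_def)
    have "contains_subgraph V E W F" if "two_tree W F" "card W = 3 * t + 2" for W :: "'b set" and F
      by (rule embed_two_tree[OF that t True L_sub RV(1) finite_L fR RV(2) cL E(2,3)
            P(1) QR PQ P(2) Q(2) JE(1) ce JE(2)])
    then show ?thesis using E(1) by blast
  next
    case False
    have "t + 2 + j \<le> card R0" using j R0(2) by simp
    then obtain R where R: "R \<subseteq> R0" "card R = t + 2 + j" by (meson obtain_subset_with_card_n)
    have fR: "finite R" using R(1) fR0 finite_subset by blast
    have RL: "R \<subseteq> V - L" using R(1) R0(1) by blast
    have Jdeg: "card (neighbors (pairs R) v) \<le> 2 * j" if "v \<in> R" for v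
    proof -
      have "neighbors (pairs R) v \<subseteq> R - {v}"
        using fR by (intro neighbors_subset) (simp add: simple_graph_iff)
      then have "card (neighbors (pairs R) v) \<le> card (R - {v})" using fR by (intro card_mono) auto
      then show ?thesis using that R(2) fR False by simp
    qed
    obtain E where E: "realizes V d E" "pairs L \<subseteq> E" "cross L R \<subseteq> E" "pairs R \<subseteq> E"
    proof (rule small_L_completion[OF j RL _ subset_refl Jdeg])
      show "\<And>v. v \<in> R \<Longrightarrow> 2 * t + j \<le> d v" using R(1) R0(3) by blast
      show "card R \<le> 3 * t + 3" "card L + card R \<le> 4 * t + 3" using R(2) j by linarith+
    qed
    have "card (L \<union> R) = card L + card R" using finite_L fR RL by (intro card_Un_disjoint) auto
    then have cU: "card (L \<union> R) = 3 * t + 2" using R(2) j by simp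
    have UE: "pairs (L \<union> R) \<subseteq> E"
    proof
      fix f assume "f \<in> pairs (L \<union> R)"
      then obtain x y where f: "f = {x, y}" "x \<noteq> y" "x \<in> L \<union> R" "y \<in> L \<union> R" by (rule pairsE)
      then consider "f \<in> pairs L" | "f \<in> pairs R" | "f \<in> cross L R"
        using crossI[of x L y R] crossI'[of y L x R] by auto
      then show "f \<in> E" using E by cases blast+
    qed
    have UV: "L \<union> R \<subseteq> V" "finite (L \<union> R)" using RL L_sub finite_L fR by blast+
    have "contains_subgraph V E W F" if "two_tree W F" "card W = 3 * t + 2" for W :: "'b set" and F
      by (rule clique_contains[OF two_tree_simple[OF that(1)] UV]) (use that cU UE in auto)
    then show ?thesis using E(1) by blast
  qed
qed

lemma universal_realization:
  "\<exists>E. realizes V d E \<and>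
    (\<forall>(W :: 'b set) F. two_tree W F \<and> card W = 3 * t + 2 \<longrightarrow> contains_subgraph V E W F)"
proof (cases "card L < 2 * t")
  case True then show ?thesis by (rule universal_small_L)
next
  case False
  obtain E0 where r0: "realizes V d E0" using graphical by blast
  have clique: ?thesis if E: "realizes V d E" and Q: "Q \<subseteq> V" "card Q = 3 * t + 2" "pairs Q \<subseteq> E" for E Q
  proof -
    have fQ: "finite Q" using Q(1) finite_V finite_subset by blast
    have "contains_subgraph V E W F" if "two_tree W F" "card W = 3 * t + 2" for W :: "'b set" and F
      by (rule clique_contains[OF two_tree_simple[OF that(1)] Q(1) fQ]) (use that Q in auto)
    then show ?thesis using E by blast
  qed
  show ?thesis
  proof (cases "3 * t + 2 \<le> card L")
    case True
    then obtain U where U: "U \<subseteq> L" "card U = 3 * t + 2" by (meson obtain_subset_with_card_n)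
    have UV: "U \<subseteq> V" using U(1) L_sub by blast
    have deg: "card U + (3 * t + 2) \<le> d u + 3" if "u \<in> U" for u
      using that U by (auto simp: L_def)
    have r1: "1 \<le> 3 * t + 2" by simp
    show ?thesis
      by (rule clique_or_clique[OF r0 UV deg r1]) (use clique UV U(2) in blast)+
  next
    case small: False
    have deg: "card L + (3 * t + 2) \<le> d u + 3" if "u \<in> L" for u
      using that small by (auto simp: L_def)
    have r1: "1 \<le> 3 * t + 2" by simp
    show ?thesis
    proof (rule clique_or_clique[OF r0 L_sub deg r1])
      fix E Q assume "realizes V d E" "Q \<subseteq> V" "card Q = 3 * t + 2" "pairs Q \<subseteq> E"
      then show ?thesis by (rule clique)
    next
      fix E1 assume E1: "realizes V d E1" "pairs L \<subseteq> E1"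
      have p: "2 * t \<le> card L" "card L \<le> 3 * t + 1" using False small by auto
      obtain E A X c e where E: "realizes V d E" and A: "A \<subseteq> V" "card A = 2 * t" "X \<subseteq> V - A" "card X = t + 2"
        "pairs A \<subseteq> E" "cross A X \<subseteq> E" and ce: "c \<in> X" "e \<in> X" "{c, e} \<in> E"
        by (rule large_L_realization[OF p E1])
      have f: "finite A" "finite X" using A finite_V finite_subset by (blast, metis finite_Diff finite_subset)
      have ne: "c \<noteq> e" using simple_graph_edgeD(3)[OF realizesD(1)[OF E] ce(3)] .
      have "card (X - {c, e}) = t" using f ce ne A(4) by (subst card_Diff_subset) auto
      then have "X - {c, e} \<noteq> {}" using t by (metis card.empty not_numeral_le_zero)
      then obtain w where w: "w \<in> X" "w \<noteq> c" "w \<noteq> e" by blast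
      have "contains_subgraph V E W F" if "two_tree W F" "card W = 3 * t + 2" for W :: "'b set" and F
        \<comment> \<open>With a full \<open>2 * t\<close>-clique the deficit is 0, and
          \<open>K_{1,0}\<close> is the single vertex \<open>w\<close>.\<close>
        by (rule embed_two_tree[OF that t, of 0 A V X E "{w}" "{}" c e])
          (use A f ce ne w in \<open>auto simp: cross_def\<close>)
      then show ?thesis using E by blast
    qed
  qed
qed

end

section \<open>From degree functions back to degree sequences\<close>

lemma degree_sequence_facts:
  shows "sum_list (degree_sequence V E) = (\<Sum>v\<in>V. degree E v)"
    "length (degree_sequence V E) = card V"
proof -
  have m: "mset (degree_sequence V E) = image_mset (degree E) (mset_set V)"
    by (simp add: degree_sequence_def)
  have "sum_list (degree_sequence V E) = sum_mset (mset (degree_sequence V E))"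
    by (simp add: sum_mset_sum_list)
  then show "sum_list (degree_sequence V E) = (\<Sum>v\<in>V. degree E v)"
    unfolding m by (simp add: sum_unfold_sum_mset)
  have "length (degree_sequence V E) = size (mset (degree_sequence V E))" by simp
  then show "length (degree_sequence V E) = card V" unfolding m by simp
qed

lemma realizes_degree_sequence:
  assumes "realizes V (degree E0) E"
  shows "realization V E (degree_sequence V E0)"
proof -
  have "image_mset (degree E) (mset_set V) = image_mset (degree E0) (mset_set V)"
    using assms realizesD(2)[OF assms] by (intro image_mset_cong) (simp add: realizes_def)
  then show ?thesis using assms by (simp add: realization_def degree_sequence_def realizes_def)
qed

theorem theorem4p3:
  fixes t n :: nat and \<pi> :: "nat list"
  assumes "t \<ge> 2"
    and "n \<ge> 20 * t\<^sup>2 + 31 * t + 12"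
    and "length \<pi> = n"
    and "graphic \<pi>"
    and "int (sum_list \<pi>) > 4 * int t * int n - 4 * (int t)\<^sup>2 - 2 * int t"
  shows "\<exists>(V :: nat set) E. realization V E \<pi> \<and>
    (\<forall>(W :: nat set) F. two_tree W F \<and> card W = 3 * t + 2 \<longrightarrow> contains_subgraph V E W F)"
proof -
  obtain V :: "nat set" and E0 where V: "simple_graph V E0" "degree_sequence V E0 = \<pi>"
    using assms(4) by (auto simp: graphic_def realization_def)
  have n: "card V = n" "int (sum_list \<pi>) = int (\<Sum>v\<in>V. degree E0 v)"
    using degree_sequence_facts[of V E0] V(2) assms(3) by simp_all
  \<comment> \<open>The degree function of one realization is fixed; switching preserves degrees
    vertex by vertex, hence also the sequence.\<close>
  interpret dense_degrees V "degree E0" t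
  proof
    have "realizes V (degree E0) E0" using V(1) by (simp add: realizes_def)
    then show "\<exists>E. realizes V (degree E0) E" by blast
  qed (use assms n in auto)
  obtain E where E: "realizes V (degree E0) E"
    "\<forall>(W :: nat set) F. two_tree W F \<and> card W = 3 * t + 2 \<longrightarrow> contains_subgraph V E W F"
    using universal_realization by blast
  then show ?thesis using realizes_degree_sequence[OF E(1)] V(2) by blast
qed

end
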